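(* Let $(k,D_k)$ be a differential field, $\mathcal C$ a finite $D_k$-category over $k$, $X$ an object in $\mathcal C$, and $l$ a $D_k$-field over $k$. Suppose that $(k,D_k)$ is filtered-linearly closed and there is a morphism of differential fields $(k,D_k)\to(K,D_K)$ together with a faithful differential functor $\mathcal C\to\mathrm{Vect}(K)$. Then there is a $D_k$-structure on $X$ in $\mathcal C$ if and only if there is a $D_l$-structure on $l\otimes_kX$ in $l\otimes_k\mathcal C$.
   Context: Differential field: a pair $(k,D_k)$, where $k$ is a field of characteristic zero and $D_k$ is a finite-dimensional $k$-vector space with a Lie bracket (additive, not necessarily $k$-linear) and a $k$-linear homomorphism of Lie rings $D_k\to\mathrm{Der}(k,k)$ (not necessarily injective) with $[\partial,a\delta]=a[\partial,\delta]+\partial(a)\delta$. Put $\Omega_k:=D_k^\vee$, $\Omega_k^i:=\wedge^i_k\Omega_k$, with the de Rham differential $\mathbf d$: $\mathbf d a(\partial)=\partial(a)$, $\mathbf d\omega(\partial,\delta)=\partial(\omega(\delta))-\delta(\omega(\partial))-\omega([\partial,\delta])$, extended by the graded Leibniz rule. A $D_k$-module is a $k$-vector space $M$ with a biadditive action of $D_k$, $k$-linear in $D_k$, with $\partial(am)=\partial(a)m+a\partial(m)$ and $[\partial,\delta]m=\partial(\delta m)-\delta(\partial m)$; it is trivial if $k\otimes_{k^{D_k}}M^{D_k}\to M$ is an isomorphism ($(\cdot)^{D_k}$ = elements annihilated by $D_k$). For a subspace $D\subset D_k$ closed under the bracket, $k$ is linearly $D$-closed if all finite-dimensional $D$-modules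 over $k$ are trivial. $(k,D_k)$ is filtered-linearly closed if there are $k$-subspaces closed under the bracket $0=D_0\subset D_1\subset\ldots\subset D_d=D_k$ with $\dim_k(D_{i+1}/D_i)=1$ and $k$ linearly $D_i$-closed for $0\leqslant i\leqslant d-1$. A $D_k$-field over $k$ is a field extension $l$ of $k$ that is a $D_k$-module with $D_k$ acting by derivations extending those of $k$; put $D_l:=l\otimes_kD_k$, so that $(l,D_l)$ is a differential field. Morphism of differential fields $(k,D_k)\to(K,D_K)$: a field homomorphism $k\to K$ and a $K$-linear map $D_K\to K\otimes_kD_k$ such that if $\delta\mapsto\sum b_i\otimes\partial_i$ then $\delta(a)=\sum b_i\partial_i(a)$ for $a\in k$, and such that the canonical $k$-linear map $\Omega_k\to\Omega_K$ obtained by duality induces a homomorphism $\Omega^\bullet_k\to\Omega^\bullet_K$ commuting with $\mathbf d$. Jet rings: $P^1_k:=k\oplus\Omega_k$ with $\Omega_k\cdot\Omega_k=0$ and two ring homomorphisms $\lambda,\rho:k\to P^1_k$, $\lambda(a)=a$, $\rho(a)=a+\mathbf d a$. In $P^1_k\otimes_kP^1_k$ (the first factor taken with $\rho$, the second with $\lambda$) let $P^2_k$ be the subring of elements $b\otimes1+\omega\otimes1+1\otimes\omega+\tau$ with $b\in k$, $\omega\in\Omega_k$, and $\tau\in\Omega_k\otimes_k\Omega_k$ whose image in $\Omega_k^2$ is $-\mathbf d\omega$; it has $\lambda(a)=\lambda(a)\otimes1$ and $\rho(a)=1\otimes\rho(a)$. $D_k$-category over $k$: an abelian $k$-linear tensor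 category $\mathcal C$ with exact functors (Atiyah functors) $\mathrm{At}^i_{\mathcal C}:\mathcal C\to\mathcal C$, $i=1,2$, such that: (a) $\mathrm{At}^i_{\mathcal C}(X)$ has a functorial action of $P^i_k$ in which $\rho(a)$ acts as the scalar $a\in k$, $\mathrm{At}^i_{\mathcal C}$ is $k$-linear with respect to the $k$-structure given by $\lambda$, that is, it is additive and $\mathrm{At}^i_{\mathcal C}(af)=\lambda(a)\circ\mathrm{At}^i_{\mathcal C}(f)$ for morphisms $f$ and $a\in k$, and $\mathrm{At}^i_{\mathcal C}$ is a tensor functor to $P^i_k$-modules in $\mathcal C$; (b) there is a functorial tensor isomorphism $k\otimes_{P^1_k}\mathrm{At}^1_{\mathcal C}(X)\cong X$ giving a functorial exact sequence $0\to\Omega_k\otimes_kX\xrightarrow{i_X}\mathrm{At}^1_{\mathcal C}(X)\xrightarrow{\pi_X}X\to0$, where $\omega\in\Omega_k\subset P^1_k$ acts on $\mathrm{At}^1_{\mathcal C}(X)$ as $i_X\circ(\omega\otimes\pi_X)$; (c) there is a functorial $P^2_k$-linear tensor embedding $\mathrm{At}^2_{\mathcal C}(X)\subset\mathrm{At}^1_{\mathcal C}(\mathrm{At}^1_{\mathcal C}(X))$ inducing an isomorphism $(P^1_k\otimes_kP^1_k)\otimes_{P^2_k}\mathrm{At}^2_{\mathcal C}(X)\cong\mathrm{At}^1_{\mathcal C}(\mathrm{At}^1_{\mathcal C}(X))$. In particular $\mathrm{Sym}^2_k\Omega_k\otimes_kX=\mathrm{At}^2_{\mathcal C}(X)\cap(\Omega_k\otimes_k\Omega_k\otimes_kX)$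 inside $\mathrm{At}^1_{\mathcal C}(\mathrm{At}^1_{\mathcal C}(X))$, and the compositions of $\mathrm{At}^2_{\mathcal C}(X)\to\mathrm{At}^1_{\mathcal C}(\mathrm{At}^1_{\mathcal C}(X))$ with $\mathrm{At}^1_{\mathcal C}(\pi_X)$ and with $\pi_{\mathrm{At}^1_{\mathcal C}(X)}$ are both surjective onto $\mathrm{At}^1_{\mathcal C}(X)$. $\mathrm{Vect}(K)$, the category of $K$-vector spaces, has a canonical $D_K$-structure: $\mathrm{At}^i(W)=W\otimes_{K,\lambda}P^i_K$ with $K$-structure via $\rho$. A differential functor $F:\mathcal C\to\mathcal D$ from a $D_k$-category to a $D_K$-category (given a morphism $(k,D_k)\to(K,D_K)$) is an exact $k$-linear tensor functor with functorial tensor isomorphisms $P^i_K\otimes_{K\otimes_{k,\rho}P^i_k}F(\mathrm{At}^i_{\mathcal C}(X))\cong\mathrm{At}^i_{\mathcal D}(F(X))$, $i=1,2$, compatible with (b) and (c). Finite: all Hom-spaces of $\mathcal C$ are finite-dimensional over $k$ and all objects have finite length. Extension of scalars: for finite $\mathcal C$, $l\otimes_k\mathcal C$ is the category of those $l$-modules in $\mathrm{Ind}(\mathcal C)$ that are cokernels of morphisms $l\otimes_kX\to l\otimes_kX'$ with $X,X'$ in $\mathcal C$; it is an abelian $l$-linear tensor category, $l\otimes_k-:\mathcal C\to l\otimes_k\mathcal C$ is an exact $k$-linear tensor functor, and $\mathrm{Hom}(l\otimes_kX,l\otimes_kX')=l\otimes_k\mathrm{Hom}_{\mathcal C}(X,X')$.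 It has a canonical $D_l$-category structure, with $\mathrm{At}^i(l\otimes_kX)=l\otimes_k\mathrm{At}^i_{\mathcal C}(X)$ (acted on by $P^i_l=l\otimes_{k,\rho}P^i_k$), $\mathrm{At}^i(b\otimes f)=\lambda(b)\circ(\mathrm{id}_l\otimes\mathrm{At}^i_{\mathcal C}(f))$, and $\pi$ and the embedding of $\mathrm{At}^2$ into $\mathrm{At}^1\circ\mathrm{At}^1$ obtained by extension of scalars. A $D_k$-connection on $X$ is a morphism $s_X:X\to\mathrm{At}^1_{\mathcal C}(X)$ with $\pi_X\circ s_X=\mathrm{id}_X$; it is a $D_k$-structure on $X$ if the image of $\mathrm{At}^1_{\mathcal C}(s_X)\circ s_X$ is contained in $\mathrm{At}^2_{\mathcal C}(X)$. The same definition applies to $l\otimes_k\mathcal C$ as a $D_l$-category. *)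

theory Defs
  imports "HOL-Algebra.Module"
begin

section \<open>Vector spaces and tensor products\<close>

text \<open>
  Fields are types.  A vector space is a \<^type>\<open>module\<close> record of HOL-Algebra over \<open>fld\<close>; the
  components \<open>mult\<close> and \<open>one\<close>, which such a record inherits from rings, play no role.
\<close>

abbreviation fld :: "'k::field ring" where
  "fld \<equiv> \<lparr>carrier = UNIV, mult = (*), one = 1, zero = 0, add = (+)\<rparr>"

definition tspace :: "('k \<Rightarrow> 'v \<Rightarrow> 'v) \<Rightarrow> ('k, 'v::ab_group_add) module" where
  "tspace s = \<lparr>carrier = UNIV, mult = undefined, one = undefined, zero = 0, add = (+), smult = s\<rparr>"

definition fin_dim :: "('k::field, 'v) module \<Rightarrow> bool" where
  "fin_dim V \<longleftrightarrow> (\<exists>B. finite B \<and> B \<subseteq> carrier V \<and>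
     (\<forall>v\<in>carrier V. \<exists>c. v = (\<Oplus>\<^bsub>V\<^esub>b\<in>B. c b \<odot>\<^bsub>V\<^esub> b)))"

definition semilin_map ::
    "'k set \<Rightarrow> ('k \<Rightarrow> 'l) \<Rightarrow> ('k, 'v) module \<Rightarrow> ('l, 'w) module \<Rightarrow> ('v \<Rightarrow> 'w) \<Rightarrow> bool" where
  "semilin_map S \<phi> V W h \<longleftrightarrow> h \<in> carrier V \<rightarrow> carrier W \<and>
     (\<forall>v\<in>carrier V. \<forall>w\<in>carrier V. h (v \<oplus>\<^bsub>V\<^esub> w) = h v \<oplus>\<^bsub>W\<^esub> h w) \<and>
     (\<forall>a\<in>S. \<forall>v\<in>carrier V. h (a \<odot>\<^bsub>V\<^esub> v) = \<phi> a \<odot>\<^bsub>W\<^esub> h v)"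

abbreviation lin_map :: "('k, 'v) module \<Rightarrow> ('k, 'w) module \<Rightarrow> ('v \<Rightarrow> 'w) \<Rightarrow> bool" where
  "lin_map \<equiv> semilin_map UNIV id"

text \<open>
  Let \<open>S\<close> be a subfield of \<open>'k\<close>, embedded into \<open>'l\<close> by \<open>\<phi>\<close>.  The tensor product
  of \<open>'l\<close> and \<open>V\<close> over \<open>S\<close> is the free \<open>'l\<close>-vector space on the set
  \<open>carrier V\<close> (finitely supported functions) modulo the relations of additivity and
  \<open>S\<close>-homogeneity; the basis vector \<open>single v\<close> represents the tensor of \<open>1\<close> and \<open>v\<close>.
\<close>

definition single :: "'v \<Rightarrow> 'v \<Rightarrow> 'l::field" where
  "single v = (\<lambda>w. if w = v then 1 else 0)"

definition fin_supp :: "'v set \<Rightarrow> ('v \<Rightarrow> 'l::field) set" where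
  "fin_supp A = {f. finite {v. f v \<noteq> 0} \<and> {v. f v \<noteq> 0} \<subseteq> A}"

inductive_set tensor_null ::
    "'k set \<Rightarrow> ('k \<Rightarrow> 'l::field) \<Rightarrow> ('k, 'v) module \<Rightarrow> ('v \<Rightarrow> 'l) set"
  for S \<phi> V where
  null_zero: "(\<lambda>x. 0) \<in> tensor_null S \<phi> V"
| null_add: "f \<in> tensor_null S \<phi> V \<Longrightarrow> g \<in> tensor_null S \<phi> V \<Longrightarrow> (\<lambda>x. f x + g x) \<in> tensor_null S \<phi> V"
| null_smult: "f \<in> tensor_null S \<phi> V \<Longrightarrow> (\<lambda>x. c * f x) \<in> tensor_null S \<phi> V"
| rel_add: "v \<in> carrier V \<Longrightarrow> w \<in> carrier V \<Longrightarrow>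
    (\<lambda>x. single (v \<oplus>\<^bsub>V\<^esub> w) x - single v x - single w x) \<in> tensor_null S \<phi> V"
| rel_smult: "a \<in> S \<Longrightarrow> v \<in> carrier V \<Longrightarrow>
    (\<lambda>x. single (a \<odot>\<^bsub>V\<^esub> v) x - \<phi> a * single v x) \<in> tensor_null S \<phi> V"

definition tensor_class ::
    "'k set \<Rightarrow> ('k \<Rightarrow> 'l::field) \<Rightarrow> ('k, 'v) module \<Rightarrow> ('v \<Rightarrow> 'l) \<Rightarrow> ('v \<Rightarrow> 'l) set" where
  "tensor_class S \<phi> V f = {g \<in> fin_supp (carrier V). (\<lambda>x. g x - f x) \<in> tensor_null S \<phi> V}"

definition tensor_space ::
    "'k set \<Rightarrow> ('k \<Rightarrow> 'l::field) \<Rightarrow> ('k, 'v) module \<Rightarrow> ('l, ('v \<Rightarrow> 'l) set) module" where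
  "tensor_space S \<phi> V = \<lparr>carrier = tensor_class S \<phi> V ` fin_supp (carrier V),
     mult = undefined, one = undefined,
     zero = tensor_class S \<phi> V (\<lambda>x. 0),
     add = (\<lambda>P Q. \<Union>f\<in>P. \<Union>g\<in>Q. tensor_class S \<phi> V (\<lambda>x. f x + g x)),
     smult = (\<lambda>b P. \<Union>f\<in>P. tensor_class S \<phi> V (\<lambda>x. b * f x))\<rparr>"

definition lin_ext :: "('l::field, 'w) module \<Rightarrow> ('v \<Rightarrow> 'w) \<Rightarrow> ('v \<Rightarrow> 'l) \<Rightarrow> 'w" where
  "lin_ext W j f = (\<Oplus>\<^bsub>W\<^esub>v\<in>{v. f v \<noteq> 0}. f v \<odot>\<^bsub>W\<^esub> j v)"

text \<open>
  The \<open>'l\<close>-linear map from the tensor product to \<open>W\<close> induced by the semilinear map \<open>j\<close> is an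
  isomorphism.
\<close>

definition is_scalar_extension ::
    "'k set \<Rightarrow> ('k \<Rightarrow> 'l::field) \<Rightarrow> ('k, 'v) module \<Rightarrow> ('l, 'w) module \<Rightarrow> ('v \<Rightarrow> 'w) \<Rightarrow> bool" where
  "is_scalar_extension S \<phi> V W j \<longleftrightarrow> semilin_map S \<phi> V W j \<and>
     bij_betw (\<lambda>P. the_elem (lin_ext W j ` P)) (carrier (tensor_space S \<phi> V)) (carrier W)"

definition field_hom :: "('k::field \<Rightarrow> 'l::field) \<Rightarrow> bool" where
  "field_hom \<phi> \<longleftrightarrow> \<phi> 1 = 1 \<and> (\<forall>a b. \<phi> (a + b) = \<phi> a + \<phi> b) \<and> (\<forall>a b. \<phi> (a * b) = \<phi> a * \<phi> b)"


section \<open>Differential fields\<close>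

text \<open>The vector space \<open>D\<^sub>k\<close> is the whole type \<open>'d\<close>, with scalar multiplication \<open>scl\<close>.\<close>

record ('k, 'd) dfield =
  scl :: "'k \<Rightarrow> 'd \<Rightarrow> 'd"
  lie :: "'d \<Rightarrow> 'd \<Rightarrow> 'd"
  der :: "'d \<Rightarrow> 'k \<Rightarrow> 'k"

abbreviation dspace :: "('k, 'd::ab_group_add) dfield \<Rightarrow> ('k, 'd) module" where
  "dspace D \<equiv> tspace (scl D)"

definition differential_field :: "('k::field_char_0, 'd::ab_group_add) dfield \<Rightarrow> bool" where
  "differential_field D \<longleftrightarrow>
     module fld (dspace D) \<and> fin_dim (dspace D) \<and>
     (\<forall>x y z. lie D (x + y) z = lie D x z + lie D y z) \<and>
     (\<forall>x y z. lie D x (y + z) = lie D x y + lie D x z) \<and>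
     (\<forall>x. lie D x x = 0) \<and>
     (\<forall>x y z. lie D x (lie D y z) + lie D y (lie D z x) + lie D z (lie D x y) = 0) \<and>
     (\<forall>x a b. der D x (a + b) = der D x a + der D x b) \<and>
     (\<forall>x a b. der D x (a * b) = der D x a * b + a * der D x b) \<and>
     (\<forall>x y a. der D (x + y) a = der D x a + der D y a) \<and>
     (\<forall>c x a. der D (scl D c x) a = c * der D x a) \<and>
     (\<forall>x y a. der D (lie D x y) a = der D x (der D y a) - der D y (der D x a)) \<and>
     (\<forall>x a y. lie D x (scl D a y) = scl D a (lie D x y) + scl D (der D x a) y)"

text \<open>
  \<open>S\<close> is a subspace of \<open>D\<^sub>k\<close> closed under the bracket, and \<open>act\<close> is only considered on \<open>S\<close>.
\<close>

definition dmodule ::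
    "('k::field_char_0, 'd::ab_group_add) dfield \<Rightarrow> 'd set \<Rightarrow> ('k, 'm) module \<Rightarrow> ('d \<Rightarrow> 'm \<Rightarrow> 'm) \<Rightarrow> bool"
  where
  "dmodule D S M act \<longleftrightarrow> module fld M \<and>
     (\<forall>x\<in>S. act x \<in> carrier M \<rightarrow> carrier M) \<and>
     (\<forall>x\<in>S. \<forall>m\<in>carrier M. \<forall>n\<in>carrier M. act x (m \<oplus>\<^bsub>M\<^esub> n) = act x m \<oplus>\<^bsub>M\<^esub> act x n) \<and>
     (\<forall>x\<in>S. \<forall>y\<in>S. \<forall>m\<in>carrier M. act (x + y) m = act x m \<oplus>\<^bsub>M\<^esub> act y m) \<and>
     (\<forall>c. \<forall>x\<in>S. \<forall>m\<in>carrier M. act (scl D c x) m = c \<odot>\<^bsub>M\<^esub> act x m) \<and>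
     (\<forall>x\<in>S. \<forall>a. \<forall>m\<in>carrier M. act x (a \<odot>\<^bsub>M\<^esub> m) = der D x a \<odot>\<^bsub>M\<^esub> m \<oplus>\<^bsub>M\<^esub> a \<odot>\<^bsub>M\<^esub> act x m) \<and>
     (\<forall>x\<in>S. \<forall>y\<in>S. \<forall>m\<in>carrier M. act (lie D x y) m = act x (act y m) \<ominus>\<^bsub>M\<^esub> act y (act x m))"

definition constants :: "('k::field_char_0, 'd) dfield \<Rightarrow> 'd set \<Rightarrow> 'k set" where
  "constants D S = {a. \<forall>x\<in>S. der D x a = 0}"

definition invariants :: "'d set \<Rightarrow> ('k, 'm) module \<Rightarrow> ('d \<Rightarrow> 'm \<Rightarrow> 'm) \<Rightarrow> ('k, 'm) module" where
  "invariants S M act = M\<lparr>carrier := {m \<in> carrier M. \<forall>x\<in>S. act x m = \<zero>\<^bsub>M\<^esub>}\<rparr>"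

definition trivial_dmodule ::
    "('k::field_char_0, 'd) dfield \<Rightarrow> 'd set \<Rightarrow> ('k, 'm) module \<Rightarrow> ('d \<Rightarrow> 'm \<Rightarrow> 'm) \<Rightarrow> bool" where
  "trivial_dmodule D S M act \<longleftrightarrow> is_scalar_extension (constants D S) id (invariants S M act) M id"

text \<open>
  The modules range over all vector spaces whose carrier is a subset of the type
  \<open>nat \<Rightarrow> 'k\<close>; every finite-dimensional vector space is isomorphic to one of these.
\<close>

definition linearly_closed :: "('k::field_char_0, 'd::ab_group_add) dfield \<Rightarrow> 'd set \<Rightarrow> bool" where
  "linearly_closed D S \<longleftrightarrow> (\<forall>(M :: ('k, nat \<Rightarrow> 'k) module) act.
     dmodule D S M act \<and> fin_dim M \<longrightarrow> trivial_dmodule D S M act)"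

text \<open>The condition on \<open>v\<close> says that the quotient of \<open>F (Suc i)\<close> by \<open>F i\<close> is one-dimensional.\<close>

definition filtered_linearly_closed :: "('k::field_char_0, 'd::ab_group_add) dfield \<Rightarrow> bool" where
  "filtered_linearly_closed D \<longleftrightarrow> (\<exists>(d::nat) F. F 0 = {0} \<and> F d = UNIV \<and>
     (\<forall>i\<le>d. submodule (F i) fld (dspace D) \<and> (\<forall>x\<in>F i. \<forall>y\<in>F i. lie D x y \<in> F i)) \<and>
     (\<forall>i<d. F i \<subseteq> F (Suc i) \<and>
        (\<exists>v. v \<notin> F i \<and> F (Suc i) = {w + scl D a v | w a. w \<in> F i}) \<and>
        linearly_closed D (F i)))"

text \<open>
  A \<open>D\<^sub>k\<close>-field \<open>'l\<close> over \<open>'k\<close>, with structure map \<open>\<phi>\<close> and action \<open>dl\<close> of \<open>D\<^sub>k\<close>.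
\<close>

definition D_field ::
    "('k::field_char_0, 'd::ab_group_add) dfield \<Rightarrow> ('k \<Rightarrow> 'l::field_char_0) \<Rightarrow> ('d \<Rightarrow> 'l \<Rightarrow> 'l) \<Rightarrow> bool"
  where
  "D_field D \<phi> dl \<longleftrightarrow> field_hom \<phi> \<and> dmodule D UNIV (tspace (\<lambda>a x. \<phi> a * x)) dl \<and>
     (\<forall>x b c. dl x (b * c) = dl x b * c + b * dl x c) \<and>
     (\<forall>x a. dl x (\<phi> a) = \<phi> (der D x a))"

text \<open>
  \<open>Dl\<close> is the differential field \<open>(l, D\<^sub>l)\<close>, where \<open>D\<^sub>l\<close> is the tensor product of \<open>l\<close> and
  \<open>D\<^sub>k\<close>; \<open>j\<close> sends \<open>x\<close> to the tensor of \<open>1\<close> and \<open>x\<close>.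
\<close>

definition D_field_extension ::
    "('k::field_char_0, 'd::ab_group_add) dfield \<Rightarrow> ('k \<Rightarrow> 'l::field_char_0) \<Rightarrow> ('d \<Rightarrow> 'l \<Rightarrow> 'l) \<Rightarrow>
      ('l, 'e::ab_group_add) dfield \<Rightarrow> ('d \<Rightarrow> 'e) \<Rightarrow> bool" where
  "D_field_extension D \<phi> dl Dl j \<longleftrightarrow> differential_field Dl \<and>
     is_scalar_extension UNIV \<phi> (dspace D) (dspace Dl) j \<and>
     (\<forall>x y. lie Dl (j x) (j y) = j (lie D x y)) \<and>
     (\<forall>x b. der Dl (j x) b = dl x b)"


section \<open>Forms, morphisms of differential fields, jet rings\<close>

text \<open>
  One-forms are the linear functions on \<open>D\<^sub>k\<close>.  As \<open>D\<^sub>k\<close> is finite-dimensional, the tensor square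
  of the space of one-forms is the space of bilinear forms, the tensor of \<open>\<omega>\<close> and \<open>\<eta>\<close> being
  \<open>\<lambda>x y. \<omega> x * \<eta> y\<close>; the second exterior power is the space of alternating bilinear forms, and
  the projection is antisymmetrization \<open>\<lambda>x y. \<tau> x y - \<tau> y x\<close>.
\<close>

definition forms1 :: "('k::field_char_0, 'd::ab_group_add) dfield \<Rightarrow> ('d \<Rightarrow> 'k) set" where
  "forms1 D = {\<omega>. (\<forall>x y. \<omega> (x + y) = \<omega> x + \<omega> y) \<and> (\<forall>a x. \<omega> (scl D a x) = a * \<omega> x)}"

definition forms11 :: "('k::field_char_0, 'd::ab_group_add) dfield \<Rightarrow> ('d \<Rightarrow> 'd \<Rightarrow> 'k) set" where
  "forms11 D = {\<tau>. (\<forall>x. \<tau> x \<in> forms1 D) \<and> (\<forall>y. (\<lambda>x. \<tau> x y) \<in> forms1 D)}"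

definition d0 :: "('k::field_char_0, 'd::ab_group_add) dfield \<Rightarrow> 'k \<Rightarrow> 'd \<Rightarrow> 'k" where
  "d0 D a = (\<lambda>x. der D x a)"

definition d1 :: "('k::field_char_0, 'd::ab_group_add) dfield \<Rightarrow> ('d \<Rightarrow> 'k) \<Rightarrow> 'd \<Rightarrow> 'd \<Rightarrow> 'k" where
  "d1 D \<omega> = (\<lambda>x y. der D x (\<omega> y) - der D y (\<omega> x) - \<omega> (lie D x y))"

definition omega :: "('k::field_char_0, 'd::ab_group_add) dfield \<Rightarrow> ('k, 'd \<Rightarrow> 'k) module" where
  "omega D = \<lparr>carrier = forms1 D, mult = undefined, one = undefined, zero = (\<lambda>x. 0),
     add = (\<lambda>\<omega> \<eta> x. \<omega> x + \<eta> x), smult = (\<lambda>a \<omega> x. a * \<omega> x)\<rparr>"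

text \<open>
  Let \<open>T\<close> be a linear map from \<open>D\<^sub>K\<close> to the scalar extension of \<open>D\<^sub>k\<close> along \<open>\<phi>\<close>.  The dual maps on
  one-forms and on bilinear forms are computed on an arbitrary representative of the tensor
  \<open>T \<delta>\<close>.
\<close>

definition pull1 ::
    "('k::field_char_0 \<Rightarrow> 'l::field_char_0) \<Rightarrow> ('e \<Rightarrow> ('d \<Rightarrow> 'l) set) \<Rightarrow> ('d \<Rightarrow> 'k) \<Rightarrow> 'e \<Rightarrow> 'l" where
  "pull1 \<phi> T \<omega> = (\<lambda>\<delta>. the_elem ((\<lambda>f. \<Sum>v\<in>{v. f v \<noteq> 0}. f v * \<phi> (\<omega> v)) ` T \<delta>))"

definition pull2 ::
    "('k::field_char_0 \<Rightarrow> 'l::field_char_0) \<Rightarrow> ('e \<Rightarrow> ('d \<Rightarrow> 'l) set) \<Rightarrow> ('d \<Rightarrow> 'd \<Rightarrow> 'k) \<Rightarrow> 'e \<Rightarrow> 'e \<Rightarrow> 'l" where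
  "pull2 \<phi> T \<tau> = (\<lambda>\<delta> \<epsilon>. the_elem ((\<lambda>(f, g). \<Sum>v\<in>{v. f v \<noteq> 0}. \<Sum>w\<in>{w. g w \<noteq> 0}.
     f v * g w * \<phi> (\<tau> v w)) ` (T \<delta> \<times> T \<epsilon>)))"

text \<open>
  The de Rham algebra is generated in degrees \<open>0\<close> and \<open>1\<close> and its differential is determined
  there by the Leibniz rule, so that it suffices to ask for compatibility with the differential
  in these degrees.
\<close>

definition differential_morphism ::
    "('k::field_char_0, 'd::ab_group_add) dfield \<Rightarrow> ('l::field_char_0, 'e::ab_group_add) dfield \<Rightarrow>
      ('k \<Rightarrow> 'l) \<Rightarrow> ('e \<Rightarrow> ('d \<Rightarrow> 'l) set) \<Rightarrow> bool" where
  "differential_morphism D D' \<phi> T \<longleftrightarrow> field_hom \<phi> \<and>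
     lin_map (dspace D') (tensor_space UNIV \<phi> (dspace D)) T \<and>
     (\<forall>\<delta> a. \<forall>f\<in>T \<delta>. der D' \<delta> (\<phi> a) = (\<Sum>v\<in>{v. f v \<noteq> 0}. f v * \<phi> (der D v a))) \<and>
     (\<forall>a. d0 D' (\<phi> a) = pull1 \<phi> T (d0 D a)) \<and>
     (\<forall>\<omega>\<in>forms1 D. d1 D' (pull1 \<phi> T \<omega>) = pull2 \<phi> T (d1 D \<omega>))"

text \<open>The identity of \<open>D\<^sub>l\<close>, as a map to the tensor product of \<open>l\<close> and \<open>D\<^sub>k\<close>.\<close>

definition extension_morphism ::
    "('l::field_char_0, 'e::ab_group_add) dfield \<Rightarrow> ('d \<Rightarrow> 'e) \<Rightarrow> 'e \<Rightarrow> ('d \<Rightarrow> 'l) set" where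
  "extension_morphism Dl j = (\<lambda>\<delta>. {f \<in> fin_supp UNIV. lin_ext (dspace Dl) j f = \<delta>})"

type_synonym ('k, 'd) jt1 = "'k \<times> ('d \<Rightarrow> 'k)"
type_synonym ('k, 'd) jt2 = "'k \<times> ('d \<Rightarrow> 'k) \<times> ('d \<Rightarrow> 'k) \<times> ('d \<Rightarrow> 'd \<Rightarrow> 'k)"

definition jet1 :: "('k::field_char_0, 'd::ab_group_add) dfield \<Rightarrow> ('k, 'd) jt1 ring" where
  "jet1 D = \<lparr>carrier = UNIV \<times> forms1 D,
     mult = (\<lambda>(a, \<alpha>) (b, \<beta>). (a * b, \<lambda>x. a * \<beta> x + b * \<alpha> x)),
     one = (1, \<lambda>x. 0), zero = (0, \<lambda>x. 0),
     add = (\<lambda>(a, \<alpha>) (b, \<beta>). (a + b, \<lambda>x. \<alpha> x + \<beta> x))\<rparr>"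

definition lam1 :: "'k::field_char_0 \<Rightarrow> ('k, 'd) jt1" where
  "lam1 a = (a, \<lambda>x. 0)"

definition rho1 :: "('k::field_char_0, 'd::ab_group_add) dfield \<Rightarrow> 'k \<Rightarrow> ('k, 'd) jt1" where
  "rho1 D a = (a, d0 D a)"

text \<open>
  The ring \<open>P\<^sup>1 \<otimes> P\<^sup>1\<close>, where the left factor is taken with \<open>\<rho>\<close> and the right one with \<open>\<lambda>\<close>.
  Each element is uniquely of the form \<open>b \<otimes> 1 + \<omega> \<otimes> 1 + 1 \<otimes> \<omega>' + \<tau>\<close> and is represented by
  \<open>(b, \<omega>, \<omega>', \<tau>)\<close>.  The terms with \<open>d0\<close> come from
  \<open>b \<otimes> \<omega> = (\<rho>(b) - db) \<otimes> \<omega> = 1 \<otimes> b\<omega> - db \<otimes> \<omega>\<close> and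
  \<open>a \<otimes> b = a\<rho>(b) \<otimes> 1 = ab \<otimes> 1 + a db \<otimes> 1\<close>.
\<close>

definition jet11 :: "('k::field_char_0, 'd::ab_group_add) dfield \<Rightarrow> ('k, 'd) jt2 ring" where
  "jet11 D = \<lparr>carrier = UNIV \<times> forms1 D \<times> forms1 D \<times> forms11 D,
     mult = (\<lambda>(a, \<alpha>, \<alpha>', \<sigma>) (b, \<beta>, \<beta>', \<tau>).
       (a * b, \<lambda>x. a * \<beta> x + b * \<alpha> x, \<lambda>x. a * \<beta>' x + b * \<alpha>' x,
        \<lambda>x y. a * \<tau> x y + b * \<sigma> x y + \<alpha> x * \<beta>' y + \<beta> x * \<alpha>' y
               - d0 D a x * \<beta>' y - d0 D b x * \<alpha>' y)),
     one = (1, \<lambda>x. 0, \<lambda>x. 0, \<lambda>x y. 0), zero = (0, \<lambda>x. 0, \<lambda>x. 0, \<lambda>x y. 0),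
     add = (\<lambda>(a, \<alpha>, \<alpha>', \<sigma>) (b, \<beta>, \<beta>', \<tau>).
       (a + b, \<lambda>x. \<alpha> x + \<beta> x, \<lambda>x. \<alpha>' x + \<beta>' x, \<lambda>x y. \<sigma> x y + \<tau> x y))\<rparr>"

definition jet_tensor ::
    "('k::field_char_0, 'd::ab_group_add) dfield \<Rightarrow> ('k, 'd) jt1 \<Rightarrow> ('k, 'd) jt1 \<Rightarrow> ('k, 'd) jt2" where
  "jet_tensor D = (\<lambda>(a, \<alpha>) (b, \<beta>). (a * b, \<lambda>x. b * \<alpha> x + a * d0 D b x, \<lambda>x. a * \<beta> x,
     \<lambda>x y. \<alpha> x * \<beta> y - d0 D a x * \<beta> y))"

definition jet2 :: "('k::field_char_0, 'd::ab_group_add) dfield \<Rightarrow> ('k, 'd) jt2 ring" where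
  "jet2 D = (jet11 D)\<lparr>carrier := {(b, \<omega>, \<omega>', \<tau>). \<omega> \<in> forms1 D \<and> \<omega>' = \<omega> \<and> \<tau> \<in> forms11 D \<and>
     (\<forall>x y. \<tau> x y - \<tau> y x = - d1 D \<omega> x y)}\<rparr>"

definition lam2 :: "('k::field_char_0, 'd::ab_group_add) dfield \<Rightarrow> 'k \<Rightarrow> ('k, 'd) jt2" where
  "lam2 D a = jet_tensor D (lam1 a) (1, \<lambda>x. 0)"

definition rho2 :: "('k::field_char_0, 'd::ab_group_add) dfield \<Rightarrow> 'k \<Rightarrow> ('k, 'd) jt2" where
  "rho2 D a = jet_tensor D (1, \<lambda>x. 0) (rho1 D a)"

definition jet_map1 ::
    "('k::field_char_0 \<Rightarrow> 'l::field_char_0) \<Rightarrow> ('e \<Rightarrow> ('d \<Rightarrow> 'l) set) \<Rightarrow> ('k, 'd) jt1 \<Rightarrow> ('l, 'e) jt1" where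
  "jet_map1 \<phi> T = (\<lambda>(a, \<alpha>). (\<phi> a, pull1 \<phi> T \<alpha>))"

definition jet_map2 ::
    "('k::field_char_0 \<Rightarrow> 'l::field_char_0) \<Rightarrow> ('e \<Rightarrow> ('d \<Rightarrow> 'l) set) \<Rightarrow> ('k, 'd) jt2 \<Rightarrow> ('l, 'e) jt2" where
  "jet_map2 \<phi> T = (\<lambda>(a, \<alpha>, \<alpha>', \<tau>). (\<phi> a, pull1 \<phi> T \<alpha>, pull1 \<phi> T \<alpha>', pull2 \<phi> T \<tau>))"


section \<open>Linear and abelian categories\<close>

text \<open>\<open>g \<cdot> f\<close> is the composition of \<open>f\<close> followed by \<open>g\<close>.\<close>

record ('o, 'a, 'k) lcat =
  obj :: "'o set"
  arr :: "'a set"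
  src :: "'a \<Rightarrow> 'o"
  tgt :: "'a \<Rightarrow> 'o"
  idt :: "'o \<Rightarrow> 'a"
  cmp :: "'a \<Rightarrow> 'a \<Rightarrow> 'a"  (infixr "\<cdot>\<index>" 70)
  hzero :: "'o \<Rightarrow> 'o \<Rightarrow> 'a"
  hadd :: "'a \<Rightarrow> 'a \<Rightarrow> 'a"
  hscal :: "'k \<Rightarrow> 'a \<Rightarrow> 'a"

definition homs :: "('o, 'a, 'k) lcat \<Rightarrow> 'o \<Rightarrow> 'o \<Rightarrow> 'a set" where
  "homs C X Y = {f \<in> arr C. src C f = X \<and> tgt C f = Y}"

definition hspace :: "('o, 'a, 'k) lcat \<Rightarrow> 'o \<Rightarrow> 'o \<Rightarrow> ('k, 'a) module" where
  "hspace C X Y = \<lparr>carrier = homs C X Y, mult = undefined, one = undefined,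
     zero = hzero C X Y, add = hadd C, smult = hscal C\<rparr>"

definition linear_category :: "('o, 'a, 'k::field) lcat \<Rightarrow> bool" where
  "linear_category C \<longleftrightarrow>
     (\<forall>f\<in>arr C. src C f \<in> obj C \<and> tgt C f \<in> obj C) \<and>
     (\<forall>X\<in>obj C. idt C X \<in> homs C X X) \<and>
     (\<forall>f\<in>arr C. \<forall>g\<in>arr C. tgt C f = src C g \<longrightarrow> g \<cdot>\<^bsub>C\<^esub> f \<in> homs C (src C f) (tgt C g)) \<and>
     (\<forall>f\<in>arr C. f \<cdot>\<^bsub>C\<^esub> idt C (src C f) = f \<and> idt C (tgt C f) \<cdot>\<^bsub>C\<^esub> f = f) \<and>
     (\<forall>f\<in>arr C. \<forall>g\<in>arr C. \<forall>h\<in>arr C. tgt C f = src C g \<and> tgt C g = src C h \<longrightarrow>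
        h \<cdot>\<^bsub>C\<^esub> (g \<cdot>\<^bsub>C\<^esub> f) = (h \<cdot>\<^bsub>C\<^esub> g) \<cdot>\<^bsub>C\<^esub> f) \<and>
     (\<forall>X\<in>obj C. \<forall>Y\<in>obj C. module fld (hspace C X Y)) \<and>
     (\<forall>X\<in>obj C. \<forall>Y\<in>obj C. \<forall>Z\<in>obj C.
        (\<forall>f\<in>homs C X Y. lin_map (hspace C Y Z) (hspace C X Z) (\<lambda>g. g \<cdot>\<^bsub>C\<^esub> f)) \<and>
        (\<forall>g\<in>homs C Y Z. lin_map (hspace C X Y) (hspace C X Z) (\<lambda>f. g \<cdot>\<^bsub>C\<^esub> f)))"

definition is_iso :: "('o, 'a, 'k) lcat \<Rightarrow> 'o \<Rightarrow> 'o \<Rightarrow> 'a \<Rightarrow> bool" where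
  "is_iso C X Y f \<longleftrightarrow> f \<in> homs C X Y \<and>
     (\<exists>g\<in>homs C Y X. g \<cdot>\<^bsub>C\<^esub> f = idt C X \<and> f \<cdot>\<^bsub>C\<^esub> g = idt C Y)"

definition is_mono :: "('o, 'a, 'k) lcat \<Rightarrow> 'a \<Rightarrow> bool" where
  "is_mono C m \<longleftrightarrow> m \<in> arr C \<and> (\<forall>f\<in>arr C. \<forall>g\<in>arr C. src C f = src C g \<and>
     tgt C f = src C m \<and> tgt C g = src C m \<and> m \<cdot>\<^bsub>C\<^esub> f = m \<cdot>\<^bsub>C\<^esub> g \<longrightarrow> f = g)"

definition is_epi :: "('o, 'a, 'k) lcat \<Rightarrow> 'a \<Rightarrow> bool" where
  "is_epi C e \<longleftrightarrow> e \<in> arr C \<and> (\<forall>f\<in>arr C. \<forall>g\<in>arr C. tgt C f = tgt C g \<and>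
     src C f = tgt C e \<and> src C g = tgt C e \<and> f \<cdot>\<^bsub>C\<^esub> e = g \<cdot>\<^bsub>C\<^esub> e \<longrightarrow> f = g)"

definition is_kernel :: "('o, 'a, 'k) lcat \<Rightarrow> 'a \<Rightarrow> 'a \<Rightarrow> bool" where
  "is_kernel C m f \<longleftrightarrow> m \<in> arr C \<and> f \<in> arr C \<and> tgt C m = src C f \<and>
     f \<cdot>\<^bsub>C\<^esub> m = hzero C (src C m) (tgt C f) \<and>
     (\<forall>g\<in>arr C. tgt C g = src C f \<and> f \<cdot>\<^bsub>C\<^esub> g = hzero C (src C g) (tgt C f) \<longrightarrow>
        (\<exists>!h. h \<in> homs C (src C g) (src C m) \<and> m \<cdot>\<^bsub>C\<^esub> h = g))"

definition is_cokernel :: "('o, 'a, 'k) lcat \<Rightarrow> 'a \<Rightarrow> 'a \<Rightarrow> bool" where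
  "is_cokernel C e f \<longleftrightarrow> e \<in> arr C \<and> f \<in> arr C \<and> src C e = tgt C f \<and>
     e \<cdot>\<^bsub>C\<^esub> f = hzero C (src C f) (tgt C e) \<and>
     (\<forall>g\<in>arr C. src C g = tgt C f \<and> g \<cdot>\<^bsub>C\<^esub> f = hzero C (src C f) (tgt C g) \<longrightarrow>
        (\<exists>!h. h \<in> homs C (tgt C e) (tgt C g) \<and> h \<cdot>\<^bsub>C\<^esub> e = g))"

definition short_exact :: "('o, 'a, 'k) lcat \<Rightarrow> 'a \<Rightarrow> 'a \<Rightarrow> bool" where
  "short_exact C f g \<longleftrightarrow> is_kernel C f g \<and> is_cokernel C g f"

definition is_zero_obj :: "('o, 'a, 'k) lcat \<Rightarrow> 'o \<Rightarrow> bool" where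
  "is_zero_obj C X \<longleftrightarrow> X \<in> obj C \<and> idt C X = hzero C X X"

definition has_biproduct :: "('o, 'a, 'k) lcat \<Rightarrow> 'o \<Rightarrow> 'o \<Rightarrow> bool" where
  "has_biproduct C X Y \<longleftrightarrow> (\<exists>Z\<in>obj C.
     \<exists>i\<in>homs C X Z. \<exists>j\<in>homs C Y Z. \<exists>p\<in>homs C Z X. \<exists>q\<in>homs C Z Y.
       p \<cdot>\<^bsub>C\<^esub> i = idt C X \<and> q \<cdot>\<^bsub>C\<^esub> j = idt C Y \<and>
       q \<cdot>\<^bsub>C\<^esub> i = hzero C X Y \<and> p \<cdot>\<^bsub>C\<^esub> j = hzero C Y X \<and>
       hadd C (i \<cdot>\<^bsub>C\<^esub> p) (j \<cdot>\<^bsub>C\<^esub> q) = idt C Z)"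

definition abelian_category :: "('o, 'a, 'k::field) lcat \<Rightarrow> bool" where
  "abelian_category C \<longleftrightarrow> linear_category C \<and>
     (\<exists>Z. is_zero_obj C Z) \<and>
     (\<forall>X\<in>obj C. \<forall>Y\<in>obj C. has_biproduct C X Y) \<and>
     (\<forall>f\<in>arr C. (\<exists>m. is_kernel C m f) \<and> (\<exists>e. is_cokernel C e f)) \<and>
     (\<forall>m. is_mono C m \<longrightarrow> (\<exists>f. is_kernel C m f)) \<and>
     (\<forall>e. is_epi C e \<longrightarrow> (\<exists>f. is_cokernel C e f))"

definition is_simple :: "('o, 'a, 'k) lcat \<Rightarrow> 'o \<Rightarrow> bool" where
  "is_simple C S \<longleftrightarrow> S \<in> obj C \<and> \<not> is_zero_obj C S \<and>
     (\<forall>m. is_mono C m \<and> tgt C m = S \<longrightarrow> is_zero_obj C (src C m) \<or> is_iso C (src C m) S m)"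

inductive finite_length :: "('o, 'a, 'k) lcat \<Rightarrow> 'o \<Rightarrow> bool" for C where
  "is_zero_obj C Z \<Longrightarrow> finite_length C Z"
| "finite_length C (src C f) \<Longrightarrow> short_exact C f g \<Longrightarrow> is_simple C (tgt C g) \<Longrightarrow>
     finite_length C (tgt C f)"

definition finite_category :: "('o, 'a, 'k::field) lcat \<Rightarrow> bool" where
  "finite_category C \<longleftrightarrow> (\<forall>X\<in>obj C. \<forall>Y\<in>obj C. fin_dim (hspace C X Y)) \<and>
     (\<forall>X\<in>obj C. finite_length C X)"

definition is_functor ::
    "('o, 'a, 'k) lcat \<Rightarrow> ('p, 'b, 'l) lcat \<Rightarrow> ('o \<Rightarrow> 'p) \<Rightarrow> ('a \<Rightarrow> 'b) \<Rightarrow> bool" where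
  "is_functor C D Fo Fa \<longleftrightarrow> Fo \<in> obj C \<rightarrow> obj D \<and>
     (\<forall>f\<in>arr C. Fa f \<in> homs D (Fo (src C f)) (Fo (tgt C f))) \<and>
     (\<forall>X\<in>obj C. Fa (idt C X) = idt D (Fo X)) \<and>
     (\<forall>f\<in>arr C. \<forall>g\<in>arr C. tgt C f = src C g \<longrightarrow> Fa (g \<cdot>\<^bsub>C\<^esub> f) = Fa g \<cdot>\<^bsub>D\<^esub> Fa f)"

definition exact_functor ::
    "('o, 'a, 'k) lcat \<Rightarrow> ('p, 'b, 'l) lcat \<Rightarrow> ('o \<Rightarrow> 'p) \<Rightarrow> ('a \<Rightarrow> 'b) \<Rightarrow> bool" where
  "exact_functor C D Fo Fa \<longleftrightarrow> is_functor C D Fo Fa \<and>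
     (\<forall>f g. short_exact C f g \<longrightarrow> short_exact D (Fa f) (Fa g))"

definition faithful :: "('o, 'a, 'k) lcat \<Rightarrow> ('a \<Rightarrow> 'b) \<Rightarrow> bool" where
  "faithful C Fa \<longleftrightarrow> (\<forall>X\<in>obj C. \<forall>Y\<in>obj C. inj_on Fa (homs C X Y))"


section \<open>Tensor categories\<close>

text \<open>
  Tensor product on objects and arrows, unit object, associativity constraint from
  \<open>(X \<otimes> Y) \<otimes> Z\<close> to \<open>X \<otimes> (Y \<otimes> Z)\<close>, commutativity constraint, left and right unit constraints.
\<close>

record ('o, 'a) tensor_data =
  tob :: "'o \<Rightarrow> 'o \<Rightarrow> 'o"
  tar :: "'a \<Rightarrow> 'a \<Rightarrow> 'a"
  tun :: "'o"
  asc :: "'o \<Rightarrow> 'o \<Rightarrow> 'o \<Rightarrow> 'a"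
  com :: "'o \<Rightarrow> 'o \<Rightarrow> 'a"
  lun :: "'o \<Rightarrow> 'a"
  run :: "'o \<Rightarrow> 'a"

definition tensor_category :: "('o, 'a, 'k::field) lcat \<Rightarrow> ('o, 'a) tensor_data \<Rightarrow> bool" where
  "tensor_category C T \<longleftrightarrow> linear_category C \<and> tun T \<in> obj C \<and>
     (\<forall>X\<in>obj C. \<forall>Y\<in>obj C. tob T X Y \<in> obj C \<and> tar T (idt C X) (idt C Y) = idt C (tob T X Y)) \<and>
     (\<forall>X\<in>obj C. \<forall>X'\<in>obj C. \<forall>Y\<in>obj C. \<forall>Y'\<in>obj C.
        (\<forall>f\<in>homs C X X'. lin_map (hspace C Y Y') (hspace C (tob T X Y) (tob T X' Y')) (\<lambda>g. tar T f g)) \<and>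
        (\<forall>g\<in>homs C Y Y'. lin_map (hspace C X X') (hspace C (tob T X Y) (tob T X' Y')) (\<lambda>f. tar T f g))) \<and>
     (\<forall>f\<in>arr C. \<forall>f'\<in>arr C. \<forall>g\<in>arr C. \<forall>g'\<in>arr C. tgt C f = src C f' \<and> tgt C g = src C g' \<longrightarrow>
        tar T (f' \<cdot>\<^bsub>C\<^esub> f) (g' \<cdot>\<^bsub>C\<^esub> g) = tar T f' g' \<cdot>\<^bsub>C\<^esub> tar T f g) \<and>
     (\<forall>X\<in>obj C. \<forall>Y\<in>obj C. \<forall>Z\<in>obj C.
        is_iso C (tob T (tob T X Y) Z) (tob T X (tob T Y Z)) (asc T X Y Z)) \<and>
     (\<forall>X\<in>obj C. \<forall>Y\<in>obj C. is_iso C (tob T X Y) (tob T Y X) (com T X Y)) \<and>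
     (\<forall>X\<in>obj C. is_iso C (tob T (tun T) X) X (lun T X) \<and> is_iso C (tob T X (tun T)) X (run T X)) \<and>
     (\<forall>f\<in>arr C. \<forall>g\<in>arr C. \<forall>h\<in>arr C.
        asc T (tgt C f) (tgt C g) (tgt C h) \<cdot>\<^bsub>C\<^esub> tar T (tar T f g) h =
        tar T f (tar T g h) \<cdot>\<^bsub>C\<^esub> asc T (src C f) (src C g) (src C h)) \<and>
     (\<forall>f\<in>arr C. \<forall>g\<in>arr C.
        com T (tgt C f) (tgt C g) \<cdot>\<^bsub>C\<^esub> tar T f g = tar T g f \<cdot>\<^bsub>C\<^esub> com T (src C f) (src C g)) \<and>
     (\<forall>f\<in>arr C. lun T (tgt C f) \<cdot>\<^bsub>C\<^esub> tar T (idt C (tun T)) f = f \<cdot>\<^bsub>C\<^esub> lun T (src C f) \<and>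
        run T (tgt C f) \<cdot>\<^bsub>C\<^esub> tar T f (idt C (tun T)) = f \<cdot>\<^bsub>C\<^esub> run T (src C f)) \<and>
     (\<forall>W\<in>obj C. \<forall>X\<in>obj C. \<forall>Y\<in>obj C. \<forall>Z\<in>obj C.
        asc T W X (tob T Y Z) \<cdot>\<^bsub>C\<^esub> asc T (tob T W X) Y Z =
        tar T (idt C W) (asc T X Y Z) \<cdot>\<^bsub>C\<^esub> asc T W (tob T X Y) Z \<cdot>\<^bsub>C\<^esub> tar T (asc T W X Y) (idt C Z)) \<and>
     (\<forall>X\<in>obj C. \<forall>Y\<in>obj C.
        tar T (idt C X) (lun T Y) \<cdot>\<^bsub>C\<^esub> asc T X (tun T) Y = tar T (run T X) (idt C Y)) \<and>
     (\<forall>X\<in>obj C. \<forall>Y\<in>obj C. com T Y X \<cdot>\<^bsub>C\<^esub> com T X Y = idt C (tob T X Y)) \<and>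
     (\<forall>X\<in>obj C. \<forall>Y\<in>obj C. \<forall>Z\<in>obj C.
        asc T Y Z X \<cdot>\<^bsub>C\<^esub> com T X (tob T Y Z) \<cdot>\<^bsub>C\<^esub> asc T X Y Z =
        tar T (idt C Y) (com T X Z) \<cdot>\<^bsub>C\<^esub> asc T Y X Z \<cdot>\<^bsub>C\<^esub> tar T (com T X Y) (idt C Z))"

text \<open>
  \<open>mu X Y\<close>, from \<open>F X \<otimes> F Y\<close> to \<open>F (X \<otimes> Y)\<close>, and \<open>e\<close>, from the unit to \<open>F\<close> of the unit, are
  functorial and compatible with the constraints.  They need not be isomorphisms.
\<close>

definition lax_tensor ::
    "('o, 'a, 'k) lcat \<Rightarrow> ('o, 'a) tensor_data \<Rightarrow> ('p, 'b, 'l) lcat \<Rightarrow> ('p, 'b) tensor_data \<Rightarrow>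
      ('o \<Rightarrow> 'p) \<Rightarrow> ('a \<Rightarrow> 'b) \<Rightarrow> ('o \<Rightarrow> 'o \<Rightarrow> 'b) \<Rightarrow> 'b \<Rightarrow> bool" where
  "lax_tensor C T D U Fo Fa mu e \<longleftrightarrow>
     e \<in> homs D (tun U) (Fo (tun T)) \<and>
     (\<forall>X\<in>obj C. \<forall>Y\<in>obj C. mu X Y \<in> homs D (tob U (Fo X) (Fo Y)) (Fo (tob T X Y))) \<and>
     (\<forall>f\<in>arr C. \<forall>g\<in>arr C.
        Fa (tar T f g) \<cdot>\<^bsub>D\<^esub> mu (src C f) (src C g) = mu (tgt C f) (tgt C g) \<cdot>\<^bsub>D\<^esub> tar U (Fa f) (Fa g)) \<and>
     (\<forall>X\<in>obj C. \<forall>Y\<in>obj C. \<forall>Z\<in>obj C.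
        Fa (asc T X Y Z) \<cdot>\<^bsub>D\<^esub> mu (tob T X Y) Z \<cdot>\<^bsub>D\<^esub> tar U (mu X Y) (idt D (Fo Z)) =
        mu X (tob T Y Z) \<cdot>\<^bsub>D\<^esub> tar U (idt D (Fo X)) (mu Y Z) \<cdot>\<^bsub>D\<^esub> asc U (Fo X) (Fo Y) (Fo Z)) \<and>
     (\<forall>X\<in>obj C. \<forall>Y\<in>obj C. Fa (com T X Y) \<cdot>\<^bsub>D\<^esub> mu X Y = mu Y X \<cdot>\<^bsub>D\<^esub> com U (Fo X) (Fo Y)) \<and>
     (\<forall>X\<in>obj C. Fa (lun T X) \<cdot>\<^bsub>D\<^esub> mu (tun T) X \<cdot>\<^bsub>D\<^esub> tar U e (idt D (Fo X)) = lun U (Fo X)) \<and>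
     (\<forall>X\<in>obj C. Fa (run T X) \<cdot>\<^bsub>D\<^esub> mu X (tun T) \<cdot>\<^bsub>D\<^esub> tar U (idt D (Fo X)) e = run U (Fo X))"

definition tensor_functor ::
    "('o, 'a, 'k) lcat \<Rightarrow> ('o, 'a) tensor_data \<Rightarrow> ('p, 'b, 'l) lcat \<Rightarrow> ('p, 'b) tensor_data \<Rightarrow>
      ('o \<Rightarrow> 'p) \<Rightarrow> ('a \<Rightarrow> 'b) \<Rightarrow> ('o \<Rightarrow> 'o \<Rightarrow> 'b) \<Rightarrow> 'b \<Rightarrow> bool" where
  "tensor_functor C T D U Fo Fa mu e \<longleftrightarrow> is_functor C D Fo Fa \<and> lax_tensor C T D U Fo Fa mu e \<and>
     is_iso D (tun U) (Fo (tun T)) e \<and>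
     (\<forall>X\<in>obj C. \<forall>Y\<in>obj C. is_iso D (tob U (Fo X) (Fo Y)) (Fo (tob T X Y)) (mu X Y))"


section \<open>Modules in a linear category\<close>

text \<open>\<open>R\<close> is a commutative ring, made into a \<open>'k\<close>-algebra by \<open>rho\<close>.\<close>

definition module_in ::
    "('o, 'a, 'k) lcat \<Rightarrow> 'r ring \<Rightarrow> ('k \<Rightarrow> 'r) \<Rightarrow> 'o \<Rightarrow> ('r \<Rightarrow> 'a) \<Rightarrow> bool" where
  "module_in C R rho N act \<longleftrightarrow> N \<in> obj C \<and> act \<in> carrier R \<rightarrow> homs C N N \<and>
     (\<forall>r\<in>carrier R. \<forall>s\<in>carrier R. act (r \<oplus>\<^bsub>R\<^esub> s) = hadd C (act r) (act s)) \<and>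
     (\<forall>r\<in>carrier R. \<forall>s\<in>carrier R. act (r \<otimes>\<^bsub>R\<^esub> s) = act r \<cdot>\<^bsub>C\<^esub> act s) \<and>
     act \<one>\<^bsub>R\<^esub> = idt C N \<and>
     (\<forall>a. act (rho a) = hscal C a (idt C N))"

text \<open>
  Let \<open>S\<close> be the underlying set of a ring acting on \<open>M\<close> via \<open>aM\<close>, and let \<open>h\<close> be a homomorphism
  from it to \<open>R\<close>.  The \<open>R\<close>-module \<open>N\<close> is the scalar extension of \<open>M\<close> along \<open>h\<close>, with the universal
  map \<open>u\<close>.
\<close>

definition base_change ::
    "('o, 'a, 'k) lcat \<Rightarrow> 's set \<Rightarrow> 'o \<Rightarrow> ('s \<Rightarrow> 'a) \<Rightarrow> ('s \<Rightarrow> 'r) \<Rightarrow>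
      'r ring \<Rightarrow> ('k \<Rightarrow> 'r) \<Rightarrow> 'o \<Rightarrow> ('r \<Rightarrow> 'a) \<Rightarrow> 'a \<Rightarrow> bool" where
  "base_change C S M aM h R rho N aN u \<longleftrightarrow> module_in C R rho N aN \<and> u \<in> homs C M N \<and>
     (\<forall>s\<in>S. u \<cdot>\<^bsub>C\<^esub> aM s = aN (h s) \<cdot>\<^bsub>C\<^esub> u) \<and>
     (\<forall>N' a' f. module_in C R rho N' a' \<and> f \<in> homs C M N' \<and>
        (\<forall>s\<in>S. f \<cdot>\<^bsub>C\<^esub> aM s = a' (h s) \<cdot>\<^bsub>C\<^esub> f) \<longrightarrow>
        (\<exists>!g. g \<in> homs C N N' \<and> (\<forall>r\<in>carrier R. g \<cdot>\<^bsub>C\<^esub> aN r = a' r \<cdot>\<^bsub>C\<^esub> g) \<and> g \<cdot>\<^bsub>C\<^esub> u = f))"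

text \<open>
  \<open>Z\<close> is the tensor product of the vector space \<open>V\<close> and the object \<open>X\<close>; the morphism
  \<open>c v\<close> from \<open>X\<close> to \<open>Z\<close> is the tensor product of \<open>v\<close> and the identity of \<open>X\<close>.
\<close>

definition is_space_tensor ::
    "('o, 'a, 'k) lcat \<Rightarrow> ('k, 'v) module \<Rightarrow> 'o \<Rightarrow> 'o \<Rightarrow> ('v \<Rightarrow> 'a) \<Rightarrow> bool" where
  "is_space_tensor C V X Z c \<longleftrightarrow> Z \<in> obj C \<and> lin_map V (hspace C X Z) c \<and>
     (\<forall>Y\<in>obj C. \<forall>g. lin_map V (hspace C X Y) g \<longrightarrow>
        (\<exists>!h. h \<in> homs C Z Y \<and> (\<forall>v\<in>carrier V. h \<cdot>\<^bsub>C\<^esub> c v = g v)))"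


section \<open>Differential categories\<close>

text \<open>
  An Atiyah functor: its values on objects and arrows, the action of the jet ring (of type
  \<open>'r\<close>), and its tensor structure.
\<close>

record ('r, 'o, 'a) atiyah =
  aob :: "'o \<Rightarrow> 'o"
  aar :: "'a \<Rightarrow> 'a"
  aact :: "'o \<Rightarrow> 'r \<Rightarrow> 'a"
  amul :: "'o \<Rightarrow> 'o \<Rightarrow> 'a"
  aone :: "'a"

text \<open>
  Condition (a).  A tensor functor to \<open>R\<close>-modules is rendered by maps \<open>amul X Y\<close> which identify
  the value at \<open>X \<otimes> Y\<close> with the tensor product over \<open>R\<close> of the values at \<open>X\<close> and \<open>Y\<close>,
  that is, with the coequalizer of the two actions of \<open>R\<close> on the tensor product of these values,
  and by a map \<open>aone\<close> which identifies the value at the unit object with the unit object of the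
  category of \<open>R\<close>-modules, that is, with the scalar extension of the unit object along \<open>rho\<close>.
\<close>

definition atiyah_functor ::
    "('o, 'a, 'k::field_char_0) lcat \<Rightarrow> ('o, 'a) tensor_data \<Rightarrow> 'r ring \<Rightarrow> ('k \<Rightarrow> 'r) \<Rightarrow> ('k \<Rightarrow> 'r) \<Rightarrow>
      ('r, 'o, 'a) atiyah \<Rightarrow> bool" where
  "atiyah_functor C T R lam rho A \<longleftrightarrow>
     exact_functor C C (aob A) (aar A) \<and>
     (\<forall>X\<in>obj C. module_in C R rho (aob A X) (aact A X)) \<and>
     (\<forall>f\<in>arr C. \<forall>r\<in>carrier R. aar A f \<cdot>\<^bsub>C\<^esub> aact A (src C f) r = aact A (tgt C f) r \<cdot>\<^bsub>C\<^esub> aar A f) \<and>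
     (\<forall>X\<in>obj C. \<forall>Y\<in>obj C. \<forall>f\<in>homs C X Y. \<forall>g\<in>homs C X Y.
        aar A (hadd C f g) = hadd C (aar A f) (aar A g)) \<and>
     (\<forall>f\<in>arr C. \<forall>a. aar A (hscal C a f) = aact A (tgt C f) (lam a) \<cdot>\<^bsub>C\<^esub> aar A f) \<and>
     lax_tensor C T C T (aob A) (aar A) (amul A) (aone A) \<and>
     (\<forall>X\<in>obj C. \<forall>Y\<in>obj C.
        (\<forall>r\<in>carrier R.
           amul A X Y \<cdot>\<^bsub>C\<^esub> tar T (aact A X r) (idt C (aob A Y)) = aact A (tob T X Y) r \<cdot>\<^bsub>C\<^esub> amul A X Y \<and>
           amul A X Y \<cdot>\<^bsub>C\<^esub> tar T (idt C (aob A X)) (aact A Y r) = aact A (tob T X Y) r \<cdot>\<^bsub>C\<^esub> amul A X Y) \<and>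
        (\<forall>N\<in>obj C. \<forall>f\<in>homs C (tob T (aob A X) (aob A Y)) N.
           (\<forall>r\<in>carrier R. f \<cdot>\<^bsub>C\<^esub> tar T (aact A X r) (idt C (aob A Y)) =
                            f \<cdot>\<^bsub>C\<^esub> tar T (idt C (aob A X)) (aact A Y r)) \<longrightarrow>
           (\<exists>!g. g \<in> homs C (aob A (tob T X Y)) N \<and> g \<cdot>\<^bsub>C\<^esub> amul A X Y = f))) \<and>
     base_change C UNIV (tun T) (\<lambda>a. hscal C a (idt C (tun T))) rho
       R rho (aob A (tun T)) (aact A (tun T)) (aone A)"

text \<open>
  The action of \<open>P\<^sup>1 \<otimes> P\<^sup>1\<close> on \<open>At\<^sup>1 (At\<^sup>1 X)\<close>: \<open>p \<otimes> q\<close> acts as \<open>At\<^sup>1 (p)\<close> followed by the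
  action of \<open>q\<close> on \<open>At\<^sup>1\<close> of the object \<open>At\<^sup>1 X\<close>.  This is balanced since \<open>At\<^sup>1\<close> turns the scalar
  \<open>a = \<rho>(a)\<close> into \<open>\<lambda>(a)\<close>, so the result does not depend on the chosen decomposition \<open>ps\<close>.
\<close>

definition act11 ::
    "('k::field_char_0, 'd::ab_group_add) dfield \<Rightarrow> ('o, 'a, 'k) lcat \<Rightarrow>
      (('k, 'd) jt1, 'o, 'a) atiyah \<Rightarrow> 'o \<Rightarrow> ('k, 'd) jt2 \<Rightarrow> 'a" where
  "act11 D C A X t =
     (let Y = aob A X;
          ps = (SOME ps. set ps \<subseteq> carrier (jet1 D) \<times> carrier (jet1 D) \<and>
                 t = foldr (\<lambda>(p, q) z. jet_tensor D p q \<oplus>\<^bsub>jet11 D\<^esub> z) ps \<zero>\<^bsub>jet11 D\<^esub>)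
      in foldr (\<lambda>(p, q) z. hadd C (aact A Y q \<cdot>\<^bsub>C\<^esub> aar A (aact A X p)) z) ps
           (hzero C (aob A Y) (aob A Y)))"

record ('k, 'd, 'o, 'a) at_data =
  at1 :: "(('k, 'd) jt1, 'o, 'a) atiyah"
  at2 :: "(('k, 'd) jt2, 'o, 'a) atiyah"
  prj :: "'o \<Rightarrow> 'a"
  emb :: "'o \<Rightarrow> 'a"

text \<open>
  \<open>prj X\<close>, from \<open>At\<^sup>1 X\<close> to \<open>X\<close>, is the projection \<open>\<pi>\<close>, and \<open>emb X\<close> is the embedding of \<open>At\<^sup>2 X\<close> into
  \<open>At\<^sup>1 (At\<^sup>1 X)\<close>.  The exact sequence in (b) is automatically functorial: \<open>i\<close> is determined
  by the action of one-forms, which commutes with \<open>At\<^sup>1\<close> of a morphism.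
\<close>

definition D_category ::
    "('k::field_char_0, 'd::ab_group_add) dfield \<Rightarrow> ('o, 'a, 'k) lcat \<Rightarrow> ('o, 'a) tensor_data \<Rightarrow>
      ('k, 'd, 'o, 'a) at_data \<Rightarrow> bool" where
  "D_category D C T A \<longleftrightarrow>
     abelian_category C \<and> tensor_category C T \<and>
     atiyah_functor C T (jet1 D) lam1 (rho1 D) (at1 A) \<and>
     atiyah_functor C T (jet2 D) (lam2 D) (rho2 D) (at2 A) \<and>
     (\<forall>f\<in>arr C. prj A (tgt C f) \<cdot>\<^bsub>C\<^esub> aar (at1 A) f = f \<cdot>\<^bsub>C\<^esub> prj A (src C f)) \<and>
     (\<forall>X\<in>obj C. base_change C (carrier (jet1 D)) (aob (at1 A) X) (aact (at1 A) X) fst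
        fld id X (\<lambda>a. hscal C a (idt C X)) (prj A X)) \<and>
     (\<forall>X\<in>obj C. \<forall>Y\<in>obj C. prj A (tob T X Y) \<cdot>\<^bsub>C\<^esub> amul (at1 A) X Y = tar T (prj A X) (prj A Y)) \<and>
     prj A (tun T) \<cdot>\<^bsub>C\<^esub> aone (at1 A) = idt C (tun T) \<and>
     (\<forall>X\<in>obj C. \<exists>Z c i. is_space_tensor C (omega D) X Z c \<and> short_exact C i (prj A X) \<and> src C i = Z \<and>
        (\<forall>\<omega>\<in>forms1 D. aact (at1 A) X (0, \<omega>) = i \<cdot>\<^bsub>C\<^esub> c \<omega> \<cdot>\<^bsub>C\<^esub> prj A X)) \<and>
     (\<forall>X\<in>obj C. is_mono C (emb A X) \<and> emb A X \<in> homs C (aob (at2 A) X) (aob (at1 A) (aob (at1 A) X))) \<and>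
     (\<forall>f\<in>arr C. emb A (tgt C f) \<cdot>\<^bsub>C\<^esub> aar (at2 A) f = aar (at1 A) (aar (at1 A) f) \<cdot>\<^bsub>C\<^esub> emb A (src C f)) \<and>
     (\<forall>X\<in>obj C. \<forall>Y\<in>obj C. emb A (tob T X Y) \<cdot>\<^bsub>C\<^esub> amul (at2 A) X Y =
        aar (at1 A) (amul (at1 A) X Y) \<cdot>\<^bsub>C\<^esub> amul (at1 A) (aob (at1 A) X) (aob (at1 A) Y) \<cdot>\<^bsub>C\<^esub>
        tar T (emb A X) (emb A Y)) \<and>
     emb A (tun T) \<cdot>\<^bsub>C\<^esub> aone (at2 A) = aar (at1 A) (aone (at1 A)) \<cdot>\<^bsub>C\<^esub> aone (at1 A) \<and>
     (\<forall>X\<in>obj C. base_change C (carrier (jet2 D)) (aob (at2 A) X) (aact (at2 A) X) id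
        (jet11 D) (rho2 D) (aob (at1 A) (aob (at1 A) X)) (act11 D C (at1 A) X) (emb A X))"

definition D_connection ::
    "('o, 'a, 'k) lcat \<Rightarrow> ('k, 'd, 'o, 'a) at_data \<Rightarrow> 'o \<Rightarrow> 'a \<Rightarrow> bool" where
  "D_connection C A X s \<longleftrightarrow> s \<in> homs C X (aob (at1 A) X) \<and> prj A X \<cdot>\<^bsub>C\<^esub> s = idt C X"

text \<open>
  The image of a morphism is contained in the subobject given by the monomorphism \<open>emb A X\<close> iff
  the morphism factors through \<open>emb A X\<close>.
\<close>

definition D_structure ::
    "('o, 'a, 'k) lcat \<Rightarrow> ('k, 'd, 'o, 'a) at_data \<Rightarrow> 'o \<Rightarrow> 'a \<Rightarrow> bool" where
  "D_structure C A X s \<longleftrightarrow> D_connection C A X s \<and>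
     (\<exists>t\<in>homs C X (aob (at2 A) X). emb A X \<cdot>\<^bsub>C\<^esub> t = aar (at1 A) s \<cdot>\<^bsub>C\<^esub> s)"


section \<open>Differential functors\<close>

text \<open>
  The tensor structure of a functor \<open>F\<close>, and the maps from \<open>F (At\<^sup>i X)\<close> to \<open>At\<^sup>i (F X)\<close> for
  \<open>i = 1, 2\<close> that correspond to the isomorphisms in the definition of a differential functor.
\<close>

record ('o, 'b) dfun_data =
  fmul :: "'o \<Rightarrow> 'o \<Rightarrow> 'b"
  fone :: "'b"
  th1 :: "'o \<Rightarrow> 'b"
  th2 :: "'o \<Rightarrow> 'b"

text \<open>
  \<open>F (At\<^sup>i X)\<close> is a module over the jet ring of \<open>k\<close>, on which \<open>\<rho>(a)\<close> acts as the scalar \<open>a\<close>.  The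
  scalar extension along the homomorphism from \<open>K \<otimes> P\<^sup>i\<^sub>k\<close> (with \<open>P\<^sup>i\<^sub>k\<close> taken with \<open>\<rho>\<close>) to
  \<open>P\<^sup>i\<^sub>K\<close> is expressed via the restriction \<open>h\<close> of this homomorphism to \<open>P\<^sup>i\<^sub>k\<close>: linearity
  over \<open>K\<close> is automatic as the target category is \<open>K\<close>-linear.
\<close>

definition atiyah_compatible ::
    "('o, 'a, 'k) lcat \<Rightarrow> ('o, 'a) tensor_data \<Rightarrow> ('r, 'o, 'a) atiyah \<Rightarrow> 'r ring \<Rightarrow>
      ('p, 'b, 'l) lcat \<Rightarrow> ('p, 'b) tensor_data \<Rightarrow> ('s, 'p, 'b) atiyah \<Rightarrow> 's ring \<Rightarrow> ('l \<Rightarrow> 's) \<Rightarrow>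
      ('r \<Rightarrow> 's) \<Rightarrow> ('o \<Rightarrow> 'p) \<Rightarrow> ('a \<Rightarrow> 'b) \<Rightarrow> ('o \<Rightarrow> 'o \<Rightarrow> 'b) \<Rightarrow> 'b \<Rightarrow> ('o \<Rightarrow> 'b) \<Rightarrow> bool" where
  "atiyah_compatible C T A P C' T' A' P' rho' h Fo Fa mu e th \<longleftrightarrow>
     (\<forall>X\<in>obj C. base_change C' (carrier P) (Fo (aob A X)) (\<lambda>p. Fa (aact A X p)) h
        P' rho' (aob A' (Fo X)) (aact A' (Fo X)) (th X)) \<and>
     (\<forall>f\<in>arr C. th (tgt C f) \<cdot>\<^bsub>C'\<^esub> Fa (aar A f) = aar A' (Fa f) \<cdot>\<^bsub>C'\<^esub> th (src C f)) \<and>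
     (\<forall>X\<in>obj C. \<forall>Y\<in>obj C.
        th (tob T X Y) \<cdot>\<^bsub>C'\<^esub> Fa (amul A X Y) \<cdot>\<^bsub>C'\<^esub> mu (aob A X) (aob A Y) =
        aar A' (mu X Y) \<cdot>\<^bsub>C'\<^esub> amul A' (Fo X) (Fo Y) \<cdot>\<^bsub>C'\<^esub> tar T' (th X) (th Y)) \<and>
     th (tun T) \<cdot>\<^bsub>C'\<^esub> Fa (aone A) \<cdot>\<^bsub>C'\<^esub> e = aar A' e \<cdot>\<^bsub>C'\<^esub> aone A'"

definition differential_functor ::
    "('k::field_char_0, 'd::ab_group_add) dfield \<Rightarrow> ('l::field_char_0, 'e::ab_group_add) dfield \<Rightarrow>
      ('k \<Rightarrow> 'l) \<Rightarrow> ('e \<Rightarrow> ('d \<Rightarrow> 'l) set) \<Rightarrow>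
      ('o, 'a, 'k) lcat \<Rightarrow> ('o, 'a) tensor_data \<Rightarrow> ('k, 'd, 'o, 'a) at_data \<Rightarrow>
      ('p, 'b, 'l) lcat \<Rightarrow> ('p, 'b) tensor_data \<Rightarrow> ('l, 'e, 'p, 'b) at_data \<Rightarrow>
      ('o \<Rightarrow> 'p) \<Rightarrow> ('a \<Rightarrow> 'b) \<Rightarrow> ('o, 'b) dfun_data \<Rightarrow> bool" where
  "differential_functor D D' \<phi> \<Theta> C T A C' T' A' Fo Fa G \<longleftrightarrow>
     exact_functor C C' Fo Fa \<and>
     (\<forall>X\<in>obj C. \<forall>Y\<in>obj C. semilin_map UNIV \<phi> (hspace C X Y) (hspace C' (Fo X) (Fo Y)) Fa) \<and>
     tensor_functor C T C' T' Fo Fa (fmul G) (fone G) \<and>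
     atiyah_compatible C T (at1 A) (jet1 D) C' T' (at1 A') (jet1 D') (rho1 D') (jet_map1 \<phi> \<Theta>)
       Fo Fa (fmul G) (fone G) (th1 G) \<and>
     atiyah_compatible C T (at2 A) (jet2 D) C' T' (at2 A') (jet2 D') (rho2 D') (jet_map2 \<phi> \<Theta>)
       Fo Fa (fmul G) (fone G) (th2 G) \<and>
     (\<forall>X\<in>obj C. prj A' (Fo X) \<cdot>\<^bsub>C'\<^esub> th1 G X = Fa (prj A X)) \<and>
     (\<forall>X\<in>obj C. emb A' (Fo X) \<cdot>\<^bsub>C'\<^esub> th2 G X =
        aar (at1 A') (th1 G X) \<cdot>\<^bsub>C'\<^esub> th1 G (aob (at1 A) X) \<cdot>\<^bsub>C'\<^esub> Fa (emb A X))"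


section \<open>Vector spaces as a differential category\<close>

type_synonym ('l, 'w) vect_arr = "('l, 'w) module \<times> ('l, 'w) module \<times> ('w \<Rightarrow> 'w)"

text \<open>All vector spaces with carrier a subset of the type \<open>'w\<close>.\<close>

definition vect_cat ::
    "(('l::field, 'w) module, ('l, 'w) vect_arr, 'l) lcat" where
  "vect_cat = \<lparr>obj = {V. module fld V},
     arr = {(V, W, h). module fld V \<and> module fld W \<and> lin_map V W h \<and> h \<in> extensional (carrier V)},
     src = fst, tgt = (\<lambda>f. fst (snd f)),
     idt = (\<lambda>V. (V, V, \<lambda>x\<in>carrier V. x)),
     cmp = (\<lambda>(V', W', g) (V, W, f). (V, W', \<lambda>x\<in>carrier V. g (f x))),
     hzero = (\<lambda>V W. (V, W, \<lambda>x\<in>carrier V. \<zero>\<^bsub>W\<^esub>)),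
     hadd = (\<lambda>(V, W, f) (V', W', g). (V, W, \<lambda>x\<in>carrier V. f x \<oplus>\<^bsub>W\<^esub> g x)),
     hscal = (\<lambda>a (V, W, f). (V, W, \<lambda>x\<in>carrier V. a \<odot>\<^bsub>W\<^esub> f x))\<rparr>"

definition app :: "('l, 'w) vect_arr \<Rightarrow> 'w \<Rightarrow> 'w" where
  "app f = snd (snd f)"

text \<open>
  The universe \<open>'w\<close> is not literally closed under tensor products, so the canonical structures
  are determined up to canonical isomorphism by universal properties.  Here \<open>tp V W v w\<close> is the
  tensor of \<open>v\<close> and \<open>w\<close>, and \<open>u\<close> is the basis element of the one-dimensional unit object.
\<close>

definition canonical_vect_tensor ::
    "(('l::field, 'w) module, ('l, 'w) vect_arr) tensor_data \<Rightarrow>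
      (('l, 'w) module \<Rightarrow> ('l, 'w) module \<Rightarrow> 'w \<Rightarrow> 'w \<Rightarrow> 'w) \<Rightarrow> 'w \<Rightarrow> bool" where
  "canonical_vect_tensor T tp u \<longleftrightarrow>
     (\<forall>V\<in>obj vect_cat. \<forall>W\<in>obj vect_cat.
        (\<forall>v\<in>carrier V. lin_map W (tob T V W) (tp V W v)) \<and>
        (\<forall>w\<in>carrier W. lin_map V (tob T V W) (\<lambda>v. tp V W v w)) \<and>
        (\<forall>U\<in>obj vect_cat. \<forall>b. (\<forall>v\<in>carrier V. lin_map W U (b v)) \<and>
             (\<forall>w\<in>carrier W. lin_map V U (\<lambda>v. b v w)) \<longrightarrow>
           (\<exists>!h. h \<in> homs vect_cat (tob T V W) U \<and>
              (\<forall>v\<in>carrier V. \<forall>w\<in>carrier W. app h (tp V W v w) = b v w)))) \<and>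
     u \<in> carrier (tun T) \<and> bij_betw (\<lambda>c. c \<odot>\<^bsub>tun T\<^esub> u) UNIV (carrier (tun T)) \<and>
     (\<forall>f\<in>arr vect_cat. \<forall>g\<in>arr vect_cat.
        \<forall>v\<in>carrier (src vect_cat f). \<forall>w\<in>carrier (src vect_cat g).
        app (tar T f g) (tp (src vect_cat f) (src vect_cat g) v w) =
        tp (tgt vect_cat f) (tgt vect_cat g) (app f v) (app g w)) \<and>
     (\<forall>U\<in>obj vect_cat. \<forall>V\<in>obj vect_cat. \<forall>W\<in>obj vect_cat.
        \<forall>x\<in>carrier U. \<forall>v\<in>carrier V. \<forall>w\<in>carrier W.
        app (asc T U V W) (tp (tob T U V) W (tp U V x v) w) = tp U (tob T V W) x (tp V W v w)) \<and>
     (\<forall>V\<in>obj vect_cat. \<forall>W\<in>obj vect_cat. \<forall>v\<in>carrier V. \<forall>w\<in>carrier W.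
        app (com T V W) (tp V W v w) = tp W V w v) \<and>
     (\<forall>V\<in>obj vect_cat. \<forall>v\<in>carrier V.
        app (lun T V) (tp (tun T) V u v) = v \<and> app (run T V) (tp V (tun T) v u) = v)"

text \<open>
  \<open>A\<close> is the functor sending \<open>W\<close> to the tensor product of \<open>W\<close> and \<open>P\<close> taken with \<open>lam\<close>; \<open>j W w\<close> is the
  tensor of \<open>w\<close> and \<open>1\<close>.
\<close>

definition canonical_vect_atiyah ::
    "(('l::field, 'w) module, ('l, 'w) vect_arr) tensor_data \<Rightarrow>
      (('l, 'w) module \<Rightarrow> ('l, 'w) module \<Rightarrow> 'w \<Rightarrow> 'w \<Rightarrow> 'w) \<Rightarrow> 'w \<Rightarrow>
      'r ring \<Rightarrow> ('l \<Rightarrow> 'r) \<Rightarrow> ('l \<Rightarrow> 'r) \<Rightarrow>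
      ('r, ('l, 'w) module, ('l, 'w) vect_arr) atiyah \<Rightarrow>
      (('l, 'w) module \<Rightarrow> 'w \<Rightarrow> 'w) \<Rightarrow> bool" where
  "canonical_vect_atiyah T tp u P lam rho A j \<longleftrightarrow>
     (\<forall>W\<in>obj vect_cat. j W \<in> carrier W \<rightarrow> carrier (aob A W) \<and>
        (\<forall>v\<in>carrier W. \<forall>w\<in>carrier W. j W (v \<oplus>\<^bsub>W\<^esub> w) = j W v \<oplus>\<^bsub>aob A W\<^esub> j W w) \<and>
        (\<forall>a. \<forall>w\<in>carrier W. j W (a \<odot>\<^bsub>W\<^esub> w) = app (aact A W (lam a)) (j W w)) \<and>
        (\<forall>N act g. module_in vect_cat P rho N act \<and> g \<in> carrier W \<rightarrow> carrier N \<and>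
             (\<forall>v\<in>carrier W. \<forall>w\<in>carrier W. g (v \<oplus>\<^bsub>W\<^esub> w) = g v \<oplus>\<^bsub>N\<^esub> g w) \<and>
             (\<forall>a. \<forall>w\<in>carrier W. g (a \<odot>\<^bsub>W\<^esub> w) = app (act (lam a)) (g w)) \<longrightarrow>
           (\<exists>!h. h \<in> homs vect_cat (aob A W) N \<and>
              (\<forall>p\<in>carrier P. h \<cdot>\<^bsub>vect_cat\<^esub> aact A W p = act p \<cdot>\<^bsub>vect_cat\<^esub> h) \<and>
              (\<forall>w\<in>carrier W. app h (j W w) = g w)))) \<and>
     (\<forall>f\<in>arr vect_cat. \<forall>w\<in>carrier (src vect_cat f).
        app (aar A f) (j (src vect_cat f) w) = j (tgt vect_cat f) (app f w)) \<and>
     (\<forall>V\<in>obj vect_cat. \<forall>W\<in>obj vect_cat. \<forall>v\<in>carrier V. \<forall>w\<in>carrier W.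
        app (amul A V W) (tp (aob A V) (aob A W) (j V v) (j W w)) = j (tob T V W) (tp V W v w)) \<and>
     app (aone A) u = j (tun T) u"

definition canonical_vect ::
    "('l::field_char_0, 'e::ab_group_add) dfield \<Rightarrow>
      (('l, 'w) module, ('l, 'w) vect_arr) tensor_data \<Rightarrow>
      ('l, 'e, ('l, 'w) module, ('l, 'w) vect_arr) at_data \<Rightarrow> bool" where
  "canonical_vect D T A \<longleftrightarrow> D_category D vect_cat T A \<and>
     (\<exists>tp u j1 j2. canonical_vect_tensor T tp u \<and>
        canonical_vect_atiyah T tp u (jet1 D) lam1 (rho1 D) (at1 A) j1 \<and>
        canonical_vect_atiyah T tp u (jet2 D) (lam2 D) (rho2 D) (at2 A) j2 \<and>
        (\<forall>W\<in>obj vect_cat. \<forall>w\<in>carrier W. app (prj A W) (j1 W w) = w \<and>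
           app (emb A W) (j2 W w) = j1 (aob (at1 A) W) (j1 W w)))"


section \<open>Extension of scalars of a linear category\<close>

text \<open>
  An ind-object of \<open>C\<close> is a presheaf on \<open>C\<close> that is a filtered colimit of representable ones,
  that is, a presheaf whose category of elements is filtered.  An \<open>l\<close>-module in the category of
  ind-objects is then a \<open>'k\<close>-linear presheaf with values in \<open>'l\<close>-vector spaces
  whose category of elements is filtered.  For finite \<open>C\<close>, the presheaves that occur in the
  extension of scalars have values of cardinality at most that of \<open>'l\<close>, so they have isomorphic
  copies with values in the type \<open>('a \<Rightarrow> 'l) set\<close>, which is used below.
\<close>

record ('o, 'a, 'l, 'v) presheaf =
  psp :: "'o \<Rightarrow> ('l, 'v) module"
  pmap :: "'a \<Rightarrow> 'v \<Rightarrow> 'v"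

type_synonym ('o, 'a, 'l, 'v) presheaf_arr =
  "('o, 'a, 'l, 'v) presheaf \<times> ('o, 'a, 'l, 'v) presheaf \<times> ('o \<Rightarrow> 'v \<Rightarrow> 'v)"

type_synonym ('o, 'a, 'l) ext_ob = "('o, 'a, 'l, ('a \<Rightarrow> 'l) set) presheaf"
type_synonym ('o, 'a, 'l) ext_ar = "('o, 'a, 'l, ('a \<Rightarrow> 'l) set) presheaf_arr"

definition filtered_elements :: "('o, 'a, 'k) lcat \<Rightarrow> ('o, 'a, 'l, 'v) presheaf \<Rightarrow> bool" where
  "filtered_elements C F \<longleftrightarrow>
     (\<exists>Y\<in>obj C. carrier (psp F Y) \<noteq> {}) \<and>
     (\<forall>Y\<in>obj C. \<forall>Y'\<in>obj C. \<forall>y\<in>carrier (psp F Y). \<forall>y'\<in>carrier (psp F Y').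
        \<exists>Z\<in>obj C. \<exists>z\<in>carrier (psp F Z). \<exists>f\<in>homs C Y Z. \<exists>f'\<in>homs C Y' Z.
          pmap F f z = y \<and> pmap F f' z = y') \<and>
     (\<forall>Y\<in>obj C. \<forall>Z\<in>obj C. \<forall>z\<in>carrier (psp F Z). \<forall>f\<in>homs C Y Z. \<forall>g\<in>homs C Y Z.
        pmap F f z = pmap F g z \<longrightarrow>
        (\<exists>W\<in>obj C. \<exists>w\<in>carrier (psp F W). \<exists>h\<in>homs C Z W.
           pmap F h w = z \<and> h \<cdot>\<^bsub>C\<^esub> f = h \<cdot>\<^bsub>C\<^esub> g))"

definition ind_lmodule ::
    "('o, 'a, 'k::field) lcat \<Rightarrow> ('k \<Rightarrow> 'l::field) \<Rightarrow> ('o, 'a, 'l, 'v) presheaf \<Rightarrow> bool" where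
  "ind_lmodule C \<phi> F \<longleftrightarrow>
     (\<forall>Y\<in>obj C. module fld (psp F Y)) \<and>
     (\<forall>f\<in>arr C. lin_map (psp F (tgt C f)) (psp F (src C f)) (pmap F f)) \<and>
     (\<forall>Y\<in>obj C. \<forall>y\<in>carrier (psp F Y). pmap F (idt C Y) y = y) \<and>
     (\<forall>f\<in>arr C. \<forall>g\<in>arr C. tgt C f = src C g \<longrightarrow>
        (\<forall>z\<in>carrier (psp F (tgt C g)). pmap F (g \<cdot>\<^bsub>C\<^esub> f) z = pmap F f (pmap F g z))) \<and>
     (\<forall>Y\<in>obj C. \<forall>Z\<in>obj C. \<forall>f\<in>homs C Y Z. \<forall>z\<in>carrier (psp F Z).
        (\<forall>g\<in>homs C Y Z. pmap F (hadd C f g) z = pmap F f z \<oplus>\<^bsub>psp F Y\<^esub> pmap F g z) \<and>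
        (\<forall>a. pmap F (hscal C a f) z = \<phi> a \<odot>\<^bsub>psp F Y\<^esub> pmap F f z)) \<and>
     filtered_elements C F"

definition ind_lmodule_cat ::
    "('o, 'a, 'k::field) lcat \<Rightarrow> ('k \<Rightarrow> 'l::field) \<Rightarrow>
      (('o, 'a, 'l, 'v) presheaf,
       ('o, 'a, 'l, 'v) presheaf_arr, 'l) lcat" where
  "ind_lmodule_cat C \<phi> = \<lparr>obj = {F. ind_lmodule C \<phi> F},
     arr = {(F, G, \<eta>). ind_lmodule C \<phi> F \<and> ind_lmodule C \<phi> G \<and> \<eta> \<in> extensional (obj C) \<and>
       (\<forall>Y\<in>obj C. lin_map (psp F Y) (psp G Y) (\<eta> Y) \<and> \<eta> Y \<in> extensional (carrier (psp F Y))) \<and>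
       (\<forall>f\<in>arr C. \<forall>z\<in>carrier (psp F (tgt C f)).
          \<eta> (src C f) (pmap F f z) = pmap G f (\<eta> (tgt C f) z))},
     src = fst, tgt = (\<lambda>t. fst (snd t)),
     idt = (\<lambda>F. (F, F, \<lambda>Y\<in>obj C. \<lambda>y\<in>carrier (psp F Y). y)),
     cmp = (\<lambda>(F', G', \<theta>) (F, G, \<eta>). (F, G', \<lambda>Y\<in>obj C. \<lambda>y\<in>carrier (psp F Y). \<theta> Y (\<eta> Y y))),
     hzero = (\<lambda>F G. (F, G, \<lambda>Y\<in>obj C. \<lambda>y\<in>carrier (psp F Y). \<zero>\<^bsub>psp G Y\<^esub>)),
     hadd = (\<lambda>(F, G, \<eta>) (F', G', \<theta>).
       (F, G, \<lambda>Y\<in>obj C. \<lambda>y\<in>carrier (psp F Y). \<eta> Y y \<oplus>\<^bsub>psp G Y\<^esub> \<theta> Y y)),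
     hscal = (\<lambda>a (F, G, \<eta>). (F, G, \<lambda>Y\<in>obj C. \<lambda>y\<in>carrier (psp F Y). a \<odot>\<^bsub>psp G Y\<^esub> \<eta> Y y))\<rparr>"

text \<open>The linear extension of \<open>m\<close> to finitely supported functions.\<close>

definition push :: "('v \<Rightarrow> 'w) \<Rightarrow> ('v \<Rightarrow> 'l::field) \<Rightarrow> 'w \<Rightarrow> 'l" where
  "push m g = (\<lambda>w. \<Sum>v\<in>{v. g v \<noteq> 0 \<and> m v = w}. g v)"

text \<open>
  The ind-object \<open>l \<otimes> X\<close>: its value at \<open>Y\<close> is the tensor product of \<open>l\<close> and the space of morphisms
  from \<open>Y\<close> to \<open>X\<close>.
\<close>

definition ext_obj ::
    "('o, 'a, 'k::field) lcat \<Rightarrow> ('k \<Rightarrow> 'l::field) \<Rightarrow> 'o \<Rightarrow> ('o, 'a, 'l) ext_ob" where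
  "ext_obj C \<phi> X = \<lparr>psp = (\<lambda>Y. tensor_space UNIV \<phi> (hspace C Y X)),
     pmap = (\<lambda>f P. \<Union>g\<in>P. tensor_class UNIV \<phi> (hspace C (src C f) X) (push (\<lambda>h. h \<cdot>\<^bsub>C\<^esub> f) g))\<rparr>"

definition ext_arr ::
    "('o, 'a, 'k::field) lcat \<Rightarrow> ('k \<Rightarrow> 'l::field) \<Rightarrow> 'a \<Rightarrow>
      ('o, 'a, 'l) ext_ar" where
  "ext_arr C \<phi> u = (ext_obj C \<phi> (src C u), ext_obj C \<phi> (tgt C u),
     \<lambda>Y\<in>obj C. \<lambda>P\<in>carrier (psp (ext_obj C \<phi> (src C u)) Y).
       \<Union>g\<in>P. tensor_class UNIV \<phi> (hspace C Y (tgt C u)) (push (\<lambda>h. u \<cdot>\<^bsub>C\<^esub> h) g))"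

definition ext_cat ::
    "('o, 'a, 'k::field) lcat \<Rightarrow> ('k \<Rightarrow> 'l::field) \<Rightarrow>
      (('o, 'a, 'l) ext_ob,
       ('o, 'a, 'l) ext_ar, 'l) lcat" where
  "ext_cat C \<phi> = (let I = ind_lmodule_cat C \<phi>;
       Ob = {F \<in> obj I. \<exists>X\<in>obj C. \<exists>X'\<in>obj C. \<exists>f p. f \<in> homs I (ext_obj C \<phi> X) (ext_obj C \<phi> X') \<and>
              tgt I p = F \<and> is_cokernel I p f}
     in I\<lparr>obj := Ob, arr := {t \<in> arr I. src I t \<in> Ob \<and> tgt I t \<in> Ob}\<rparr>)"

text \<open>
  \<open>T'\<close> and \<open>A'\<close> form the canonical structure of a \<open>D\<^sub>l\<close>-category on the extension of scalars.  The
  functor \<open>l \<otimes> -\<close> is a differential functor, and \<open>th1 G X\<close> and \<open>th2 G X\<close> are isomorphisms from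
  \<open>l \<otimes> At\<^sup>i X\<close> to \<open>At\<^sup>i (l \<otimes> X)\<close>; the formula for \<open>At\<^sup>i\<close> on scalar multiples of morphisms is part
  of the definition of a \<open>D\<^sub>l\<close>-category.
\<close>

definition canonical_extension ::
    "('k::field_char_0, 'd::ab_group_add) dfield \<Rightarrow> ('l::field_char_0, 'e::ab_group_add) dfield \<Rightarrow>
      ('k \<Rightarrow> 'l) \<Rightarrow> ('e \<Rightarrow> ('d \<Rightarrow> 'l) set) \<Rightarrow>
      ('o, 'a, 'k) lcat \<Rightarrow> ('o, 'a) tensor_data \<Rightarrow> ('k, 'd, 'o, 'a) at_data \<Rightarrow>
      (('o, 'a, 'l) ext_ob, ('o, 'a, 'l) ext_ar) tensor_data \<Rightarrow>
      ('l, 'e, ('o, 'a, 'l) ext_ob, ('o, 'a, 'l) ext_ar) at_data \<Rightarrow> bool" where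
  "canonical_extension D Dl \<phi> \<Theta> C T A T' A' \<longleftrightarrow> D_category Dl (ext_cat C \<phi>) T' A' \<and>
     (\<exists>G. differential_functor D Dl \<phi> \<Theta> C T A (ext_cat C \<phi>) T' A' (ext_obj C \<phi>) (ext_arr C \<phi>) G \<and>
        (\<forall>X\<in>obj C.
           is_iso (ext_cat C \<phi>) (ext_obj C \<phi> (aob (at1 A) X)) (aob (at1 A') (ext_obj C \<phi> X)) (th1 G X) \<and>
           is_iso (ext_cat C \<phi>) (ext_obj C \<phi> (aob (at2 A) X)) (aob (at2 A') (ext_obj C \<phi> X)) (th2 G X)))"

end

theory Submission
  imports HOL.Vector_Spaces "HOL-Library.Function_Algebras" Defs
begin

text \<open>
  A connection on \<open>X\<close> makes \<open>End X\<close> a module with operators \<open>\<nabla>\<^sub>x\<close>, and it has a curvature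
  with values in \<open>End X\<close>, which vanishes exactly for \<open>D\<close>-structures.  In a general
  \<open>D\<close>-category the Bianchi identity may fail, since \<open>At\<^sup>2\<close> is only an abstract subfunctor of
  \<open>At\<^sup>1 \<circ> At\<^sup>1\<close>; but it holds for every connection on an object which carries some \<open>D\<close>-structure,
  and so it descends from \<open>l \<otimes> X\<close> to \<open>X\<close>.  A \<open>k\<close>-linear retraction of \<open>l\<close> onto \<open>k\<close> yields a
  connection on \<open>X\<close>.  It is made flat along the steps of the filtration of \<open>D\<^sub>k\<close>: if it is flat on
  \<open>D\<^sub>i\<close> and \<open>v\<close> spans \<open>D\<^bsub>i+1\<^esub>\<close> modulo \<open>D\<^sub>i\<close> with \<open>[D\<^sub>i, v] \<subseteq> D\<^sub>i\<close>, then by the Bianchi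
  identity the curvature in the direction of \<open>v\<close> is a 1-cocycle on \<open>D\<^sub>i\<close> with values in \<open>End X\<close>.  It is a
  coboundary because the corresponding extension of \<open>k\<close> by \<open>End X\<close> is a trivial \<open>D\<^sub>i\<close>-module,
  and a primitive gives the correction of the connection.
\<close>

section \<open>Linear forms and tensor products\<close>

text \<open>The equation that makes a connection \<open>s\<close> on \<open>l \<otimes> X\<close> a
  \<open>D\<close>-structure is quadratic in \<open>s\<close>, and the retraction of
  \<open>l\<close> onto \<open>k\<close> is only \<open>k\<close>-linear, so this equation does not
  descend. What descends is linear data: a second-order lift \<open>t\<close> from \<open>X\<close>
  to \<open>At2 X\<close>, which splits the projection to \<open>X\<close> and has equal images
  under the two projections to \<open>At1 X\<close>. Its first-order part is the connection on
  \<open>X\<close>. The conditions on \<open>t\<close> do not mention the connection, so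
  \<open>t\<close> stays fixed while the connection is changed. The lift also makes
  \<open>At2 X\<close> computable: by (c), a morphism from \<open>At2 X\<close> to \<open>X\<close>
  on which \<open>P2\<close> acts through its augmentation is some \<open>e\<close> after the
  projection to \<open>X\<close>, and composition with \<open>t\<close> determines \<open>e\<close>.
  Curvature arises as such an \<open>e\<close>. A step of the filtration need not be an ideal of the
  next one. That \<open>[D_i, v]\<close> lies in \<open>D_i\<close> is achieved by rescaling
  \<open>v\<close>: the quotient of two consecutive steps is a one-dimensional
  \<open>D_i\<close>-module, so linear closedness gives it an invariant generator.\<close>

lemma (in abelian_group) add_minus_cancel:
  assumes "a \<in> carrier G" "b \<in> carrier G"
  shows "a \<oplus> b \<ominus> a \<ominus> b = \<zero>"
proof -
  have "a \<oplus> b \<ominus> a = b \<oplus> (a \<oplus> \<ominus> a)"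
    unfolding minus_eq a_comm[OF assms] by (rule a_assoc) (use assms in auto)
  also have "\<dots> = b" using assms r_neg by simp
  finally show ?thesis using assms r_neg by (simp add: minus_eq)
qed

lemma (in abelian_group) eq_if_minus_zero:
  assumes "a \<in> carrier G" "b \<in> carrier G" "a \<ominus> b = \<zero>"
  shows "a = b"
proof -
  have "a = a \<ominus> b \<oplus> b" unfolding minus_eq using assms(1,2) by (simp add: a_assoc l_neg)
  then show ?thesis using assms by simp
qed

definition linear_form :: "('k::field, 'v) module \<Rightarrow> ('v \<Rightarrow> 'k) \<Rightarrow> bool" where
  "linear_form V p \<longleftrightarrow>
     (\<forall>v\<in>carrier V. \<forall>w\<in>carrier V. p (v \<oplus>\<^bsub>V\<^esub> w) = p v + p w) \<and>
     (\<forall>a. \<forall>v\<in>carrier V. p (a \<odot>\<^bsub>V\<^esub> v) = a * p v)"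

lemma lin_ext_eq_finsum:
  fixes V :: "('k::field, 'v) module"
  assumes W: "module fld W" and j: "j \<in> carrier V \<rightarrow> carrier W"
    and A: "finite A" "A \<subseteq> carrier V" and f: "{v. f v \<noteq> 0} \<subseteq> A"
  shows "lin_ext W j f = (\<Oplus>\<^bsub>W\<^esub>v\<in>A. f v \<odot>\<^bsub>W\<^esub> j v)"
proof -
  interpret W: module fld W by (rule W)
  have cl: "b \<odot>\<^bsub>W\<^esub> j v \<in> carrier W" if "v \<in> A" for b v
    using that A j by (auto intro!: W.smult_closed)
  have z: "0 \<odot>\<^bsub>W\<^esub> w = \<zero>\<^bsub>W\<^esub>" if "w \<in> carrier W" for w
    using W.smult_l_null[OF that] by simp
  show ?thesis
    unfolding lin_ext_def
    by (rule W.add.finprod_mono_neutral_cong_left)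
       (use A f cl z j in \<open>auto intro!: z\<close>)
qed

lemma lin_ext_closed:
  fixes V :: "('k::field, 'v) module"
  assumes W: "module fld W" and j: "j \<in> carrier V \<rightarrow> carrier W" and f: "f \<in> fin_supp (carrier V)"
  shows "lin_ext W j f \<in> carrier W"
proof -
  interpret W: module fld W by (rule W)
  show ?thesis unfolding lin_ext_def
    by (rule W.finsum_closed) (use f j in \<open>auto simp: fin_supp_def intro!: W.smult_closed\<close>)
qed

lemma lin_ext_add:
  fixes V :: "('k::field, 'v) module"
  assumes W: "module fld W" and j: "j \<in> carrier V \<rightarrow> carrier W"
    and f: "f \<in> fin_supp (carrier V)" and g: "g \<in> fin_supp (carrier V)"
  shows "lin_ext W j (\<lambda>x. f x + g x) = lin_ext W j f \<oplus>\<^bsub>W\<^esub> lin_ext W j g"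
proof -
  interpret W: module fld W by (rule W)
  let ?A = "{v. f v \<noteq> 0} \<union> {v. g v \<noteq> 0}"
  have A: "finite ?A" "?A \<subseteq> carrier V" using f g by (auto simp: fin_supp_def)
  have cl: "b \<odot>\<^bsub>W\<^esub> j v \<in> carrier W" if "v \<in> ?A" for b v
    using that A j by (auto intro!: W.smult_closed)
  have "lin_ext W j (\<lambda>x. f x + g x) = (\<Oplus>\<^bsub>W\<^esub>v\<in>?A. (f v + g v) \<odot>\<^bsub>W\<^esub> j v)"
    by (rule lin_ext_eq_finsum[OF W j A]) auto
  also have "\<dots> = (\<Oplus>\<^bsub>W\<^esub>v\<in>?A. f v \<odot>\<^bsub>W\<^esub> j v \<oplus>\<^bsub>W\<^esub> g v \<odot>\<^bsub>W\<^esub> j v)"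
  proof (rule W.finsum_cong')
    fix v assume "v \<in> ?A"
    then have "j v \<in> carrier W" using A j by blast
    then show "(f v + g v) \<odot>\<^bsub>W\<^esub> j v = f v \<odot>\<^bsub>W\<^esub> j v \<oplus>\<^bsub>W\<^esub> g v \<odot>\<^bsub>W\<^esub> j v"
      using W.smult_l_distr[of "f v" "g v" "j v"] by simp
  qed (use cl in auto)
  also have "\<dots> = (\<Oplus>\<^bsub>W\<^esub>v\<in>?A. f v \<odot>\<^bsub>W\<^esub> j v) \<oplus>\<^bsub>W\<^esub> (\<Oplus>\<^bsub>W\<^esub>v\<in>?A. g v \<odot>\<^bsub>W\<^esub> j v)"
    by (rule W.finsum_addf) (use cl in auto)
  also have "(\<Oplus>\<^bsub>W\<^esub>v\<in>?A. f v \<odot>\<^bsub>W\<^esub> j v) = lin_ext W j f"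
    by (rule lin_ext_eq_finsum[OF W j A, symmetric]) auto
  also have "(\<Oplus>\<^bsub>W\<^esub>v\<in>?A. g v \<odot>\<^bsub>W\<^esub> j v) = lin_ext W j g"
    by (rule lin_ext_eq_finsum[OF W j A, symmetric]) auto
  finally show ?thesis .
qed

lemma lin_ext_smult:
  fixes V :: "('k::field, 'v) module"
  assumes W: "module fld W" and j: "j \<in> carrier V \<rightarrow> carrier W"
    and f: "f \<in> fin_supp (carrier V)"
  shows "lin_ext W j (\<lambda>x. c * f x) = c \<odot>\<^bsub>W\<^esub> lin_ext W j f"
proof -
  interpret W: module fld W by (rule W)
  let ?A = "{v. f v \<noteq> 0}"
  have A: "finite ?A" "?A \<subseteq> carrier V" using f by (auto simp: fin_supp_def)
  have jc: "j v \<in> carrier W" if "v \<in> ?A" for v using that A j by blast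
  have cl: "b \<odot>\<^bsub>W\<^esub> j v \<in> carrier W" if "v \<in> ?A" for b v
    using jc[OF that] W.smult_closed by simp
  have *: "(c * f v) \<odot>\<^bsub>W\<^esub> j v = c \<odot>\<^bsub>W\<^esub> (f v \<odot>\<^bsub>W\<^esub> j v)" if "v \<in> ?A" for v
    using W.smult_assoc1[of c "f v" "j v"] jc[OF that] by simp
  have "lin_ext W j (\<lambda>x. c * f x) = (\<Oplus>\<^bsub>W\<^esub>v\<in>?A. (c * f v) \<odot>\<^bsub>W\<^esub> j v)"
    by (rule lin_ext_eq_finsum[OF W j A]) auto
  also have "\<dots> = (\<Oplus>\<^bsub>W\<^esub>v\<in>?A. c \<odot>\<^bsub>W\<^esub> (f v \<odot>\<^bsub>W\<^esub> j v))"
    by (rule W.finsum_cong') (use cl jc * W.smult_closed in auto)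
  also have "\<dots> = c \<odot>\<^bsub>W\<^esub> lin_ext W j f"
    unfolding lin_ext_def
    by (rule W.finsum_smult_ldistr[symmetric]) (use A cl in auto)
  finally show ?thesis .
qed

lemma single_fin_supp: "v \<in> A \<Longrightarrow> single v \<in> fin_supp A"
  by (auto simp: single_def fin_supp_def)

lemma fin_supp_add: "f \<in> fin_supp A \<Longrightarrow> g \<in> fin_supp A \<Longrightarrow> (\<lambda>x. f x + g x) \<in> fin_supp A"
proof -
  assume a: "f \<in> fin_supp A" "g \<in> fin_supp A"
  have "{v. f v + g v \<noteq> 0} \<subseteq> {v. f v \<noteq> 0} \<union> {v. g v \<noteq> 0}" by auto
  moreover have "finite ({v. f v \<noteq> 0} \<union> {v. g v \<noteq> 0})" using a by (simp add: fin_supp_def)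
  ultimately show ?thesis using a by (auto simp: fin_supp_def intro: finite_subset)
qed

lemma fin_supp_smult: "f \<in> fin_supp A \<Longrightarrow> (\<lambda>x. c * f x) \<in> fin_supp A"
  unfolding fin_supp_def by (auto elim: rev_finite_subset)

lemma fin_supp_diff: "f \<in> fin_supp A \<Longrightarrow> g \<in> fin_supp A \<Longrightarrow> (\<lambda>x. f x - g x) \<in> fin_supp A"
  using fin_supp_add[of f A "\<lambda>x. - 1 * g x"] fin_supp_smult[of g A "-1"] by simp

lemma lin_ext_diff:
  fixes V :: "('k::field, 'v) module"
  assumes W: "module fld W" and j: "j \<in> carrier V \<rightarrow> carrier W"
    and f: "f \<in> fin_supp (carrier V)" and g: "g \<in> fin_supp (carrier V)"
  shows "lin_ext W j (\<lambda>x. f x - g x) = lin_ext W j f \<ominus>\<^bsub>W\<^esub> lin_ext W j g"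
proof -
  interpret W: module fld W by (rule W)
  have g': "lin_ext W j g \<in> carrier W" by (rule lin_ext_closed[OF W j g])
  have "lin_ext W j (\<lambda>x. f x - g x) = lin_ext W j (\<lambda>x. f x + (- 1) * g x)" by simp
  also have "\<dots> = lin_ext W j f \<oplus>\<^bsub>W\<^esub> lin_ext W j (\<lambda>x. (- 1) * g x)"
    by (rule lin_ext_add[OF W j f fin_supp_smult[OF g]])
  also have "lin_ext W j (\<lambda>x. (- 1) * g x) = (- 1) \<odot>\<^bsub>W\<^esub> lin_ext W j g"
    by (rule lin_ext_smult[OF W j g])
  also have "\<dots> = \<ominus>\<^bsub>W\<^esub> lin_ext W j g"
  proof -
    have "(- 1) \<odot>\<^bsub>W\<^esub> lin_ext W j g \<oplus>\<^bsub>W\<^esub> 1 \<odot>\<^bsub>W\<^esub> lin_ext W j g = 0 \<odot>\<^bsub>W\<^esub> lin_ext W j g"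
      using W.smult_l_distr[of "- 1" 1 "lin_ext W j g"] g' by simp
    then have "(- 1) \<odot>\<^bsub>W\<^esub> lin_ext W j g \<oplus>\<^bsub>W\<^esub> lin_ext W j g = \<zero>\<^bsub>W\<^esub>"
      using W.smult_l_null[OF g'] W.smult_one[OF g'] by simp
    then show ?thesis using W.smult_closed[of "- 1", OF _ g'] g' by (simp add: W.minus_equality)
  qed
  finally show ?thesis by (simp add: a_minus_def)
qed

lemma lin_ext_single:
  fixes W :: "('k::field, 'w) module"
  assumes W: "module fld W" and j: "j v \<in> carrier W"
  shows "lin_ext W j (single v) = j v"
proof -
  interpret W: module fld W by (rule W)
  have "{x. single v x \<noteq> (0::'k)} = {v}" by (auto simp: single_def)
  then show ?thesis using j W.smult_one[OF j] by (simp add: lin_ext_def single_def)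
qed

text \<open>Invariants are in general stable only under the constants, so they do not form a
  \<open>module\<close> over \<open>fld\<close>. This weaker closure property is what the source of
  a tensor product has to satisfy; it covers full spaces and spaces of invariants alike.\<close>

definition closed_under :: "'k set \<Rightarrow> ('k, 'v) module \<Rightarrow> bool" where
  "closed_under S V \<longleftrightarrow> (\<forall>v\<in>carrier V. \<forall>w\<in>carrier V. v \<oplus>\<^bsub>V\<^esub> w \<in> carrier V) \<and>
     (\<forall>a\<in>S. \<forall>v\<in>carrier V. a \<odot>\<^bsub>V\<^esub> v \<in> carrier V)"

lemma module_closed_under: "module fld V \<Longrightarrow> closed_under S V"
proof -
  assume "module fld V"
  then interpret V: module fld V .
  show ?thesis using V.smult_closed by (auto simp: closed_under_def)
qed

lemma tensor_null_fin_supp: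
  assumes "closed_under S V" and "f \<in> tensor_null S \<phi> V"
  shows "f \<in> fin_supp (carrier V)"
proof -
  show ?thesis using assms(2)
  proof induction
    case null_zero then show ?case by (simp add: fin_supp_def)
  next
    case (rel_add v w) then show ?case
      using assms(1) by (intro fin_supp_diff single_fin_supp) (auto simp: closed_under_def)
  next
    case (rel_smult a v) then show ?case
      using assms(1) by (intro fin_supp_diff single_fin_supp fin_supp_smult) (auto simp: closed_under_def)
  qed (auto intro: fin_supp_add fin_supp_smult)
qed

text \<open>Each generating relation evaluates to zero because \<open>j\<close> is additive and
  \<open>S\<close>-semilinear; hence the value of \<open>lin_ext\<close> depends only on the tensor
  class.\<close>

lemma lin_ext_tensor_null:
  fixes V :: "('k::field, 'v) module"
  assumes V: "closed_under S V" and W: "module fld W" and j: "semilin_map S \<phi> V W j"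
    and f: "f \<in> tensor_null S \<phi> V"
  shows "lin_ext W j f = \<zero>\<^bsub>W\<^esub>"
proof -
  have Vc: "v \<oplus>\<^bsub>V\<^esub> w \<in> carrier V" "a \<in> S \<Longrightarrow> a \<odot>\<^bsub>V\<^esub> v \<in> carrier V"
    if "v \<in> carrier V" "w \<in> carrier V" for a v w
    using V that by (auto simp: closed_under_def)
  interpret W: module fld W by (rule W)
  have j': "j \<in> carrier V \<rightarrow> carrier W" using j by (simp add: semilin_map_def)
  note fs = tensor_null_fin_supp[OF V]
  have jc: "j v \<in> carrier W" if "v \<in> carrier V" for v using j' that by blast
  show ?thesis using f
  proof induction
    case null_zero then show ?case by (simp add: lin_ext_def)
  next
    case (null_add f g) then show ?case by (simp add: lin_ext_add[OF W j' fs fs])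
  next
    case (null_smult f c) then show ?case
      using W.smult_r_null[of c] by (simp add: lin_ext_smult[OF W j' fs])
  next
    case (rel_add v w)
    then have "j (v \<oplus>\<^bsub>V\<^esub> w) = j v \<oplus>\<^bsub>W\<^esub> j w" using j by (simp add: semilin_map_def)
    then show ?case using rel_add jc Vc
      apply (subst lin_ext_diff[OF W j' fin_supp_diff[OF single_fin_supp single_fin_supp] single_fin_supp])
         apply simp_all
      apply (subst lin_ext_diff[OF W j' single_fin_supp single_fin_supp])
        apply (simp_all add: lin_ext_single[OF W])
      by (rule W.add_minus_cancel)
  next
    case (rel_smult a v)
    then have "j (a \<odot>\<^bsub>V\<^esub> v) = \<phi> a \<odot>\<^bsub>W\<^esub> j v" using j by (simp add: semilin_map_def)
    then show ?case using rel_smult jc Vc(2)[OF rel_smult(2) rel_smult(2) rel_smult(1)] W.smult_closed[of "\<phi> a" "j v"]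
      apply (subst lin_ext_diff[OF W j' single_fin_supp fin_supp_smult[OF single_fin_supp]])
        apply (simp_all add: lin_ext_single[OF W] lin_ext_smult[OF W j' single_fin_supp])
      by (simp add: a_minus_def W.r_neg)
  qed
qed

text \<open>A basis of \<open>N\<close> together with \<open>x\<close> is independent, so values may
  be prescribed on it. This one fact yields the linear forms that separate morphisms, the one-forms
  that vanish on a step of the filtration, and the retraction of \<open>l\<close> onto
  \<open>k\<close>.\<close>

lemma separating_form:
  fixes s :: "'k::field \<Rightarrow> 'b::ab_group_add \<Rightarrow> 'b"
  assumes "vector_space s" and N: "0 \<in> N" "\<And>u v. u \<in> N \<Longrightarrow> v \<in> N \<Longrightarrow> u + v \<in> N"
    "\<And>a v. v \<in> N \<Longrightarrow> s a v \<in> N" and x: "x \<notin> N"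
  shows "\<exists>P. (\<forall>u v. P (u + v) = P u + P v) \<and> (\<forall>a v. P (s a v) = a * P v) \<and>
    (\<forall>u\<in>N. P u = 0) \<and> P x = 1"
proof -
  interpret vector_space s by fact
  interpret vector_space_pair s "(*) :: 'k \<Rightarrow> 'k \<Rightarrow> 'k"
    by unfold_locales (auto simp: algebra_simps)
  have sub: "subspace N" using N by (auto simp: subspace_def)
  obtain B where B: "B \<subseteq> N" "independent B" "N \<subseteq> span B"
    using maximal_independent_subset by blast
  have "span B = N" using B sub by (metis span_minimal subset_antisym)
  then have ins: "independent (insert x B)" using x B by (simp add: independent_insertI)
  obtain P where P: "Vector_Spaces.linear s (*) P" "\<forall>u\<in>insert x B. P u = (if u = x then 1 else 0)"
    using linear_independent_extend[OF ins, of "\<lambda>u. if u = x then 1 else 0"] by blast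
  interpret P: Vector_Spaces.linear s "(*)" P by (rule P)
  have "P u = 0" if "u \<in> N" for u
  proof -
    have "u \<in> span B" using \<open>span B = N\<close> that by simp
    moreover have "P b = 0" if "b \<in> B" for b using P(2) that B x by auto
    ultimately show ?thesis
      by (metis (no_types, lifting) linear_eq_0_on_span P(1))
  qed
  then show ?thesis using P P.add P.scale by auto
qed

text \<open>A \<open>module\<close> has a carrier set, whereas \<open>separating_form\<close>
  concerns a whole type. So \<open>V\<close> is presented inside the type of functions, by the
  vectors \<open>single w\<close> modulo the relations \<open>tensor_null UNIV id V\<close>; a form
  \<open>P\<close> that kills the relations gives the linear form
  \<open>w \<mapsto> P (single w)\<close>.\<close>

lemma module_separation:
  fixes V :: "('k::field, 'v) module"
  assumes V: "module fld V" and u: "u \<in> carrier V" "v \<in> carrier V" "u \<noteq> v"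
  shows "\<exists>p. linear_form V p \<and> p u \<noteq> p v"
proof -
  interpret V: module fld V by (rule V)
  let ?s = "\<lambda>(a::'k) (f::'v \<Rightarrow> 'k) x. a * f x"
  let ?N = "tensor_null UNIV id V"
  interpret vs: vector_space ?s
    by unfold_locales (auto simp: algebra_simps plus_fun_def)
  have id: "semilin_map UNIV id V V id" by (simp add: semilin_map_def)
  have sub: "0 \<in> ?N" "\<And>u v. u \<in> ?N \<Longrightarrow> v \<in> ?N \<Longrightarrow> u + v \<in> ?N"
    "\<And>a v. v \<in> ?N \<Longrightarrow> ?s a v \<in> ?N"
    using tensor_null.null_zero[of UNIV id V] tensor_null.null_add[of _ UNIV id V] tensor_null.null_smult[of _ UNIV id V]
    by (auto simp: plus_fun_def zero_fun_def)
  \<comment> \<open>Under \<open>lin_ext\<close> with \<open>j = id\<close> every relation evaluates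
    to zero, but this vector evaluates to the difference of \<open>u\<close> and
    \<open>v\<close>.\<close>
  have "(\<lambda>x. single u x - single v x) \<notin> ?N"
  proof
    assume "(\<lambda>x. single u x - single v x) \<in> ?N"
    from lin_ext_tensor_null[OF module_closed_under[OF V] V id this] have "u \<ominus>\<^bsub>V\<^esub> v = \<zero>\<^bsub>V\<^esub>"
      using u by (subst (asm) lin_ext_diff[OF V _ single_fin_supp single_fin_supp])
        (auto simp: lin_ext_single[OF V])
    then show False using u V.eq_if_minus_zero by blast
  qed
  then have "single u - single v \<notin> ?N" by (simp add: fun_diff_def)
  from separating_form[OF vs.vector_space_axioms sub this]
  obtain P where P: "\<And>f g. P (f + g) = P f + P g" "\<And>a f. P (?s a f) = a * P f"
    "\<And>f. f \<in> ?N \<Longrightarrow> P f = 0" "P (single u - single v) = 1" by blast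
  have Pd: "P (f - g) = P f - P g" for f g
    using P(1)[of "f - g" g] by (simp add: algebra_simps)
  let ?p = "\<lambda>w. P (single w)"
  have "linear_form V ?p"
    unfolding linear_form_def
  proof (intro conjI ballI allI)
    fix v w assume vw: "v \<in> carrier V" "w \<in> carrier V"
    have "P (single (v \<oplus>\<^bsub>V\<^esub> w) - single v - single w) = 0"
      by (rule P(3)) (use tensor_null.rel_add[OF vw, of UNIV id] in \<open>simp add: fun_diff_def\<close>)
    then show "P (single (v \<oplus>\<^bsub>V\<^esub> w)) = P (single v) + P (single w)"
      by (simp add: Pd diff_eq_eq add.commute)
  next
    fix a v assume v: "v \<in> carrier V"
    have "P (single (a \<odot>\<^bsub>V\<^esub> v) - ?s a (single v)) = 0"
      by (rule P(3)) (use tensor_null.rel_smult[OF _ v, of a UNIV id] in \<open>simp add: fun_diff_def\<close>)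
    then show "P (single (a \<odot>\<^bsub>V\<^esub> v)) = a * P (single v)" by (simp only: Pd P(2)) simp
  qed
  moreover have "?p u \<noteq> ?p v" using P(4) unfolding Pd by (metis cancel_comm_monoid_add_class.diff_cancel zero_neq_one)
  ultimately show ?thesis by blast
qed

lemma tensor_class_self: "f \<in> fin_supp (carrier V) \<Longrightarrow> f \<in> tensor_class S \<phi> V f"
  using tensor_null.null_zero[of S \<phi> V] by (simp add: tensor_class_def)

lemma lin_ext_tensor_class:
  fixes V :: "('k::field, 'v) module"
  assumes V: "closed_under S V" and W: "module fld W" and j: "semilin_map S \<phi> V W j"
    and f: "f \<in> fin_supp (carrier V)" and g: "g \<in> tensor_class S \<phi> V f"
  shows "lin_ext W j g = lin_ext W j f"
proof -
  interpret W: module fld W by (rule W)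
  have j': "j \<in> carrier V \<rightarrow> carrier W" using j by (simp add: semilin_map_def)
  have g': "g \<in> fin_supp (carrier V)" "(\<lambda>x. g x - f x) \<in> tensor_null S \<phi> V"
    using g by (auto simp: tensor_class_def)
  have "lin_ext W j g \<ominus>\<^bsub>W\<^esub> lin_ext W j f = \<zero>\<^bsub>W\<^esub>"
    using lin_ext_tensor_null[OF V W j g'(2)] by (simp add: lin_ext_diff[OF W j' g'(1) f])
  then show ?thesis using lin_ext_closed[OF W j'] f g'(1) W.eq_if_minus_zero by blast
qed

text \<open>The map in \<open>is_scalar_extension\<close> is written with \<open>the_elem\<close> of
  an image; on a tensor class this image is a singleton.\<close>

lemma the_elem_lin_ext:
  fixes V :: "('k::field, 'v) module"
  assumes "closed_under S V" and "module fld W" and "semilin_map S \<phi> V W j"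
    and "f \<in> fin_supp (carrier V)"
  shows "the_elem (lin_ext W j ` tensor_class S \<phi> V f) = lin_ext W j f"
proof -
  have "lin_ext W j ` tensor_class S \<phi> V f = {lin_ext W j f}"
    using lin_ext_tensor_class[OF assms] tensor_class_self[OF assms(4)] by fast
  then show ?thesis by simp
qed

lemma linear_form_finsum:
  assumes V: "module fld V" and p: "linear_form V p" and g: "g \<in> A \<rightarrow> carrier V" and A: "finite A"
  shows "p (\<Oplus>\<^bsub>V\<^esub>x\<in>A. g x) = (\<Sum>x\<in>A. p (g x))"
proof -
  interpret V: module fld V by (rule V)
  have "p (\<zero>\<^bsub>V\<^esub> \<oplus>\<^bsub>V\<^esub> \<zero>\<^bsub>V\<^esub>) = p \<zero>\<^bsub>V\<^esub> + p \<zero>\<^bsub>V\<^esub>"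
    using p V.zero_closed unfolding linear_form_def by blast
  then have "p \<zero>\<^bsub>V\<^esub> + p \<zero>\<^bsub>V\<^esub> = p \<zero>\<^bsub>V\<^esub> + 0" by (simp only: V.l_zero[OF V.zero_closed] add_0_right)
  then have z: "p \<zero>\<^bsub>V\<^esub> = 0" by (rule add_left_imp_eq)
  show ?thesis using A g
    by (induction A) (auto simp: z p[unfolded linear_form_def])
qed

lemma linear_form_lin_ext:
  fixes V :: "('k::field, 'v) module"
  assumes W: "module fld W" and p: "linear_form W p"
    and j: "j \<in> carrier V \<rightarrow> carrier W" and f: "f \<in> fin_supp (carrier V)"
  shows "p (lin_ext W j f) = (\<Sum>v\<in>{v. f v \<noteq> 0}. f v * p (j v))"
proof -
  interpret W: module fld W by (rule W)
  have jc: "j v \<in> carrier W" if "f v \<noteq> 0" for v using that f j by (auto simp: fin_supp_def)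
  show ?thesis unfolding lin_ext_def
    by (subst linear_form_finsum[OF W p])
      (use jc W.smult_closed f p in \<open>auto simp: fin_supp_def linear_form_def intro!: sum.cong\<close>)
qed

section \<open>Differential fields and linear categories\<close>

locale diff_field =
  fixes D :: "('k::field_char_0, 'd::ab_group_add) dfield"
  assumes D: "differential_field D"
begin

lemma scl_module: "module fld (dspace D)"
  using D by (simp add: differential_field_def)

lemma scl_simps:
  "scl D a (x + y) = scl D a x + scl D a y"
  "scl D (a + b) x = scl D a x + scl D b x"
  "scl D a (scl D b x) = scl D (a * b) x"
  "scl D 1 x = x"
proof -
  interpret M: module fld "dspace D" by (rule scl_module)
  show "scl D a (x + y) = scl D a x + scl D a y" "scl D (a + b) x = scl D a x + scl D b x"
    "scl D a (scl D b x) = scl D (a * b) x" "scl D 1 x = x"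
    using M.smult_r_distr[of a x y] M.smult_l_distr[of a b x] M.smult_assoc1[of a b x] M.smult_one[of x]
    by (simp_all add: tspace_def)
qed

sublocale scl: vector_space "scl D"
  by unfold_locales (simp_all add: scl_simps)

lemma lie_simps:
  "lie D (x + y) z = lie D x z + lie D y z"
  "lie D x (y + z) = lie D x y + lie D x z"
  "lie D x x = 0"
  "lie D x (scl D a y) = scl D a (lie D x y) + scl D (der D x a) y"
  using D by (simp_all add: differential_field_def)

lemma jacobi: "lie D x (lie D y z) + lie D y (lie D z x) + lie D z (lie D x y) = 0"
  using D by (simp add: differential_field_def)

lemma lie_swap: "lie D x y = - lie D y x"
proof -
  have "lie D (x + y) (x + y) = 0" by (rule lie_simps)
  then have "lie D x x + lie D y x + (lie D x y + lie D y y) = 0"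
    by (simp only: lie_simps(1,2))
  then have "lie D x y + lie D y x = 0" by (simp add: lie_simps(3) add.commute)
  then show ?thesis by (simp add: eq_neg_iff_add_eq_0)
qed

lemma lie_zero [simp]: "lie D 0 x = 0" "lie D x 0 = 0"
  using lie_simps(1)[of 0 0 x] lie_simps(2)[of x 0 0] by simp_all

lemma lie_scl_left: "lie D (scl D a y) x = scl D a (lie D y x) - scl D (der D x a) y"
  by (metis lie_swap lie_simps(4) minus_add_distrib scl.scale_minus_right add_uminus_conv_diff)

lemma der_simps:
  "der D x (a + b) = der D x a + der D x b"
  "der D x (a * b) = der D x a * b + a * der D x b"
  "der D (x + y) a = der D x a + der D y a"
  "der D (scl D c x) a = c * der D x a"
  "der D (lie D x y) a = der D x (der D y a) - der D y (der D x a)"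
  using D by (simp_all add: differential_field_def)

lemma der_zero [simp]: "der D x 0 = 0" "der D 0 a = 0"
  using der_simps(1)[of x 0 0] der_simps(3)[of 0 0 a] by simp_all

lemma der_one [simp]: "der D x 1 = 0"
  using der_simps(2)[of x 1 1] by simp

lemma der_minus: "der D x (- a) = - der D x a"
  by (metis add.right_inverse add_eq_0_iff der_simps(1) der_zero(1))

lemma der_diff: "der D x (a - b) = der D x a - der D x b"
  using der_simps(1)[of x a "- b"] by (simp add: der_minus)

lemma der_inverse: "a \<noteq> 0 \<Longrightarrow> der D x a = 0 \<Longrightarrow> der D x (inverse a) = 0"
  using der_simps(2)[of x a "inverse a"] by simp

lemma forms1_simps:
  assumes "\<omega> \<in> forms1 D"
  shows "\<omega> (x + y) = \<omega> x + \<omega> y" "\<omega> (scl D a x) = a * \<omega> x" "\<omega> 0 = 0" "\<omega> (- x) = - \<omega> x"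
    "\<omega> (x - y) = \<omega> x - \<omega> y"
proof -
  show a: "\<omega> (x + y) = \<omega> x + \<omega> y" "\<omega> (scl D a x) = a * \<omega> x" for x y a
    using assms by (simp_all add: forms1_def)
  show z: "\<omega> 0 = 0" using a(2)[of 0 0] by simp
  show m: "\<omega> (- x) = - \<omega> x" for x using a(1)[of x "- x"] z by (simp add: eq_neg_iff_add_eq_0 add.commute)
  show "\<omega> (x - y) = \<omega> x - \<omega> y" using a(1)[of x "- y"] m[of y] by simp
qed

lemma forms1_closed [simp]:
  "(\<lambda>x. 0) \<in> forms1 D"
  "\<omega> \<in> forms1 D \<Longrightarrow> \<eta> \<in> forms1 D \<Longrightarrow> (\<lambda>x. \<omega> x + \<eta> x) \<in> forms1 D"
  "\<omega> \<in> forms1 D \<Longrightarrow> \<eta> \<in> forms1 D \<Longrightarrow> (\<lambda>x. \<omega> x - \<eta> x) \<in> forms1 D"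
  "\<omega> \<in> forms1 D \<Longrightarrow> (\<lambda>x. a * \<omega> x) \<in> forms1 D"
  "d0 D a \<in> forms1 D"
  by (auto simp: forms1_def algebra_simps d0_def der_simps)

lemma forms1_sum: "\<omega> \<in> forms1 D \<Longrightarrow> \<omega> (\<Sum>b\<in>B. g b) = (\<Sum>b\<in>B. \<omega> (g b))"
  by (induction B rule: infinite_finite_induct) (simp_all add: forms1_simps)

lemma forms1_sum_closed:
  assumes "\<And>b. \<omega> b \<in> forms1 D"
  shows "(\<lambda>x. \<Sum>b\<in>B. c b * \<omega> b x) \<in> forms1 D"
proof (induction B rule: infinite_finite_induct)
  case (insert b F)
  have "(\<lambda>x. c b * \<omega> b x + (\<Sum>b\<in>F. c b * \<omega> b x)) \<in> forms1 D"
    by (intro forms1_closed assms insert.IH)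
  then show ?case using insert by simp
qed simp_all

lemma separating_one_form:
  assumes "0 \<in> N" "\<And>u v. u \<in> N \<Longrightarrow> v \<in> N \<Longrightarrow> u + v \<in> N" "\<And>a v. v \<in> N \<Longrightarrow> scl D a v \<in> N" "x \<notin> N"
  shows "\<exists>\<omega>\<in>forms1 D. (\<forall>u\<in>N. \<omega> u = 0) \<and> \<omega> x = 1"
  using separating_form[OF scl.vector_space_axioms assms] unfolding forms1_def by blast

lemma finsum_dspace:
  "finite B \<Longrightarrow> (\<Oplus>\<^bsub>dspace D\<^esub>b\<in>B. g b) = sum g B"
proof -
  interpret M: module fld "dspace D" by (rule scl_module)
  show "finite B \<Longrightarrow> (\<Oplus>\<^bsub>dspace D\<^esub>b\<in>B. g b) = sum g B"
    by (induction B rule: finite_induct) (simp_all add: tspace_def M.finsum_insert[unfolded tspace_def] M.finsum_empty[unfolded tspace_def])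
qed

text \<open>The one-forms are the coordinates for a basis extracted from a finite spanning set. Of
  duality only the expansion of one-forms in the last clause is retained; every later sum over the
  basis is evaluated by it.\<close>

lemma dual_basis:
  obtains B \<omega> where "finite B" "\<And>b. \<omega> b \<in> forms1 D"
    "\<And>\<eta> x. \<eta> \<in> forms1 D \<Longrightarrow> (\<Sum>b\<in>B. \<omega> b x * \<eta> b) = \<eta> x"
proof -
  from D obtain S where S: "finite S" "\<And>v. \<exists>c. v = (\<Oplus>\<^bsub>dspace D\<^esub>b\<in>S. c b \<odot>\<^bsub>dspace D\<^esub> b)"
    unfolding differential_field_def fin_dim_def by (auto simp: tspace_def)
  have span: "v \<in> scl.span S" for v
  proof -
    obtain c where "v = (\<Oplus>\<^bsub>dspace D\<^esub>b\<in>S. c b \<odot>\<^bsub>dspace D\<^esub> b)" using S(2) by blast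
    then have "v = (\<Sum>b\<in>S. scl D (c b) b)" by (simp add: finsum_dspace[OF S(1)]) (simp add: tspace_def)
    then show ?thesis by (simp add: scl.span_sum scl.span_scale scl.span_base)
  qed
  obtain B where B: "B \<subseteq> S" "scl.independent B" "S \<subseteq> scl.span B"
    using scl.maximal_independent_subset by blast
  have fB: "finite B" using B(1) S(1) by (rule finite_subset)
  have spB: "v \<in> scl.span B" for v
    using span B(3) by (metis scl.span_mono scl.span_span subsetD)
  let ?w = "\<lambda>b x. scl.representation B x b"
  have w: "?w b \<in> forms1 D" for b
    unfolding forms1_def
    by (simp add: scl.representation_add[OF B(2) spB spB] scl.representation_scale[OF B(2) spB])
  have e: "(\<Sum>b\<in>B. ?w b x * \<eta> b) = \<eta> x" if h: "\<eta> \<in> forms1 D" for \<eta> x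
  proof -
    have "x = (\<Sum>b\<in>B. scl D (?w b x) b)"
      using scl.sum_representation_eq[OF B(2) spB fB] by simp
    then have "\<eta> x = \<eta> (\<Sum>b\<in>B. scl D (?w b x) b)" by simp
    also have "\<dots> = (\<Sum>b\<in>B. \<eta> (scl D (?w b x) b))"
      by (rule forms1_sum[OF h])
    finally show ?thesis by (simp add: forms1_simps(2)[OF h])
  qed
  show ?thesis by (rule that[of B ?w]) (fact fB w e)+
qed

text \<open>Chosen once, so that the splittings of \<open>At1 X\<close> for all connections are sums
  over the same index set \<open>bas\<close>.\<close>

definition dual_pair :: "'d set \<times> ('d \<Rightarrow> 'd \<Rightarrow> 'k)" where
  "dual_pair = (SOME (B, \<omega>). finite B \<and> (\<forall>b. \<omega> b \<in> forms1 D) \<and>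
     (\<forall>\<eta>\<in>forms1 D. \<forall>x. (\<Sum>b\<in>B. \<omega> b x * \<eta> b) = \<eta> x))"

definition "bas = fst dual_pair"
definition "dual = snd dual_pair"

lemma bas_finite [simp]: "finite bas"
  and dual_form [simp]: "dual b \<in> forms1 D"
  and dual_sum: "\<eta> \<in> forms1 D \<Longrightarrow> (\<Sum>b\<in>bas. dual b x * \<eta> b) = \<eta> x"
proof -
  have "\<exists>p. case p of (B, \<omega>) \<Rightarrow> finite B \<and> (\<forall>b. \<omega> b \<in> forms1 D) \<and>
     (\<forall>\<eta>\<in>forms1 D. \<forall>x. (\<Sum>b\<in>B. \<omega> b x * \<eta> b) = \<eta> x)"
    by (rule dual_basis) (rule exI, rule case_prodI, intro conjI allI ballI)
  from someI_ex[OF this, folded dual_pair_def]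
  show "finite bas" "dual b \<in> forms1 D" "\<eta> \<in> forms1 D \<Longrightarrow> (\<Sum>b\<in>bas. dual b x * \<eta> b) = \<eta> x"
    unfolding bas_def dual_def by (auto split: prod.splits)
qed

lemma d0_apply: "d0 D a x = der D x a"
  by (simp add: d0_def)

lemma der_form [simp]: "(\<lambda>x. der D x a) \<in> forms1 D"
  using forms1_closed(5)[of a] by (simp add: d0_def)

lemma d1_forms11: 
  assumes w: "w \<in> forms1 D"
  shows "(\<lambda>x y. a * d1 D w x y) \<in> forms11 D"
  unfolding forms11_def forms1_def d1_def
  using w by (auto simp: forms1_simps der_simps lie_simps lie_scl_left algebra_simps)

text \<open>Since \<open>d w\<close> is alternating, the antisymmetrization of
  \<open>- (1/2) d w\<close> is \<open>- d w\<close>, as membership in \<open>P2\<close> demands.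
  Division by 2 thus gives an explicit element of \<open>P2\<close> over every one-form.\<close>

lemma half_closed_form:
  assumes w: "w \<in> forms1 D"
  shows "(0, w, w, \<lambda>x y. (- 1 / 2) * d1 D w x y) \<in> carrier (jet2 D)"
proof -
  have "(- 1 / 2) * d1 D w x y - (- 1 / 2) * d1 D w y x = - d1 D w x y" for x y
  proof -
    have "w (lie D y x) = - w (lie D x y)" using lie_swap[of y x] w by (simp add: forms1_simps)
    then have "d1 D w y x = - d1 D w x y" by (simp add: d1_def)
    then show ?thesis by (simp add: field_simps)
  qed
  then show ?thesis using w d1_forms11[OF w, of "- 1 / 2"] by (simp add: jet2_def)
qed

text \<open>Elements of the symmetric square of the one-forms, as a part of \<open>P2\<close>: when
  the one-form component is zero, the condition on the bilinear component is symmetry.\<close>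

lemma symmetric_form:
  assumes w: "v \<in> forms1 D" "w \<in> forms1 D"
  shows "(0, \<lambda>x. 0, \<lambda>x. 0, \<lambda>x y. (1 / 2) * (v x * w y + w x * v y)) \<in> carrier (jet2 D)"
proof -
  have "(\<lambda>x y. (1 / 2) * (v x * w y + w x * v y)) \<in> forms11 D"
    unfolding forms11_def using w by (auto simp: forms1_def algebra_simps add_divide_distrib)
  then show ?thesis by (simp add: jet2_def d1_def algebra_simps)
qed

text \<open>The terms are \<open>c \<otimes> 1\<close>, \<open>w \<otimes> 1\<close>,
  \<open>1 \<otimes> w'\<close> and \<open>dual b \<otimes> \<tau> b\<close>, the last ones from
  expanding \<open>\<tau>\<close> in its first argument. This is the witness for the choice made in
  \<open>act11\<close>.\<close>

lemma jet11_decomposition: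
  assumes "t \<in> carrier (jet11 D)"
  shows "\<exists>ps. set ps \<subseteq> carrier (jet1 D) \<times> carrier (jet1 D) \<and>
     t = foldr (\<lambda>(p, q) z. jet_tensor D p q \<oplus>\<^bsub>jet11 D\<^esub> z) ps \<zero>\<^bsub>jet11 D\<^esub>"
proof -
  obtain c w w' \<tau> where t: "t = (c, w, w', \<tau>)" by (cases t)
  have w [simp]: "w \<in> forms1 D" "w' \<in> forms1 D" and \<tau>: "\<tau> \<in> forms11 D"
    using assms by (auto simp: t jet11_def)
  have \<tau>': "\<tau> b \<in> forms1 D" "(\<lambda>x. \<tau> x y) \<in> forms1 D" for b y using \<tau> by (auto simp: forms11_def)
  obtain xs where xs: "set xs = bas" "distinct xs" using finite_distinct_list[OF bas_finite] by blast
  let ?f = "\<lambda>(p, q) z. jet_tensor D p q \<oplus>\<^bsub>jet11 D\<^esub> z"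
  let ?L = "map (\<lambda>b. ((0, dual b), (0, \<tau> b))) xs"
  let ?ps = "((c, \<lambda>x. 0), (1, \<lambda>x. 0)) # ((0, w), (1, \<lambda>x. 0)) # ((1, \<lambda>x. 0), (0, w')) # ?L"
  have "foldr ?f (map (\<lambda>b. ((0, dual b), (0, \<tau> b))) ys) \<zero>\<^bsub>jet11 D\<^esub> =
    (0, \<lambda>x. 0, \<lambda>x. 0, \<lambda>x y. \<Sum>b\<leftarrow>ys. dual b x * \<tau> b y)" for ys
    by (induction ys) (auto simp: jet11_def jet_tensor_def d0_def)
  also have "(\<lambda>x y. \<Sum>b\<leftarrow>xs. dual b x * \<tau> b y) = \<tau>"
  proof (intro ext)
    fix x y
    have "(\<Sum>b\<leftarrow>xs. dual b x * \<tau> b y) = (\<Sum>b\<in>bas. dual b x * \<tau> b y)"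
      using xs by (simp add: sum_list_distinct_conv_sum_set)
    also have "\<dots> = \<tau> x y" using dual_sum[OF \<tau>'(2)[of y], of x] .
    finally show "(\<Sum>b\<leftarrow>xs. dual b x * \<tau> b y) = \<tau> x y" .
  qed
  finally have L: "foldr ?f ?L \<zero>\<^bsub>jet11 D\<^esub> = (0, \<lambda>x. 0, \<lambda>x. 0, \<tau>)" .
  have "t = foldr ?f ?ps \<zero>\<^bsub>jet11 D\<^esub>"
    unfolding foldr.simps o_def L[simplified] by (simp add: L t) (simp add: jet11_def jet_tensor_def d0_def)
  moreover have "set ?ps \<subseteq> carrier (jet1 D) \<times> carrier (jet1 D)"
    using \<tau>' by (auto simp: jet1_def)
  ultimately show ?thesis by blast
qed

end

section \<open>Calculus of morphisms in a linear category\<close>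

locale lin_category =
  fixes C :: "('o, 'a, 'k::field) lcat" (structure)
  assumes lin: "linear_category C"
begin

lemma homs_iff: "f \<in> homs C X Y \<longleftrightarrow> f \<in> arr C \<and> src C f = X \<and> tgt C f = Y"
  by (simp add: homs_def)

lemma arr_homs: "f \<in> arr C \<Longrightarrow> f \<in> homs C (src C f) (tgt C f)"
  by (simp add: homs_def)

lemma src_tgt_obj [simp]: "f \<in> arr C \<Longrightarrow> src C f \<in> obj C" "f \<in> arr C \<Longrightarrow> tgt C f \<in> obj C"
  using lin by (simp_all add: linear_category_def)

lemma idt_typ [simp]: "X \<in> obj C \<Longrightarrow> idt C X \<in> arr C" "X \<in> obj C \<Longrightarrow> src C (idt C X) = X"
  "X \<in> obj C \<Longrightarrow> tgt C (idt C X) = X"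
  using lin by (simp_all add: linear_category_def homs_def)

lemma cmp_typ [simp]:
  assumes "f \<in> arr C" "g \<in> arr C" "tgt C f = src C g"
  shows "g \<cdot> f \<in> arr C" "src C (g \<cdot> f) = src C f" "tgt C (g \<cdot> f) = tgt C g"
  using lin assms by (simp_all add: linear_category_def homs_def)

lemma cmp_idt [simp]: "f \<in> arr C \<Longrightarrow> src C f = X \<Longrightarrow> f \<cdot> idt C X = f"
  "f \<in> arr C \<Longrightarrow> tgt C f = X \<Longrightarrow> idt C X \<cdot> f = f"
  using lin by (auto simp: linear_category_def)

lemma cmp_assoc [simp]: "f \<in> arr C \<Longrightarrow> g \<in> arr C \<Longrightarrow> h \<in> arr C \<Longrightarrow> tgt C f = src C g \<Longrightarrow>
  tgt C g = src C h \<Longrightarrow> (h \<cdot> g) \<cdot> f = h \<cdot> (g \<cdot> f)"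
  using lin by (simp add: linear_category_def)

lemma hspace_module: "X \<in> obj C \<Longrightarrow> Y \<in> obj C \<Longrightarrow> module fld (hspace C X Y)"
  using lin by (simp add: linear_category_def)

lemma hspace_simps [simp]: "carrier (hspace C X Y) = homs C X Y" "zero (hspace C X Y) = hzero C X Y"
  "add (hspace C X Y) = hadd C" "smult (hspace C X Y) = hscal C"
  by (simp_all add: hspace_def)

lemma hadd_typ [simp]:
  assumes "f \<in> arr C" "g \<in> arr C" "src C f = src C g" "tgt C f = tgt C g"
  shows "hadd C f g \<in> arr C" "src C (hadd C f g) = src C g" "tgt C (hadd C f g) = tgt C g"
proof -
  interpret H: module fld "hspace C (src C g) (tgt C g)" by (rule hspace_module) (use assms in auto)
  show "hadd C f g \<in> arr C" "src C (hadd C f g) = src C g" "tgt C (hadd C f g) = tgt C g"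
    using H.add.m_closed[of f g] assms by (simp_all add: homs_iff)
qed

lemma hscal_typ [simp]:
  assumes "f \<in> arr C"
  shows "hscal C a f \<in> arr C" "src C (hscal C a f) = src C f" "tgt C (hscal C a f) = tgt C f"
proof -
  interpret H: module fld "hspace C (src C f) (tgt C f)" by (rule hspace_module) (use assms in auto)
  show "hscal C a f \<in> arr C" "src C (hscal C a f) = src C f" "tgt C (hscal C a f) = tgt C f"
    using H.smult_closed[of a f] assms by (simp_all add: homs_iff)
qed

lemma hzero_typ [simp]:
  assumes "X \<in> obj C" "Y \<in> obj C"
  shows "hzero C X Y \<in> arr C" "src C (hzero C X Y) = X" "tgt C (hzero C X Y) = Y"
proof -
  interpret H: module fld "hspace C X Y" by (rule hspace_module) (use assms in auto)
  show "hzero C X Y \<in> arr C" "src C (hzero C X Y) = X" "tgt C (hzero C X Y) = Y"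
    using H.zero_closed assms by (simp_all add: homs_iff)
qed

lemma cmp_hadd [simp]:
  "f \<in> arr C \<Longrightarrow> g \<in> arr C \<Longrightarrow> h \<in> arr C \<Longrightarrow> src C f = src C g \<Longrightarrow> tgt C f = tgt C g \<Longrightarrow>
     tgt C h = src C g \<Longrightarrow> hadd C f g \<cdot> h = hadd C (f \<cdot> h) (g \<cdot> h)"
  "f \<in> arr C \<Longrightarrow> g \<in> arr C \<Longrightarrow> h \<in> arr C \<Longrightarrow> src C f = src C g \<Longrightarrow> tgt C f = tgt C g \<Longrightarrow>
     tgt C g = src C h \<Longrightarrow> h \<cdot> hadd C f g = hadd C (h \<cdot> f) (h \<cdot> g)"
proof -
  assume a: "f \<in> arr C" "g \<in> arr C" "h \<in> arr C" "src C f = src C g" "tgt C f = tgt C g"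
  { assume "tgt C h = src C g"
    then have "lin_map (hspace C (src C g) (tgt C g)) (hspace C (src C h) (tgt C g)) (\<lambda>g. g \<cdot> h)"
      using lin a src_tgt_obj unfolding linear_category_def by (metis arr_homs)
    then show "hadd C f g \<cdot> h = hadd C (f \<cdot> h) (g \<cdot> h)"
      using a by (simp add: semilin_map_def homs_iff) }
  { assume "tgt C g = src C h"
    then have "lin_map (hspace C (src C g) (tgt C g)) (hspace C (src C g) (tgt C h)) (\<lambda>g. h \<cdot> g)"
      using lin a src_tgt_obj unfolding linear_category_def by (metis arr_homs)
    then show "h \<cdot> hadd C f g = hadd C (h \<cdot> f) (h \<cdot> g)"
      using a by (simp add: semilin_map_def homs_iff) }
qed

lemma cmp_hscal [simp]:
  "f \<in> arr C \<Longrightarrow> h \<in> arr C \<Longrightarrow> tgt C h = src C f \<Longrightarrow> hscal C a f \<cdot> h = hscal C a (f \<cdot> h)"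
  "f \<in> arr C \<Longrightarrow> h \<in> arr C \<Longrightarrow> tgt C f = src C h \<Longrightarrow> h \<cdot> hscal C a f = hscal C a (h \<cdot> f)"
proof -
  assume a: "f \<in> arr C" "h \<in> arr C"
  { assume "tgt C h = src C f"
    then have "lin_map (hspace C (src C f) (tgt C f)) (hspace C (src C h) (tgt C f)) (\<lambda>g. g \<cdot> h)"
      using lin a src_tgt_obj unfolding linear_category_def by (metis arr_homs)
    then show "hscal C a f \<cdot> h = hscal C a (f \<cdot> h)"
      using a by (simp add: semilin_map_def homs_iff) }
  { assume "tgt C f = src C h"
    then have "lin_map (hspace C (src C f) (tgt C f)) (hspace C (src C f) (tgt C h)) (\<lambda>g. h \<cdot> g)"
      using lin a src_tgt_obj unfolding linear_category_def by (metis arr_homs)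
    then show "h \<cdot> hscal C a f = hscal C a (h \<cdot> f)"
      using a by (simp add: semilin_map_def homs_iff) }
qed

text \<open>
  Linear identities between morphisms are reduced to identities in the base field: morphisms with
  the same image under all linear forms on a space of morphisms are equal.
\<close>

definition hform :: "'o \<Rightarrow> 'o \<Rightarrow> ('a \<Rightarrow> 'k) \<Rightarrow> bool" where
  "hform X Y p \<longleftrightarrow> X \<in> obj C \<and> Y \<in> obj C \<and> linear_form (hspace C X Y) p"

lemma hform_hadd:
  "hform X Y p \<Longrightarrow> f \<in> arr C \<Longrightarrow> g \<in> arr C \<Longrightarrow> src C f = X \<Longrightarrow> tgt C f = Y \<Longrightarrow> src C g = X \<Longrightarrow> tgt C g = Y \<Longrightarrow>
   p (hadd C f g) = p f + p g"
  by (simp add: hform_def linear_form_def homs_iff)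

lemma hform_hscal:
  "hform X Y p \<Longrightarrow> f \<in> arr C \<Longrightarrow> src C f = X \<Longrightarrow> tgt C f = Y \<Longrightarrow> p (hscal C a f) = a * p f"
  by (simp add: hform_def linear_form_def homs_iff)

lemma hom_eqI:
  assumes "f \<in> arr C" "g \<in> arr C" "src C f = X" "tgt C f = Y" "src C g = X" "tgt C g = Y"
    and "\<And>p. hform X Y p \<Longrightarrow> p f = p g"
  shows "f = g"
proof (rule ccontr)
  have o: "X \<in> obj C" "Y \<in> obj C" using assms(1,3,4) by auto
  assume "f \<noteq> g"
  with module_separation[OF hspace_module[OF o], of f g] assms o show False
    by (auto simp: homs_iff hform_def)
qed

lemma hform_hzero [simp]: "hform X Y p \<Longrightarrow> p (hzero C X Y) = 0"
proof -
  assume p: "hform X Y p"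
  then have o: "X \<in> obj C" "Y \<in> obj C" by (auto simp: hform_def)
  interpret H: module fld "hspace C X Y" by (rule hspace_module[OF o])
  have "p (hadd C (hzero C X Y) (hzero C X Y)) = p (hzero C X Y) + p (hzero C X Y)"
    using o by (intro hform_hadd[OF p]) auto
  moreover have "hadd C (hzero C X Y) (hzero C X Y) = hzero C X Y"
    using H.add.l_one[of "hzero C X Y"] o by (simp add: homs_iff)
  ultimately have "p (hzero C X Y) + p (hzero C X Y) = p (hzero C X Y) + 0" by simp
  then show ?thesis by (rule add_left_imp_eq)
qed

lemmas hform_simps = hform_hadd hform_hscal hform_hzero

lemma hform_cmp_left:
  "hform X Z p \<Longrightarrow> u \<in> arr C \<Longrightarrow> src C u = Y \<Longrightarrow> tgt C u = Z \<Longrightarrow> hform X Y (\<lambda>f. p (u \<cdot> f))"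
  by (auto simp: hform_def linear_form_def homs_iff)

lemma hform_cmp_right:
  "hform X Z p \<Longrightarrow> u \<in> arr C \<Longrightarrow> src C u = X \<Longrightarrow> tgt C u = Y \<Longrightarrow> hform Y Z (\<lambda>f. p (f \<cdot> u))"
  by (auto simp: hform_def linear_form_def homs_iff)

lemma hscal_hscal [simp]: "f \<in> arr C \<Longrightarrow> hscal C a (hscal C b f) = hscal C (a * b) f"
  by (rule hom_eqI) (auto simp: hform_simps)

lemma hscal_one [simp]: "f \<in> arr C \<Longrightarrow> hscal C 1 f = f"
  by (rule hom_eqI[where X = "src C f" and Y = "tgt C f"]) (auto simp: hform_simps)

lemma hscal_hzero [simp]: "X \<in> obj C \<Longrightarrow> Y \<in> obj C \<Longrightarrow> hscal C a (hzero C X Y) = hzero C X Y"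
  by (rule hom_eqI[where X = X and Y = Y]) (auto simp: hform_simps)

lemma hscal_zero: "f \<in> arr C \<Longrightarrow> hscal C 0 f = hzero C (src C f) (tgt C f)"
  by (rule hom_eqI[where X = "src C f" and Y = "tgt C f"]) (auto simp: hform_simps)

lemma cmp_hzero [simp]:
  "f \<in> arr C \<Longrightarrow> src C f = Y \<Longrightarrow> X \<in> obj C \<Longrightarrow> f \<cdot> hzero C X Y = hzero C X (tgt C f)"
  "f \<in> arr C \<Longrightarrow> tgt C f = X \<Longrightarrow> Y \<in> obj C \<Longrightarrow> hzero C X Y \<cdot> f = hzero C (src C f) Y"
proof -
  assume f: "f \<in> arr C" "src C f = Y" and X: "X \<in> obj C"
  show "f \<cdot> hzero C X Y = hzero C X (tgt C f)"
    by (rule hom_eqI[where X = X and Y = "tgt C f"])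
      (use f X in \<open>auto simp: hform_simps dest: hform_hzero[OF hform_cmp_left[of X "tgt C f" _ f Y]]\<close>)
next
  assume f: "f \<in> arr C" "tgt C f = X" and Y: "Y \<in> obj C"
  show "hzero C X Y \<cdot> f = hzero C (src C f) Y"
    by (rule hom_eqI[where X = "src C f" and Y = Y])
      (use f Y in \<open>auto simp: hform_simps dest: hform_hzero[OF hform_cmp_right[of "src C f" Y _ f X]]\<close>)
qed

lemma hadd_hzero [simp]:
  "f \<in> arr C \<Longrightarrow> src C f = X \<Longrightarrow> tgt C f = Y \<Longrightarrow> hadd C f (hzero C X Y) = f"
  "f \<in> arr C \<Longrightarrow> src C f = X \<Longrightarrow> tgt C f = Y \<Longrightarrow> hadd C (hzero C X Y) f = f"
  by (rule hom_eqI[where X = X and Y = Y]; auto simp: hform_simps)+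

definition hsub :: "'a \<Rightarrow> 'a \<Rightarrow> 'a" where
  "hsub f g = hadd C f (hscal C (- 1) g)"

lemma hsub_typ [simp]:
  assumes "f \<in> arr C" "g \<in> arr C" "src C f = src C g" "tgt C f = tgt C g"
  shows "hsub f g \<in> arr C" "src C (hsub f g) = src C g" "tgt C (hsub f g) = tgt C g"
  using assms by (simp_all add: hsub_def)

lemma cmp_hsub [simp]:
  "f \<in> arr C \<Longrightarrow> g \<in> arr C \<Longrightarrow> h \<in> arr C \<Longrightarrow> src C f = src C g \<Longrightarrow> tgt C f = tgt C g \<Longrightarrow>
     tgt C h = src C g \<Longrightarrow> hsub f g \<cdot> h = hsub (f \<cdot> h) (g \<cdot> h)"
  "f \<in> arr C \<Longrightarrow> g \<in> arr C \<Longrightarrow> h \<in> arr C \<Longrightarrow> src C f = src C g \<Longrightarrow> tgt C f = tgt C g \<Longrightarrow>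
     tgt C g = src C h \<Longrightarrow> h \<cdot> hsub f g = hsub (h \<cdot> f) (h \<cdot> g)"
  by (simp_all add: hsub_def)

lemma hform_hsub:
  "hform X Y p \<Longrightarrow> f \<in> arr C \<Longrightarrow> g \<in> arr C \<Longrightarrow> src C f = X \<Longrightarrow> tgt C f = Y \<Longrightarrow> src C g = X \<Longrightarrow> tgt C g = Y \<Longrightarrow>
   p (hsub f g) = p f - p g"
  by (simp add: hsub_def hform_simps)

lemma hsub_eq_zeroD:
  assumes "hsub f g = hzero C X Y" "f \<in> arr C" "g \<in> arr C" "src C f = X" "tgt C f = Y" "src C g = X" "tgt C g = Y"
  shows "f = g"
proof (rule hom_eqI[OF assms(2-)])
  fix p assume p: "hform X Y p"
  then have "p (hsub f g) = 0" by (simp add: assms(1))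
  moreover have "p (hsub f g) = p f - p g" by (rule hform_hsub[OF p assms(2-)])
  ultimately show "p f = p g" by simp
qed

definition hsum :: "'o \<Rightarrow> 'o \<Rightarrow> ('b \<Rightarrow> 'a) \<Rightarrow> 'b set \<Rightarrow> 'a" where
  "hsum X Y g B = finsum (hspace C X Y) g B"

lemma hsum_typ [simp]:
  assumes "X \<in> obj C" "Y \<in> obj C" "\<And>b. b \<in> B \<Longrightarrow> g b \<in> arr C" "\<And>b. b \<in> B \<Longrightarrow> src C (g b) = X"
    "\<And>b. b \<in> B \<Longrightarrow> tgt C (g b) = Y"
  shows "hsum X Y g B \<in> arr C" "src C (hsum X Y g B) = X" "tgt C (hsum X Y g B) = Y"
proof -
  interpret H: module fld "hspace C X Y" by (rule hspace_module) (use assms in auto)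
  have "hsum X Y g B \<in> homs C X Y"
    using H.finsum_closed[of g B] assms(3-) by (simp add: hsum_def homs_iff)
  then show "hsum X Y g B \<in> arr C" "src C (hsum X Y g B) = X" "tgt C (hsum X Y g B) = Y"
    by (simp_all add: homs_iff)
qed

lemma hform_hsum:
  assumes "hform X Y p" "finite B" "\<And>b. b \<in> B \<Longrightarrow> g b \<in> arr C" "\<And>b. b \<in> B \<Longrightarrow> src C (g b) = X"
    "\<And>b. b \<in> B \<Longrightarrow> tgt C (g b) = Y"
  shows "p (hsum X Y g B) = (\<Sum>b\<in>B. p (g b))"
  unfolding hsum_def
  by (rule linear_form_finsum) (use assms hspace_module in \<open>auto simp: hform_def homs_iff\<close>)

lemma cmp_hsum_right:
  assumes "u \<in> arr C" "src C u = Y" "finite B" "X \<in> obj C" "\<And>b. b \<in> B \<Longrightarrow> g b \<in> arr C" "\<And>b. b \<in> B \<Longrightarrow> src C (g b) = X"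
    "\<And>b. b \<in> B \<Longrightarrow> tgt C (g b) = Y"
  shows "u \<cdot> hsum X Y g B = hsum X (tgt C u) (\<lambda>b. u \<cdot> g b) B"
proof (rule hom_eqI[where X = X and Y = "tgt C u"])
  fix p assume p: "hform X (tgt C u) p"
  show "p (u \<cdot> hsum X Y g B) = p (hsum X (tgt C u) (\<lambda>b. u \<cdot> g b) B)"
    using hform_hsum[OF hform_cmp_left[OF p assms(1,2)], of B g] assms
    by (simp add: hform_hsum[OF p])
qed (use assms in auto)

lemma cmp_hsum_left:
  assumes "u \<in> arr C" "tgt C u = X" "finite B" "Y \<in> obj C" "\<And>b. b \<in> B \<Longrightarrow> g b \<in> arr C" "\<And>b. b \<in> B \<Longrightarrow> src C (g b) = X"
    "\<And>b. b \<in> B \<Longrightarrow> tgt C (g b) = Y"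
  shows "hsum X Y g B \<cdot> u = hsum (src C u) Y (\<lambda>b. g b \<cdot> u) B"
proof (rule hom_eqI[where X = "src C u" and Y = Y])
  fix p assume p: "hform (src C u) Y p"
  show "p (hsum X Y g B \<cdot> u) = p (hsum (src C u) Y (\<lambda>b. g b \<cdot> u) B)"
    using hform_hsum[OF hform_cmp_right[OF p assms(1) refl assms(2)], of B g] assms
    by (simp add: hform_hsum[OF p])
qed (use assms in auto)

lemma hsum_cong:
  assumes "X \<in> obj C" "Y \<in> obj C" "finite B" "\<And>b. b \<in> B \<Longrightarrow> g b = h b" "\<And>b. b \<in> B \<Longrightarrow> h b \<in> arr C"
    "\<And>b. b \<in> B \<Longrightarrow> src C (h b) = X" "\<And>b. b \<in> B \<Longrightarrow> tgt C (h b) = Y"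
  shows "hsum X Y g B = hsum X Y h B"
  by (rule hom_eqI[where X = X and Y = Y]) (use assms in \<open>auto simp: hform_hsum intro!: sum.cong\<close>)

text \<open>Composites are normalised to the right by \<open>cmp_assoc\<close>, so an equation for
  \<open>g \<cdot> f\<close> no longer matches once something precedes \<open>f\<close>; this is its
  form for that situation.\<close>

lemma reassoc:
  "g \<cdot> f = k \<Longrightarrow> f \<in> arr C \<Longrightarrow> g \<in> arr C \<Longrightarrow> tgt C f = src C g \<Longrightarrow> x \<in> arr C \<Longrightarrow> tgt C x = src C f \<Longrightarrow>
     g \<cdot> (f \<cdot> x) = k \<cdot> x"
  by (metis cmp_assoc)

lemma hsub_self [simp]: "f \<in> arr C \<Longrightarrow> hsub f f = hzero C (src C f) (tgt C f)"
  by (rule hom_eqI[where X = "src C f" and Y = "tgt C f"]) (auto simp: hform_hsub)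

lemma hsub_hzero [simp]: "f \<in> arr C \<Longrightarrow> src C f = X \<Longrightarrow> tgt C f = Y \<Longrightarrow> hsub f (hzero C X Y) = f"
  by (rule hom_eqI[where X = "src C f" and Y = "tgt C f"]) (auto simp: hform_hsub)

lemma homs_simps:
  "f \<in> homs C X Y \<Longrightarrow> g \<in> homs C X Y \<Longrightarrow> hadd C f g \<in> homs C X Y"
  "f \<in> homs C X Y \<Longrightarrow> g \<in> homs C X Y \<Longrightarrow> hsub f g \<in> homs C X Y"
  "f \<in> homs C X Y \<Longrightarrow> hscal C a f \<in> homs C X Y"
  "f \<in> arr C \<Longrightarrow> g \<in> arr C \<Longrightarrow> tgt C f = src C g \<Longrightarrow> src C f = X \<Longrightarrow> tgt C g = Y \<Longrightarrow> g \<cdot> f \<in> homs C X Y"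
  by (auto simp: homs_iff)

text \<open>
  With typing conditions in terms of \<^const>\<open>homs\<close> rather than \<^const>\<open>src\<close> and \<^const>\<open>tgt\<close>,
  the time needed for rewriting is not exponential in the nesting depth.
\<close>

lemma hform_homs:
  "hform X Y p \<Longrightarrow> f \<in> homs C X Y \<Longrightarrow> g \<in> homs C X Y \<Longrightarrow> p (hadd C f g) = p f + p g"
  "hform X Y p \<Longrightarrow> f \<in> homs C X Y \<Longrightarrow> g \<in> homs C X Y \<Longrightarrow> p (hsub f g) = p f - p g"
  "hform X Y p \<Longrightarrow> f \<in> homs C X Y \<Longrightarrow> p (hscal C a f) = a * p f"
  by (auto simp: homs_iff hform_simps hform_hsub)

lemma hom_eqI':
  assumes "f \<in> homs C X Y" "g \<in> homs C X Y" and "\<And>p. hform X Y p \<Longrightarrow> p f = p g"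
  shows "f = g"
  using assms by (intro hom_eqI[of f g X Y]) (auto simp: homs_iff)

end

section \<open>Connections\<close>

locale d_category = diff_field D + lin_category C
  for D :: "('k::field_char_0, 'd::ab_group_add) dfield" and C :: "('o, 'a, 'k) lcat" (structure) +
  fixes T :: "('o, 'a) tensor_data" and A :: "('k, 'd, 'o, 'a) at_data"
  assumes DC: "D_category D C T A"
begin

abbreviation "AO \<equiv> aob (at1 A)"
abbreviation "AF \<equiv> aar (at1 A)"
abbreviation "AO2 \<equiv> aob (at2 A)"
abbreviation "AF2 \<equiv> aar (at2 A)"
abbreviation "pr \<equiv> prj A"
abbreviation "em \<equiv> emb A"
abbreviation "om X \<omega> \<equiv> aact (at1 A) X (0, \<omega>)"

lemma at1: "atiyah_functor C T (jet1 D) lam1 (rho1 D) (at1 A)"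
  and at2: "atiyah_functor C T (jet2 D) (lam2 D) (rho2 D) (at2 A)"
  using DC by (simp_all add: D_category_def)

lemma AO_obj [simp]: "X \<in> obj C \<Longrightarrow> AO X \<in> obj C" "X \<in> obj C \<Longrightarrow> AO2 X \<in> obj C"
  using at1 at2 by (auto simp: atiyah_functor_def exact_functor_def is_functor_def)

lemma AF_typ [simp]: "f \<in> arr C \<Longrightarrow> AF f \<in> arr C" "f \<in> arr C \<Longrightarrow> src C (AF f) = AO (src C f)"
   "f \<in> arr C \<Longrightarrow> tgt C (AF f) = AO (tgt C f)"
  using at1 by (auto simp: atiyah_functor_def exact_functor_def is_functor_def homs_iff)

lemma AF2_typ [simp]: "f \<in> arr C \<Longrightarrow> AF2 f \<in> arr C" "f \<in> arr C \<Longrightarrow> src C (AF2 f) = AO2 (src C f)"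
   "f \<in> arr C \<Longrightarrow> tgt C (AF2 f) = AO2 (tgt C f)"
  using at2 by (auto simp: atiyah_functor_def exact_functor_def is_functor_def homs_iff)

lemma AF_idt [simp]: "X \<in> obj C \<Longrightarrow> AF (idt C X) = idt C (AO X)"
  using at1 by (auto simp: atiyah_functor_def exact_functor_def is_functor_def)

lemma AF_cmp [simp]: "f \<in> arr C \<Longrightarrow> g \<in> arr C \<Longrightarrow> tgt C f = src C g \<Longrightarrow> AF (g \<cdot> f) = AF g \<cdot> AF f"
  using at1 by (auto simp: atiyah_functor_def exact_functor_def is_functor_def)

lemma AF_hadd [simp]: "f \<in> arr C \<Longrightarrow> g \<in> arr C \<Longrightarrow> src C f = src C g \<Longrightarrow> tgt C f = tgt C g \<Longrightarrow>
   AF (hadd C f g) = hadd C (AF f) (AF g)"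
proof -
  assume a: "f \<in> arr C" "g \<in> arr C" "src C f = src C g" "tgt C f = tgt C g"
  have "\<forall>X\<in>obj C. \<forall>Y\<in>obj C. \<forall>f\<in>homs C X Y. \<forall>g\<in>homs C X Y. AF (hadd C f g) = hadd C (AF f) (AF g)"
    using at1 by (simp add: atiyah_functor_def)
  then show ?thesis using a by (metis arr_homs src_tgt_obj)
qed

lemma act_module: "X \<in> obj C \<Longrightarrow> module_in C (jet1 D) (rho1 D) (AO X) (aact (at1 A) X)"
  using at1 by (auto simp: atiyah_functor_def)

lemma jet1_simps: "p \<in> carrier (jet1 D) \<longleftrightarrow> snd p \<in> forms1 D"
  "(a, \<alpha>) \<oplus>\<^bsub>jet1 D\<^esub> (b, \<beta>) = (a + b, \<lambda>x. \<alpha> x + \<beta> x)"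
  "(a, \<alpha>) \<otimes>\<^bsub>jet1 D\<^esub> (b, \<beta>) = (a * b, \<lambda>x. a * \<beta> x + b * \<alpha> x)"
  by (cases p) (auto simp: jet1_def)

lemma act_typ [simp]: "X \<in> obj C \<Longrightarrow> snd p \<in> forms1 D \<Longrightarrow> aact (at1 A) X p \<in> arr C"
   "X \<in> obj C \<Longrightarrow> snd p \<in> forms1 D \<Longrightarrow> src C (aact (at1 A) X p) = AO X"
   "X \<in> obj C \<Longrightarrow> snd p \<in> forms1 D \<Longrightarrow> tgt C (aact (at1 A) X p) = AO X"
  using act_module[of X] unfolding module_in_def by (auto simp: homs_iff jet1_simps)

lemma act_add: "X \<in> obj C \<Longrightarrow> \<alpha> \<in> forms1 D \<Longrightarrow> \<beta> \<in> forms1 D \<Longrightarrow>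
   aact (at1 A) X (a + b, \<lambda>x. \<alpha> x + \<beta> x) = hadd C (aact (at1 A) X (a, \<alpha>)) (aact (at1 A) X (b, \<beta>))"
  using act_module[of X] unfolding module_in_def by (auto simp: jet1_simps simp flip: jet1_simps(2))

lemma act_mult: "X \<in> obj C \<Longrightarrow> \<alpha> \<in> forms1 D \<Longrightarrow> \<beta> \<in> forms1 D \<Longrightarrow>
   aact (at1 A) X (a, \<alpha>) \<cdot> aact (at1 A) X (b, \<beta>) = aact (at1 A) X (a * b, \<lambda>x. a * \<beta> x + b * \<alpha> x)"
  using act_module[of X] unfolding module_in_def by (auto simp: jet1_simps simp flip: jet1_simps(3))

lemma act_rho: "X \<in> obj C \<Longrightarrow> aact (at1 A) X (a, d0 D a) = hscal C a (idt C (AO X))"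
  using act_module[of X] unfolding module_in_def rho1_def by auto

text \<open>Multiply by \<open>\<rho>(a)\<close>, which acts as the scalar \<open>a\<close>; its
  one-form part \<open>d a\<close> contributes nothing, as products of one-forms vanish in
  \<open>P1\<close>.\<close>

lemma om_scal: "X \<in> obj C \<Longrightarrow> \<alpha> \<in> forms1 D \<Longrightarrow> om X (\<lambda>x. a * \<alpha> x) = hscal C a (om X \<alpha>)"
  using act_mult[of X "d0 D a" \<alpha> a 0] by (simp add: act_rho)

lemma act_eq: 
  assumes "X \<in> obj C" "\<alpha> \<in> forms1 D"
  shows "aact (at1 A) X (a, \<alpha>) = hadd C (hscal C a (idt C (AO X))) (om X (\<lambda>x. \<alpha> x - d0 D a x))"
  using act_add[of X "d0 D a" "\<lambda>x. \<alpha> x - d0 D a x" a 0] assms by (simp add: act_rho)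

lemma om_zero: "X \<in> obj C \<Longrightarrow> om X (\<lambda>x. 0) = hzero C (AO X) (AO X)"
  using om_scal[of X "\<lambda>x. 0" 0] by (simp add: hscal_zero)

lemma AF_act: "f \<in> arr C \<Longrightarrow> src C f = X \<Longrightarrow> snd p \<in> forms1 D \<Longrightarrow>
   AF f \<cdot> aact (at1 A) X p = aact (at1 A) (tgt C f) p \<cdot> AF f"
  using at1 by (auto simp: atiyah_functor_def jet1_simps)

text \<open>A scalar \<open>a\<close> comes out of \<open>At1\<close> as
  \<open>\<lambda>(a)\<close>, which is \<open>\<rho>(a) - d a\<close> in \<open>P1\<close>, and
  only \<open>\<rho>(a)\<close> acts as the scalar \<open>a\<close>. All derivatives in the later
  computations originate in this correction.\<close>

lemma AF_hscal: 
  assumes "f \<in> arr C"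
  shows "AF (hscal C a f) = hsub (hscal C a (AF f)) (om (tgt C f) (d0 D a) \<cdot> AF f)"
proof -
  have 1: "AF (hscal C a f) = aact (at1 A) (tgt C f) (a, \<lambda>x. 0) \<cdot> AF f"
    using at1 assms by (simp add: atiyah_functor_def lam1_def)
  have "om (tgt C f) (\<lambda>x. 0 - d0 D a x) = om (tgt C f) (\<lambda>x. (- 1) * d0 D a x)" by simp
  also have "\<dots> = hscal C (- 1) (om (tgt C f) (d0 D a))" using assms by (intro om_scal) auto
  finally show ?thesis using assms unfolding 1 hsub_def
    by (subst act_eq) auto
qed

lemma pr_base_change: "X \<in> obj C \<Longrightarrow> base_change C (carrier (jet1 D)) (AO X) (aact (at1 A) X) fst
        fld id X (\<lambda>a. hscal C a (idt C X)) (pr X)"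
  using DC by (simp add: D_category_def)

lemma pr_typ [simp]: "X \<in> obj C \<Longrightarrow> pr X \<in> arr C" "X \<in> obj C \<Longrightarrow> src C (pr X) = AO X"
   "X \<in> obj C \<Longrightarrow> tgt C (pr X) = X"
  using pr_base_change[of X] by (auto simp: base_change_def homs_iff)

lemma pr_act [simp]: "X \<in> obj C \<Longrightarrow> snd p \<in> forms1 D \<Longrightarrow> pr X \<cdot> aact (at1 A) X p = hscal C (fst p) (pr X)"
  using pr_base_change[of X] by (auto simp: base_change_def jet1_simps)

lemma pr_om [simp]: "X \<in> obj C \<Longrightarrow> \<omega> \<in> forms1 D \<Longrightarrow> pr X \<cdot> om X \<omega> = hzero C (AO X) X"
  by (simp add: hscal_zero)

lemma pr_AF [simp]: "f \<in> arr C \<Longrightarrow> tgt C f = Y \<Longrightarrow> pr Y \<cdot> AF f = f \<cdot> pr (src C f)"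
  using DC by (auto simp: D_category_def)

lemma pr_kernel: "X \<in> obj C \<Longrightarrow> \<exists>Z c i. is_space_tensor C (omega D) X Z c \<and> short_exact C i (pr X) \<and> src C i = Z \<and>
        (\<forall>\<omega>\<in>forms1 D. om X \<omega> = i \<cdot> c \<omega> \<cdot> pr X)"
  using DC by (simp add: D_category_def)

lemma em_typ [simp]: "X \<in> obj C \<Longrightarrow> em X \<in> arr C" "X \<in> obj C \<Longrightarrow> src C (em X) = AO2 X"
   "X \<in> obj C \<Longrightarrow> tgt C (em X) = AO (AO X)"
  using DC by (auto simp: D_category_def homs_iff)

lemma em_AF2: "f \<in> arr C \<Longrightarrow> tgt C f = Y \<Longrightarrow> em Y \<cdot> AF2 f = AF (AF f) \<cdot> em (src C f)"
  using DC by (auto simp: D_category_def)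

lemma em_base_change: "X \<in> obj C \<Longrightarrow> base_change C (carrier (jet2 D)) (AO2 X) (aact (at2 A) X) id
        (jet11 D) (rho2 D) (AO (AO X)) (act11 D C (at1 A) X) (em X)"
  using DC by (simp add: D_category_def)

lemma act2_module: "X \<in> obj C \<Longrightarrow> module_in C (jet2 D) (rho2 D) (AO2 X) (aact (at2 A) X)"
  using at2 by (auto simp: atiyah_functor_def)

lemma act2_typ [simp]: 
  assumes "X \<in> obj C" "p \<in> carrier (jet2 D)"
  shows "aact (at2 A) X p \<in> arr C" "src C (aact (at2 A) X p) = AO2 X" "tgt C (aact (at2 A) X p) = AO2 X"
  using act2_module[OF assms(1)] assms unfolding module_in_def by (auto simp: homs_iff)

lemma AF_hzero [simp]: "X \<in> obj C \<Longrightarrow> Y \<in> obj C \<Longrightarrow> AF (hzero C X Y) = hzero C (AO X) (AO Y)"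
proof -
  assume o: "X \<in> obj C" "Y \<in> obj C"
  have "d0 D 0 = (\<lambda>x. 0)" by (simp add: d0_def)
  then have "AF (hscal C 0 (hzero C X Y)) = hsub (hzero C (AO X) (AO Y)) (hzero C (AO X) (AO Y))"
    using o by (subst AF_hscal) (auto simp: om_zero hscal_zero)
  then show ?thesis using o by (simp add: hsub_def)
qed

lemma AF_hsub [simp]: "f \<in> arr C \<Longrightarrow> g \<in> arr C \<Longrightarrow> src C f = src C g \<Longrightarrow> tgt C f = tgt C g \<Longrightarrow>
   AF (hsub f g) = hsub (AF f) (AF g)"
proof -
  assume a: "f \<in> arr C" "g \<in> arr C" "src C f = src C g" "tgt C f = tgt C g"
  \<comment> \<open>\<open>At1\<close> commutes with the scalar \<open>-1\<close> because this is a
    constant.\<close>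
  have "d0 D (- 1) = (\<lambda>x. 0)" by (simp add: d0_def der_minus)
  then have "AF (hscal C (- 1) g) = hscal C (- 1) (AF g)"
    using a by (simp add: AF_hscal om_zero hsub_def)
  then show ?thesis using a by (simp add: hsub_def)
qed

lemma AF_hsum:
  assumes "X \<in> obj C" "Y \<in> obj C" "finite B" "\<And>b. b \<in> B \<Longrightarrow> g b \<in> arr C" "\<And>b. b \<in> B \<Longrightarrow> src C (g b) = X"
    "\<And>b. b \<in> B \<Longrightarrow> tgt C (g b) = Y"
  shows "AF (hsum X Y g B) = hsum (AO X) (AO Y) (\<lambda>b. AF (g b)) B"
proof -
  interpret H: module fld "hspace C X Y" by (rule hspace_module) (use assms in auto)
  interpret H': module fld "hspace C (AO X) (AO Y)" by (rule hspace_module) (use assms in auto)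
  show ?thesis using assms(3-)
  proof (induction B rule: finite_induct)
    case empty then show ?case using assms by (simp add: hsum_def)
  next
    case (insert x F)
    have 1: "hsum X Y g (insert x F) = hadd C (g x) (hsum X Y g F)"
      using insert unfolding hsum_def by (subst H.finsum_insert) (auto simp: homs_iff)
    have 2: "hsum (AO X) (AO Y) (\<lambda>b. AF (g b)) (insert x F) = hadd C (AF (g x)) (hsum (AO X) (AO Y) (\<lambda>b. AF (g b)) F)"
      using insert unfolding hsum_def by (subst H'.finsum_insert) (auto simp: homs_iff)
    show ?case unfolding 1 2 using insert assms by (subst AF_hadd) auto
  qed
qed

lemma pr_AF' [simp]:
  "f \<in> arr C \<Longrightarrow> tgt C f = Y \<Longrightarrow> g \<in> arr C \<Longrightarrow> tgt C g = AO (src C f) \<Longrightarrow> pr Y \<cdot> AF f \<cdot> g = f \<cdot> pr (src C f) \<cdot> g"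
  by (subst reassoc[OF pr_AF]) auto

lemma pr_act' [simp]:
  "X \<in> obj C \<Longrightarrow> snd p \<in> forms1 D \<Longrightarrow> g \<in> arr C \<Longrightarrow> tgt C g = AO X \<Longrightarrow>
    pr X \<cdot> aact (at1 A) X p \<cdot> g = hscal C (fst p) (pr X \<cdot> g)"
  by (subst reassoc[OF pr_act]) auto

lemma AF_act':
  "f \<in> arr C \<Longrightarrow> src C f = X \<Longrightarrow> snd p \<in> forms1 D \<Longrightarrow> g \<in> arr C \<Longrightarrow> tgt C g = AO X \<Longrightarrow>
   AF f \<cdot> aact (at1 A) X p \<cdot> g = aact (at1 A) (tgt C f) p \<cdot> AF f \<cdot> g"
  by (subst reassoc[OF AF_act]) auto

end

section \<open>The splitting of \<open>At1 X\<close> by a connection\<close>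

locale d_connection = d_category D C T A
  for D :: "('k::field_char_0, 'd::ab_group_add) dfield" and C :: "('o, 'a, 'k) lcat" (structure)
    and T :: "('o, 'a) tensor_data" and A :: "('k, 'd, 'o, 'a) at_data" +
  fixes X :: 'o and s :: 'a
  assumes X [simp]: "X \<in> obj C" and s: "D_connection C A X s"
begin

lemma s_typ [simp]: "s \<in> arr C" "src C s = X" "tgt C s = AO X"
  and pr_s [simp]: "pr X \<cdot> s = idt C X"
  using s by (simp_all add: D_connection_def homs_iff)

lemma pr_s' [simp]: "f \<in> arr C \<Longrightarrow> tgt C f = X \<Longrightarrow> pr X \<cdot> (s \<cdot> f) = f"
  using reassoc[OF pr_s] by simp

text \<open>Expressed through the action of one-forms on \<open>At1 X\<close>, so that no object
  representing \<open>\<Omega> \<otimes> X\<close> has to be named; such an object is only known to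
  exist.\<close>

definition is_ctr :: "'d \<Rightarrow> 'a \<Rightarrow> bool" where
  "is_ctr x h \<longleftrightarrow> h \<in> homs C (AO X) X \<and> h \<cdot> s = hzero C X X \<and>
     (\<forall>\<omega>\<in>forms1 D. h \<cdot> om X \<omega> = hscal C (\<omega> x) (pr X))"

text \<open>On the kernel \<open>Z = \<Omega> \<otimes> X\<close> of \<open>pr X\<close> the
  universal property gives contractions \<open>k x\<close>, and the dual basis expands the identity
  of \<open>Z\<close> in terms of them. The section \<open>s\<close> gives a projection
  \<open>r\<close> of \<open>At1 X\<close> onto \<open>Z\<close>, so that
  \<open>k x \<cdot> r\<close> is the contraction. The factor \<open>s\<close> appears in the sum
  because \<open>om X \<omega> \<cdot> s\<close> equals \<open>i \<cdot> c \<omega>\<close>.\<close>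

lemma ctr_decomposition_exists:
  "\<exists>h. (\<forall>x. is_ctr x (h x)) \<and>
    idt C (AO X) = hadd C (s \<cdot> pr X) (hsum (AO X) (AO X) (\<lambda>b. om X (dual b) \<cdot> s \<cdot> h b) bas)"
proof -
  obtain Z c i where Z: "is_space_tensor C (omega D) X Z c" and ex: "short_exact C i (pr X)" and iZ: "src C i = Z"
    and omc: "\<And>\<omega>. \<omega> \<in> forms1 D \<Longrightarrow> om X \<omega> = i \<cdot> c \<omega> \<cdot> pr X"
    using pr_kernel[OF X] by blast
  have ker: "is_kernel C i (pr X)" using ex by (simp add: short_exact_def)
  then have i [simp]: "i \<in> arr C" "src C i = Z" "tgt C i = AO X" and pri: "pr X \<cdot> i = hzero C Z X"
    using iZ by (auto simp: is_kernel_def)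
  have kerE: "\<exists>!h. h \<in> homs C (src C g) Z \<and> i \<cdot> h = g"
    if "g \<in> arr C" "tgt C g = AO X" "pr X \<cdot> g = hzero C (src C g) X" for g
    using ker that by (auto simp: is_kernel_def)
  have Zo [simp]: "Z \<in> obj C" using i(1) i(2) src_tgt_obj(1) by blast
  have carr: "carrier (omega D) = forms1 D" "add (omega D) = (\<lambda>\<omega> \<eta> x. \<omega> x + \<eta> x)" "smult (omega D) = (\<lambda>a \<omega> x. a * \<omega> x)"
    by (simp_all add: omega_def)
  have c [simp]: "c \<omega> \<in> arr C" "src C (c \<omega>) = X" "tgt C (c \<omega>) = Z" if "\<omega> \<in> forms1 D" for \<omega>
    using Z that by (auto simp: is_space_tensor_def semilin_map_def carr homs_iff)
  have clin: "c (\<lambda>x. \<omega> x + \<eta> x) = hadd C (c \<omega>) (c \<eta>)" "c (\<lambda>x. a * \<omega> x) = hscal C a (c \<omega>)"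
    if "\<omega> \<in> forms1 D" "\<eta> \<in> forms1 D" for a \<omega> \<eta>
    using Z that by (auto simp: is_space_tensor_def semilin_map_def carr homs_iff)
  have univ: "\<exists>!h. h \<in> homs C Z Y \<and> (\<forall>\<omega>\<in>forms1 D. h \<cdot> c \<omega> = g \<omega>)"
    if "Y \<in> obj C" "lin_map (omega D) (hspace C X Y) g" for Y g
    using Z that unfolding is_space_tensor_def carr by blast
  have "\<exists>h. h \<in> homs C Z X \<and> (\<forall>\<omega>\<in>forms1 D. h \<cdot> c \<omega> = hscal C (\<omega> x) (idt C X))" for x
  proof -
    have "lin_map (omega D) (hspace C X X) (\<lambda>\<omega>. hscal C (\<omega> x) (idt C X))"
      unfolding semilin_map_def carr
      by (auto simp: homs_iff hform_simps intro!: hom_eqI[where X = X and Y = X] simp: algebra_simps)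
    from univ[OF X this] show ?thesis by blast
  qed
  then obtain k where k: "\<And>x. k x \<in> homs C Z X" "\<And>x \<omega>. \<omega> \<in> forms1 D \<Longrightarrow> k x \<cdot> c \<omega> = hscal C (\<omega> x) (idt C X)"
    by metis
  have k_typ [simp]: "k x \<in> arr C" "src C (k x) = Z" "tgt C (k x) = X" for x
    using k(1) by (auto simp: homs_iff)
  \<comment> \<open>Both sides agree after composition with every \<open>c \<eta>\<close>, by the
    expansion of \<open>\<eta>\<close> in the dual basis; the uniqueness in the universal property
    of \<open>Z\<close> does the rest.\<close>
  have idZ: "hsum Z Z (\<lambda>b. c (dual b) \<cdot> k b) bas = idt C Z"
  proof -
    have cl: "lin_map (omega D) (hspace C X Z) c" using Z by (simp add: is_space_tensor_def)
    have "hsum Z Z (\<lambda>b. c (dual b) \<cdot> k b)  bas \<cdot> c \<eta> = c \<eta>" if \<eta> [simp]: "\<eta> \<in> forms1 D" for \<eta>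
    proof (rule hom_eqI[where X = X and Y = Z])
      fix p assume p: "hform X Z p"
      have ind: "(\<Sum>b\<in>F. \<eta> b * p (c (dual b))) = p (c (\<lambda>x. \<Sum>b\<in>F. \<eta> b * dual b x))" if "finite F" for F
        using that
      proof (induction F rule: finite_induct)
        case empty
        show ?case using clin(2)[of "\<lambda>x. 0" "\<lambda>x. 0" 0] p by (simp add: hscal_zero)
      next
        case (insert b F)
        have sf: "(\<lambda>x. \<Sum>b\<in>F. \<eta> b * dual b x) \<in> forms1 D"
          by (rule forms1_sum_closed) simp
        have "p (c (\<lambda>x. \<Sum>b\<in>insert b F. \<eta> b * dual b x)) = p (c (\<lambda>x. \<eta> b * dual b x + (\<Sum>b\<in>F. \<eta> b * dual b x)))"
          using insert by simp
        also have "\<dots> = p (hadd C (hscal C (\<eta> b) (c (dual b))) (c (\<lambda>x. \<Sum>b\<in>F. \<eta> b * dual b x)))"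
          by (subst clin(1)) (use sf in \<open>auto simp: clin(2)[OF dual_form dual_form]\<close>)
        also have "\<dots> = \<eta> b * p (c (dual b)) + p (c (\<lambda>x. \<Sum>b\<in>F. \<eta> b * dual b x))"
          using sf by (simp add: hform_hadd[OF p] hform_hscal[OF p])
        finally show ?case unfolding insert(3)[symmetric] using insert(1,2) by simp
      qed
      have "p (hsum Z Z (\<lambda>b. c (dual b) \<cdot> k b)  bas \<cdot> c \<eta>) = p (hsum X Z (\<lambda>b. (c (dual b) \<cdot> k b) \<cdot> c \<eta>) bas)"
        using bas_finite by (subst cmp_hsum_left) auto
      also have "\<dots> = (\<Sum>b\<in>bas. \<eta> b * p (c (dual b)))"
        using bas_finite by (subst hform_hsum[OF p]) (auto simp: k(2) hform_simps[OF p])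
      also have "\<dots> = p (c (\<lambda>x. \<Sum>b\<in>bas. \<eta> b * dual b x))" by (rule ind) simp
      also have "(\<lambda>x. \<Sum>b\<in>bas. \<eta> b * dual b x) = \<eta>"
      proof
        fix x show "(\<Sum>b\<in>bas. \<eta> b * dual b x) = \<eta> x"
          by (subst dual_sum[OF \<eta>, of x, symmetric]) (simp add: mult.commute)
      qed
      finally show "p (hsum Z Z (\<lambda>b. c (dual b) \<cdot> k b)  bas \<cdot> c \<eta>) = p (c \<eta>)" .
    qed auto
    moreover have "hsum Z Z (\<lambda>b. c (dual b) \<cdot> k b)  bas \<in> homs C Z Z" by (simp add: homs_iff)
    moreover have "idt C Z \<in> homs C Z Z" "\<And>\<eta>. \<eta> \<in> forms1 D \<Longrightarrow> idt C Z \<cdot> c \<eta> = c \<eta>" by (auto simp: homs_iff)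
    ultimately show ?thesis using univ[OF Zo cl] by blast
  qed
  obtain r where r: "r \<in> homs C (AO X) Z" "i \<cdot> r = hsub (idt C (AO X)) (s \<cdot> pr X)"
  proof -
    have "pr X \<cdot> hsub (idt C (AO X)) (s \<cdot> pr X) = hzero C (AO X) X"
      by (rule hom_eqI[where X = "AO X" and Y = X]) (auto simp: hform_hsub)
    then show ?thesis using kerE[of "hsub (idt C (AO X)) (s \<cdot> pr X)"] that by auto
  qed
  have r_typ [simp]: "r \<in> arr C" "src C r = AO X" "tgt C r = Z" using r(1) by (auto simp: homs_iff)
  have i_cancel: "f = g" if "i \<cdot> f = i \<cdot> g" "f \<in> homs C Y Z" "g \<in> homs C Y Z" "Y \<in> obj C" for f g Y
  proof -
    have "pr X \<cdot> (i \<cdot> g) = hzero C Y X" using that reassoc[OF pri, of g] by (auto simp: homs_iff)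
    then show ?thesis using kerE[of "i \<cdot> g"] that by (auto simp: homs_iff)
  qed
  have rs: "r \<cdot> s = hzero C X Z"
  proof (rule i_cancel)
    show "i \<cdot> r \<cdot> s = i \<cdot> hzero C X Z"
      by (subst reassoc[OF r(2)]; (rule hom_eqI[where X = X and Y = "AO X"])?) (auto simp: hform_hsub)
  qed (auto simp: homs_iff)
  have ri: "r \<cdot> i = idt C Z"
  proof (rule i_cancel)
    show "i \<cdot> r \<cdot> i = i \<cdot> idt C Z"
      by (subst reassoc[OF r(2)]; (rule hom_eqI[where X = Z and Y = "AO X"])?) (auto simp: hform_hsub pri)
  qed (auto simp: homs_iff)
  have ctr: "is_ctr x (k x \<cdot> r)" for x
    unfolding is_ctr_def
  proof (intro conjI ballI)
    show "k x \<cdot> r \<in> homs C (AO X) X" by (simp add: homs_iff)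
    show "(k x \<cdot> r) \<cdot> s = hzero C X X" by (simp add: rs)
    fix \<omega> assume w [simp]: "\<omega> \<in> forms1 D"
    show "(k x \<cdot> r) \<cdot> om X \<omega> = hscal C (\<omega> x) (pr X)"
      by (simp add: omc reassoc[OF ri] reassoc[OF k(2)])
  qed
  have "idt C (AO X) = hadd C (s \<cdot> pr X) (hsum (AO X) (AO X) (\<lambda>b. om X (dual b) \<cdot> s \<cdot> k b \<cdot> r) bas)"
  proof -
    have "hsum (AO X) (AO X) (\<lambda>b. om X (dual b) \<cdot> s \<cdot> k b \<cdot> r) bas = hsum (AO X) (AO X) (\<lambda>b. i \<cdot> (c (dual b) \<cdot> k b) \<cdot> r) bas"
      using bas_finite by (intro hsum_cong) (auto simp: omc)
    also have "\<dots> = i \<cdot> hsum Z Z (\<lambda>b. c (dual b) \<cdot> k b)  bas \<cdot> r"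
      using bas_finite by (simp add: cmp_hsum_left cmp_hsum_right)
    also have "\<dots> = hsub (idt C (AO X)) (s \<cdot> pr X)" by (simp add: idZ r(2))
    finally show ?thesis
      by (intro hom_eqI[where X = "AO X" and Y = "AO X"]) (auto simp: hform_hadd hform_hsub)
  qed
  then show ?thesis using ctr by (intro exI[of _ "\<lambda>x. k x \<cdot> r"]) simp
qed

end

context d_connection
begin

text \<open>
  The contraction with \<open>x\<close> of the component in \<open>\<Omega> \<otimes> X\<close>, in the splitting of \<open>At\<^sup>1 X\<close> given by \<open>s\<close>.
  As \<open>At\<^sup>1 (af) = \<lambda>(a) \<circ> At\<^sup>1 f\<close> with \<open>\<lambda>(a) = \<rho>(a) - da\<close>, the sign in \<open>nab\<close> is needed
  for the Leibniz rule.
\<close>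

definition ctr :: "'d \<Rightarrow> 'a" where
  "ctr x = (THE h. is_ctr x h)"

definition nab :: "'d \<Rightarrow> 'a \<Rightarrow> 'a" where
  "nab x f = hscal C (- 1) (ctr x \<cdot> AF f \<cdot> s)"

text \<open>Composing \<open>u\<close> with the decomposition of the identity of
  \<open>At1 X\<close> expresses it through \<open>u \<cdot> s\<close> and the
  \<open>u \<cdot> om X \<omega>\<close>.\<close>

lemma joint_epi:
  assumes "u \<in> arr C" "v \<in> arr C" "src C u = AO X" "src C v = AO X" "tgt C u = tgt C v"
    and s: "u \<cdot> s = v \<cdot> s" and om: "\<And>\<omega>. \<omega> \<in> forms1 D \<Longrightarrow> u \<cdot> om X \<omega> = v \<cdot> om X \<omega>"
  shows "u = v"
proof -
  obtain h where h: "\<And>x. is_ctr x (h x)"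
    and dec: "idt C (AO X) = hadd C (s \<cdot> pr X) (hsum (AO X) (AO X) (\<lambda>b. om X (dual b) \<cdot> s \<cdot> h b) bas)"
    using ctr_decomposition_exists by blast
  have [simp]: "h x \<in> arr C" "src C (h x) = AO X" "tgt C (h x) = X" for x
    using h by (auto simp: is_ctr_def homs_iff)
  have exp: "w = hadd C (w \<cdot> s \<cdot> pr X) (hsum (AO X) (tgt C w) (\<lambda>b. (w \<cdot> om X (dual b)) \<cdot> s \<cdot> h b) bas)"
    if "w \<in> arr C" "src C w = AO X" for w
  proof -
    have "w = w \<cdot> idt C (AO X)" using that by simp
    also have "\<dots> = hadd C (w \<cdot> s \<cdot> pr X) (hsum (AO X) (tgt C w) (\<lambda>b. (w \<cdot> om X (dual b)) \<cdot> s \<cdot> h b) bas)"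
      unfolding dec using that by (simp add: cmp_hsum_right)
    finally show ?thesis .
  qed
  have sp: "u \<cdot> s \<cdot> pr X = v \<cdot> s \<cdot> pr X" using s assms(1-5) by (metis X cmp_assoc pr_typ(1,3) s_typ)
  show ?thesis
    using exp[of u] exp[of v] assms(1-5) by (simp add: om sp)
qed

lemma is_ctr_unique:
  assumes g: "is_ctr x g" and h: "is_ctr x h"
  shows "g = h"
proof -
  have g': "g \<in> arr C" "src C g = AO X" "tgt C g = X" "g \<cdot> s = hzero C X X"
    "\<And>\<omega>. \<omega> \<in> forms1 D \<Longrightarrow> g \<cdot> om X \<omega> = hscal C (\<omega> x) (pr X)"
    using g by (simp_all add: is_ctr_def homs_iff)
  have h': "h \<in> arr C" "src C h = AO X" "tgt C h = X" "h \<cdot> s = hzero C X X"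
    "\<And>\<omega>. \<omega> \<in> forms1 D \<Longrightarrow> h \<cdot> om X \<omega> = hscal C (\<omega> x) (pr X)"
    using h by (simp_all add: is_ctr_def homs_iff)
  show ?thesis by (rule joint_epi) (simp_all only: g' h')
qed

lemma is_ctr_ctr: "is_ctr x (ctr x)"
  unfolding ctr_def
proof (rule theI')
  obtain h where h: "\<And>x. is_ctr x (h x)" using ctr_decomposition_exists by blast
  show "\<exists>!h. is_ctr x h" using h is_ctr_unique by blast
qed

lemma ctr_unique: "is_ctr x h \<Longrightarrow> h = ctr x"
  using is_ctr_ctr is_ctr_unique by blast

lemma ctr_typ [simp]: "ctr x \<in> arr C" "src C (ctr x) = AO X" "tgt C (ctr x) = X"
  using is_ctr_ctr by (auto simp: is_ctr_def homs_iff)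

lemma ctr_s [simp]: "ctr x \<cdot> s = hzero C X X"
  and ctr_om [simp]: "\<omega> \<in> forms1 D \<Longrightarrow> ctr x \<cdot> om X \<omega> = hscal C (\<omega> x) (pr X)"
  using is_ctr_ctr by (auto simp: is_ctr_def)

lemma ctr_om' [simp]: "\<omega> \<in> forms1 D \<Longrightarrow> f \<in> arr C \<Longrightarrow> tgt C f = AO X \<Longrightarrow>
    ctr x \<cdot> om X \<omega> \<cdot> f = hscal C (\<omega> x) (pr X \<cdot> f)"
  using reassoc[OF ctr_om] by simp

lemma decomposition:
  "idt C (AO X) = hadd C (s \<cdot> pr X) (hsum (AO X) (AO X) (\<lambda>b. om X (dual b) \<cdot> s \<cdot> ctr b) bas)"
proof -
  obtain h where h: "\<And>x. is_ctr x (h x)"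
    and dec: "idt C (AO X) = hadd C (s \<cdot> pr X) (hsum (AO X) (AO X) (\<lambda>b. om X (dual b) \<cdot> s \<cdot> h b) bas)"
    using ctr_decomposition_exists by blast
  have "h = ctr" using ctr_unique h by blast
  then show ?thesis using dec by simp
qed

lemma ctr_add: "ctr (x + y) = hadd C (ctr x) (ctr y)"
  by (rule ctr_unique[symmetric])
    (auto simp: is_ctr_def homs_iff forms1_simps hform_simps intro!: hom_eqI[where X = "AO X" and Y = X] simp: algebra_simps)

lemma ctr_scl: "ctr (scl D a x) = hscal C a (ctr x)"
  by (rule ctr_unique[symmetric])
    (auto simp: is_ctr_def homs_iff forms1_simps hform_simps intro!: hom_eqI[where X = "AO X" and Y = X] simp: algebra_simps)

text \<open>By the decomposition of the identity, a morphism into \<open>At1 X\<close> is a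
  combination of its coordinates under \<open>pr X\<close> and the contractions.\<close>

lemma joint_mono:
  assumes u: "u \<in> arr C" "tgt C u = AO X" and v: "v \<in> arr C" "tgt C v = AO X" and uv: "src C u = src C v"
    and pr: "pr X \<cdot> u = pr X \<cdot> v" and ctr: "\<And>x. ctr x \<cdot> u = ctr x \<cdot> v"
  shows "u = v"
proof -
  have exp: "w = hadd C (s \<cdot> pr X \<cdot> w) (hsum (src C w) (AO X) (\<lambda>b. om X (dual b) \<cdot> s \<cdot> ctr b \<cdot> w) bas)"
    if "w \<in> arr C" "tgt C w = AO X" for w
  proof -
    have "w = idt C (AO X) \<cdot> w" using that by simp
    also have "\<dots> = hadd C (s \<cdot> pr X \<cdot> w) (hsum (src C w) (AO X) (\<lambda>b. om X (dual b) \<cdot> s \<cdot> ctr b \<cdot> w) bas)"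
      unfolding decomposition using that by (simp add: cmp_hsum_left)
    finally show ?thesis .
  qed
  show ?thesis using exp[OF u] exp[OF v] by (simp add: pr ctr uv)
qed

lemma AF_decomposition:
  "idt C (AO (AO X)) = hadd C (AF s \<cdot> AF (pr X))
     (hsum (AO (AO X)) (AO (AO X)) (\<lambda>b. AF (om X (dual b)) \<cdot> AF s \<cdot> AF (ctr b)) bas)"
proof -
  have "AF (idt C (AO X)) = hadd C (AF s \<cdot> AF (pr X))
     (hsum (AO (AO X)) (AO (AO X)) (\<lambda>b. AF (om X (dual b)) \<cdot> AF s \<cdot> AF (ctr b)) bas)"
    unfolding decomposition by (simp add: AF_hsum)
  then show ?thesis by simp
qed

text \<open>The additive functor \<open>At1\<close> carries the decomposition of the identity of
  \<open>At1 X\<close> to one for \<open>At1 (At1 X)\<close>. Combined with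
  \<open>joint_mono\<close> it provides coordinates on second-order jets.\<close>

lemma joint_mono_AF:
  assumes u: "u \<in> arr C" "tgt C u = AO (AO X)" and v: "v \<in> arr C" "tgt C v = AO (AO X)" and uv: "src C u = src C v"
    and pr: "AF (pr X) \<cdot> u = AF (pr X) \<cdot> v" and ctr: "\<And>x. AF (ctr x) \<cdot> u = AF (ctr x) \<cdot> v"
  shows "u = v"
proof -
  have exp: "w = hadd C (AF s \<cdot> AF (pr X) \<cdot> w) (hsum (src C w) (AO (AO X)) (\<lambda>b. AF (om X (dual b)) \<cdot> AF s \<cdot> AF (ctr b) \<cdot> w) bas)"
    if "w \<in> arr C" "tgt C w = AO (AO X)" for w
  proof -
    have "w = idt C (AO (AO X)) \<cdot> w" using that by simp
    also have "\<dots> = hadd C (AF s \<cdot> AF (pr X) \<cdot> w) (hsum (src C w) (AO (AO X)) (\<lambda>b. AF (om X (dual b)) \<cdot> AF s \<cdot> AF (ctr b) \<cdot> w) bas)"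
      unfolding AF_decomposition using that by (simp add: cmp_hsum_left)
    finally show ?thesis .
  qed
  show ?thesis using exp[OF u] exp[OF v] by (simp add: pr ctr uv)
qed

lemma nab_typ [simp]:
  "f \<in> arr C \<Longrightarrow> src C f = X \<Longrightarrow> tgt C f = X \<Longrightarrow> nab x f \<in> arr C"
  "f \<in> arr C \<Longrightarrow> src C f = X \<Longrightarrow> tgt C f = X \<Longrightarrow> src C (nab x f) = X"
  "f \<in> arr C \<Longrightarrow> src C f = X \<Longrightarrow> tgt C f = X \<Longrightarrow> tgt C (nab x f) = X"
  by (simp_all add: nab_def)

text \<open>The difference of \<open>ctr x \<cdot> AF f\<close> and \<open>f \<cdot> ctr x\<close>
  vanishes on \<open>\<Omega> \<otimes> X\<close>, as \<open>AF f\<close> commutes with one-forms.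
  Hence it factors through \<open>pr X\<close>, and evaluation on \<open>s\<close> shows that the
  factor is \<open>- nab x f\<close>.\<close>

lemma ctr_AF:
  assumes "f \<in> arr C" "src C f = X" "tgt C f = X"
  shows "ctr x \<cdot> AF f = hsub (f \<cdot> ctr x) (nab x f \<cdot> pr X)"
proof (rule joint_epi)
  show "(ctr x \<cdot> AF f) \<cdot> s = hsub (f \<cdot> ctr x) (nab x f \<cdot> pr X) \<cdot> s"
    using assms by (intro hom_eqI[where X = X and Y = X]) (auto simp: nab_def hform_hsub hform_simps)
  fix \<omega> assume w [simp]: "\<omega> \<in> forms1 D"
  show "(ctr x \<cdot> AF f) \<cdot> om X \<omega> = hsub (f \<cdot> ctr x) (nab x f \<cdot> pr X) \<cdot> om X \<omega>"
    using assms
    by (intro hom_eqI[where X = "AO X" and Y = X]) (auto simp: AF_act hform_hsub hform_simps)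
qed (use assms in auto)

lemma nab_eqI:
  assumes "f \<in> arr C" "src C f = X" "tgt C f = X" "g \<in> arr C" "src C g = X" "tgt C g = X"
    and e: "ctr x \<cdot> AF f = hsub (f \<cdot> ctr x) (g \<cdot> pr X)"
  shows "nab x f = g"
proof -
  have "(ctr x \<cdot> AF f) \<cdot> s = hsub (f \<cdot> ctr x) (g \<cdot> pr X) \<cdot> s" by (simp only: e)
  then have *: "ctr x \<cdot> AF f \<cdot> s = hsub (hzero C X X) g" using assms(1-6) by simp
  show ?thesis unfolding nab_def * using assms(1-6)
    by (intro hom_eqI[where X = X and Y = X]) (auto simp: hform_hsub hform_simps)
qed

lemma nab_hadd:
  assumes "f \<in> arr C" "src C f = X" "tgt C f = X" "g \<in> arr C" "src C g = X" "tgt C g = X"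
  shows "nab x (hadd C f g) = hadd C (nab x f) (nab x g)"
  unfolding nab_def using assms
  by (intro hom_eqI[where X = X and Y = X]) (auto simp: hform_simps algebra_simps)

lemma nab_hsub:
  assumes "f \<in> arr C" "src C f = X" "tgt C f = X" "g \<in> arr C" "src C g = X" "tgt C g = X"
  shows "nab x (hsub f g) = hsub (nab x f) (nab x g)"
  unfolding nab_def using assms
  by (intro hom_eqI[where X = X and Y = X]) (auto simp: hform_simps hform_hsub algebra_simps)

lemma nab_hscal:
  assumes "f \<in> arr C" "src C f = X" "tgt C f = X"
  shows "nab x (hscal C a f) = hadd C (hscal C a (nab x f)) (hscal C (der D x a) f)"
  unfolding nab_def using assms
  by (intro hom_eqI[where X = X and Y = X]) (simp_all add: AF_hscal hform_simps hform_hsub algebra_simps d0_apply)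

text \<open>The contraction is moved past \<open>AF f\<close> and \<open>AF g\<close> one after the
  other by \<open>ctr_AF\<close>; the coefficient of \<open>pr X\<close> that accumulates is the
  derivative of the composite.\<close>

lemma nab_cmp:
  assumes f: "f \<in> arr C" "src C f = X" "tgt C f = X" and g: "g \<in> arr C" "src C g = X" "tgt C g = X"
  shows "nab x (f \<cdot> g) = hadd C (nab x f \<cdot> g) (f \<cdot> nab x g)"
proof (rule nab_eqI)
  have "ctr x \<cdot> AF (f \<cdot> g) = (ctr x \<cdot> AF f) \<cdot> AF g" using f g by simp
  also have "\<dots> = hsub (f \<cdot> ctr x \<cdot> AF g) (nab x f \<cdot> g \<cdot> pr X)" using f g by (simp add: ctr_AF[OF f])
  also have "\<dots> = hsub ((f \<cdot> g) \<cdot> ctr x) (hadd C (nab x f \<cdot> g) (f \<cdot> nab x g) \<cdot> pr X)"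
    using f g by (intro hom_eqI[where X = "AO X" and Y = X]) (auto simp: ctr_AF[OF g] hform_hsub hform_simps algebra_simps)
  finally show "ctr x \<cdot> AF (f \<cdot> g) = hsub ((f \<cdot> g) \<cdot> ctr x) (hadd C (nab x f \<cdot> g) (f \<cdot> nab x g) \<cdot> pr X)" .
qed (use f g in auto)

lemma nab_left:
  assumes "f \<in> arr C" "src C f = X" "tgt C f = X"
  shows "nab (x + y) f = hadd C (nab x f) (nab y f)" "nab (scl D a x) f = hscal C a (nab x f)"
  unfolding nab_def using assms
  by (intro hom_eqI[where X = X and Y = X]; simp add: ctr_add ctr_scl hform_simps algebra_simps)+

lemma ctr_act:
  assumes "snd p \<in> forms1 D"
  shows "ctr x \<cdot> aact (at1 A) X p = hadd C (hscal C (fst p) (ctr x)) (hscal C (snd p x - der D x (fst p)) (pr X))"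
proof -
  have "ctr x \<cdot> aact (at1 A) X (fst p, snd p) = hadd C (hscal C (fst p) (ctr x)) (hscal C (snd p x - der D x (fst p)) (pr X))"
    using assms by (subst act_eq) (simp_all add: d0_apply)
  then show ?thesis by simp
qed

lemma nab_homs: "f \<in> homs C X X \<Longrightarrow> nab x f \<in> homs C X X"
  by (simp add: homs_iff)

end

section \<open>Second-order jets\<close>

context d_connection
begin

abbreviation "q2 \<equiv> pr X \<cdot> pr (AO X)"
abbreviation "v1 y \<equiv> ctr y \<cdot> AF (pr X)"
abbreviation "v2 x \<equiv> ctr x \<cdot> pr (AO X)"
abbreviation "th2c x y \<equiv> ctr y \<cdot> AF (ctr x)"

text \<open>
  The action of an element of \<open>P\<^sup>1 \<otimes> P\<^sup>1\<close> on \<open>At\<^sup>1 (At\<^sup>1 X)\<close> in the coordinates given by \<open>s\<close>.  They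
  determine the action, so the choice of a decomposition in \<^const>\<open>act11\<close> does not matter.
\<close>

definition jcoord :: "('k, 'd) jt2 \<Rightarrow> 'a \<Rightarrow> bool" where
  "jcoord t \<sigma> \<longleftrightarrow> (case t of (c, w, w', \<tau>) \<Rightarrow> \<sigma> \<in> homs C (AO (AO X)) (AO (AO X)) \<and>
     q2 \<cdot> \<sigma> = hscal C c q2 \<and>
     (\<forall>y. v1 y \<cdot> \<sigma> = hadd C (hscal C c (v1 y)) (hscal C (w' y - der D y c) q2)) \<and>
     (\<forall>x. v2 x \<cdot> \<sigma> = hadd C (hscal C c (v2 x)) (hscal C (w x - der D x c) q2)) \<and>
     (\<forall>x y. th2c x y \<cdot> \<sigma> = hadd C (hadd C (hscal C c (th2c x y)) (hscal C (w x - der D x c) (v1 y)))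
         (hadd C (hscal C (w' y - der D y c) (v2 x)) (hscal C (\<tau> x y - der D y (w x - der D x c)) q2))))"

lemma ctr_act':
  "snd p \<in> forms1 D \<Longrightarrow> g \<in> arr C \<Longrightarrow> tgt C g = AO X \<Longrightarrow>
   ctr x \<cdot> aact (at1 A) X p \<cdot> g = hadd C (hscal C (fst p) (ctr x \<cdot> g)) (hscal C (snd p x - der D x (fst p)) (pr X \<cdot> g))"
  by (subst reassoc[OF ctr_act]) simp_all

text \<open>In \<open>P1\<close> the element \<open>(a, \<alpha>)\<close> is
  \<open>\<rho>(a)\<close> plus the one-form \<open>\<alpha> - d a\<close>, whence the terms
  \<open>w x - der D x c\<close>. The left factor acts through \<open>At1\<close>, where scalars
  come out with a correction by their differential; this produces the derivative in the last
  coordinate.\<close>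

lemma jcoord_tensor:
  assumes p: "snd p \<in> forms1 D" and q: "snd q \<in> forms1 D"
  shows "jcoord (jet_tensor D p q) (aact (at1 A) (AO X) q \<cdot> AF (aact (at1 A) X p))"
proof -
  obtain a \<alpha> where p_eq: "p = (a, \<alpha>)" by (cases p)
  obtain b \<beta> where q_eq: "q = (b, \<beta>)" by (cases q)
  have [simp]: "\<alpha> \<in> forms1 D" "\<beta> \<in> forms1 D" using p q by (simp_all add: p_eq q_eq)
  have e1: "AF (pr X) \<cdot> AF (aact (at1 A) X (a, \<alpha>)) = hsub (hscal C a (AF (pr X))) (om X (d0 D a) \<cdot> AF (pr X))"
  proof -
    have "AF (pr X) \<cdot> AF (aact (at1 A) X (a, \<alpha>)) = AF (pr X \<cdot> aact (at1 A) X (a, \<alpha>))" by (subst AF_cmp) simp_all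
    also have "\<dots> = hsub (hscal C a (AF (pr X))) (om X (d0 D a) \<cdot> AF (pr X))" by (simp add: AF_hscal)
    finally show ?thesis .
  qed
  have e2: "AF (ctr x) \<cdot> AF (aact (at1 A) X (a, \<alpha>)) =
     hadd C (hsub (hscal C a (AF (ctr x))) (om X (d0 D a) \<cdot> AF (ctr x)))
            (hsub (hscal C (\<alpha> x - der D x a) (AF (pr X))) (om X (d0 D (\<alpha> x - der D x a)) \<cdot> AF (pr X)))" for x
  proof -
    have "AF (ctr x) \<cdot> AF (aact (at1 A) X (a, \<alpha>)) = AF (ctr x \<cdot> aact (at1 A) X (a, \<alpha>))" by (subst AF_cmp) simp_all
    also have "\<dots> = hadd C (hsub (hscal C a (AF (ctr x))) (om X (d0 D a) \<cdot> AF (ctr x)))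
            (hsub (hscal C (\<alpha> x - der D x a) (AF (pr X))) (om X (d0 D (\<alpha> x - der D x a)) \<cdot> AF (pr X)))"
      by (simp add: ctr_act AF_hscal)
    finally show ?thesis .
  qed
  show ?thesis
    unfolding jcoord_def p_eq q_eq jet_tensor_def prod.case
  proof (intro conjI allI)
    show "aact (at1 A) (AO X) (b, \<beta>) \<cdot> AF (aact (at1 A) X (a, \<alpha>)) \<in> homs C (AO (AO X)) (AO (AO X))"
      by (simp add: homs_iff)
    show "q2 \<cdot> aact (at1 A) (AO X) (b, \<beta>) \<cdot> AF (aact (at1 A) X (a, \<alpha>)) = hscal C (a * b) q2"
      by (simp add: mult.commute)
    show "v1 y \<cdot> aact (at1 A) (AO X) (b, \<beta>) \<cdot> AF (aact (at1 A) X (a, \<alpha>)) =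
      hadd C (hscal C (a * b) (v1 y)) (hscal C (a * \<beta> y - der D y (a * b)) q2)" for y
      by (intro hom_eqI[where X = "AO (AO X)" and Y = X])
        (simp_all add: AF_act' e1 ctr_act' hform_simps hform_hsub d0_apply der_simps algebra_simps)
    show "v2 x \<cdot> aact (at1 A) (AO X) (b, \<beta>) \<cdot> AF (aact (at1 A) X (a, \<alpha>)) =
      hadd C (hscal C (a * b) (v2 x)) (hscal C (b * \<alpha> x + a * d0 D b x - der D x (a * b)) q2)" for x
      by (intro hom_eqI[where X = "AO (AO X)" and Y = X])
        (simp_all add: ctr_act' hform_simps hform_hsub d0_apply der_simps algebra_simps)
    show "th2c x y \<cdot> aact (at1 A) (AO X) (b, \<beta>) \<cdot> AF (aact (at1 A) X (a, \<alpha>)) =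
      hadd C (hadd C (hscal C (a * b) (th2c x y)) (hscal C (b * \<alpha> x + a * d0 D b x - der D x (a * b)) (v1 y)))
         (hadd C (hscal C (a * \<beta> y - der D y (a * b)) (v2 x))
         (hscal C (\<alpha> x * \<beta> y - d0 D a x * \<beta> y - der D y (b * \<alpha> x + a * d0 D b x - der D x (a * b))) q2))" for x y
      by (intro hom_eqI[where X = "AO (AO X)" and Y = X])
        (simp_all add: AF_act' e2 ctr_act' hform_simps hform_hsub d0_apply der_simps der_diff algebra_simps)
  qed
qed

lemma jcoord_zero: "jcoord \<zero>\<^bsub>jet11 D\<^esub> (hzero C (AO (AO X)) (AO (AO X)))"
  unfolding jcoord_def jet11_def ring.simps prod.case
  by (intro conjI allI)
    ((intro hom_eqI[where X = "AO (AO X)" and Y = X])?; simp add: homs_iff hform_simps)+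

lemma jcoord_add:
  assumes "jcoord t \<sigma>" "jcoord t' \<sigma>'"
  shows "jcoord (t \<oplus>\<^bsub>jet11 D\<^esub> t') (hadd C \<sigma> \<sigma>')"
proof -
  obtain c w w' \<tau> where t: "t = (c, w, w', \<tau>)" by (cases t)
  obtain d v v' \<rho> where t': "t' = (d, v, v', \<rho>)" by (cases t')
  have [simp]: "\<sigma> \<in> arr C" "src C \<sigma> = AO (AO X)" "tgt C \<sigma> = AO (AO X)"
    "\<sigma>' \<in> arr C" "src C \<sigma>' = AO (AO X)" "tgt C \<sigma>' = AO (AO X)"
    using assms by (auto simp: jcoord_def homs_iff split: prod.splits)
  have 1: "pr X \<cdot> pr (AO X) \<cdot> \<sigma> = hscal C c q2"
     "\<And>y. ctr y \<cdot> AF (pr X) \<cdot> \<sigma> = hadd C (hscal C c (v1 y)) (hscal C (w' y - der D y c) q2)"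
     "\<And>x. ctr x \<cdot> pr (AO X) \<cdot> \<sigma> = hadd C (hscal C c (v2 x)) (hscal C (w x - der D x c) q2)"
     "\<And>x y. ctr y \<cdot> AF (ctr x) \<cdot> \<sigma> = hadd C (hadd C (hscal C c (th2c x y)) (hscal C (w x - der D x c) (v1 y)))
         (hadd C (hscal C (w' y - der D y c) (v2 x)) (hscal C (\<tau> x y - der D y (w x - der D x c)) q2))"
    using assms(1) by (simp_all add: jcoord_def t homs_iff)
  have 2: "pr X \<cdot> pr (AO X) \<cdot> \<sigma>' = hscal C d q2"
     "\<And>y. ctr y \<cdot> AF (pr X) \<cdot> \<sigma>' = hadd C (hscal C d (v1 y)) (hscal C (v' y - der D y d) q2)"
     "\<And>x. ctr x \<cdot> pr (AO X) \<cdot> \<sigma>' = hadd C (hscal C d (v2 x)) (hscal C (v x - der D x d) q2)"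
     "\<And>x y. ctr y \<cdot> AF (ctr x) \<cdot> \<sigma>' = hadd C (hadd C (hscal C d (th2c x y)) (hscal C (v x - der D x d) (v1 y)))
         (hadd C (hscal C (v' y - der D y d) (v2 x)) (hscal C (\<rho> x y - der D y (v x - der D x d)) q2))"
    using assms(2) by (simp_all add: jcoord_def t' homs_iff)
  show ?thesis
    unfolding jcoord_def t t' jet11_def ring.simps prod.case
    by (intro conjI allI)
     ((intro hom_eqI[where X = "AO (AO X)" and Y = X])?;
        simp add: homs_iff 1 2 hform_simps der_simps der_diff algebra_simps)+
qed

lemma jcoord_foldr:
  "set ps \<subseteq> carrier (jet1 D) \<times> carrier (jet1 D) \<Longrightarrow>
   jcoord (foldr (\<lambda>(p, q) z. jet_tensor D p q \<oplus>\<^bsub>jet11 D\<^esub> z) ps \<zero>\<^bsub>jet11 D\<^esub>)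
     (foldr (\<lambda>(p, q) z. hadd C (aact (at1 A) (AO X) q \<cdot> AF (aact (at1 A) X p)) z) ps
           (hzero C (AO (AO X)) (AO (AO X))))"
  by (induction ps) (auto simp: jcoord_zero jet1_simps intro!: jcoord_add jcoord_tensor)

text \<open>The coordinates are jointly monic: \<open>joint_mono_AF\<close> reduces to morphisms
  into \<open>At1 X\<close>, and \<open>joint_mono\<close> applies to each of these. The coordinate
  \<open>v2 x\<close> enters through
  \<open>pr X \<cdot> AF (ctr x) = ctr x \<cdot> pr (AO X)\<close>.\<close>

lemma jcoord_unique:
  assumes "jcoord t \<sigma>" "jcoord t \<sigma>'"
  shows "\<sigma> = \<sigma>'"
proof -
  obtain c w w' \<tau> where t: "t = (c, w, w', \<tau>)" by (cases t)
  have [simp]: "\<sigma> \<in> arr C" "src C \<sigma> = AO (AO X)" "tgt C \<sigma> = AO (AO X)"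
    "\<sigma>' \<in> arr C" "src C \<sigma>' = AO (AO X)" "tgt C \<sigma>' = AO (AO X)"
    using assms by (auto simp: jcoord_def homs_iff split: prod.splits)
  note d = assms[unfolded jcoord_def t prod.case]
  show ?thesis
  proof (rule joint_mono_AF)
    show "AF (pr X) \<cdot> \<sigma> = AF (pr X) \<cdot> \<sigma>'"
    proof (rule joint_mono)
      show "pr X \<cdot> AF (pr X) \<cdot> \<sigma> = pr X \<cdot> AF (pr X) \<cdot> \<sigma>'"
        using d by simp
      show "ctr x \<cdot> AF (pr X) \<cdot> \<sigma> = ctr x \<cdot> AF (pr X) \<cdot> \<sigma>'" for x
        using d by simp
    qed simp_all
    show "AF (ctr x) \<cdot> \<sigma> = AF (ctr x) \<cdot> \<sigma>'" for x
    proof (rule joint_mono)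
      show "pr X \<cdot> AF (ctr x) \<cdot> \<sigma> = pr X \<cdot> AF (ctr x) \<cdot> \<sigma>'"
        using d by simp
      show "ctr y \<cdot> AF (ctr x) \<cdot> \<sigma> = ctr y \<cdot> AF (ctr x) \<cdot> \<sigma>'" for y
        using d by simp
    qed simp_all
  qed simp_all
qed

lemma jcoord_act11:
  assumes "t \<in> carrier (jet11 D)"
  shows "jcoord t (act11 D C (at1 A) X t)"
proof -
  let ?P = "\<lambda>ps. set ps \<subseteq> carrier (jet1 D) \<times> carrier (jet1 D) \<and>
     t = foldr (\<lambda>(p, q) z. jet_tensor D p q \<oplus>\<^bsub>jet11 D\<^esub> z) ps \<zero>\<^bsub>jet11 D\<^esub>"
  have "?P (SOME ps. ?P ps)" using jet11_decomposition[OF assms] by (rule someI_ex)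
  then show ?thesis
    unfolding act11_def Let_def using jcoord_foldr[of "SOME ps. ?P ps"] by simp
qed

lemma act11_om_left: "\<omega> \<in> forms1 D \<Longrightarrow> act11 D C (at1 A) X (0, \<omega>, \<lambda>x. 0, \<lambda>x y. 0) = AF (om X \<omega>)"
proof -
  assume w [simp]: "\<omega> \<in> forms1 D"
  have "jcoord (jet_tensor D (0, \<omega>) (1, \<lambda>x. 0)) (aact (at1 A) (AO X) (1, \<lambda>x. 0) \<cdot> AF (om X \<omega>))"
    by (rule jcoord_tensor) simp_all
  moreover have "jet_tensor D (0, \<omega>) (1, \<lambda>x. 0) = (0, \<omega>, \<lambda>x. 0, \<lambda>x y. 0)"
    by (simp add: jet_tensor_def d0_def)
  moreover have "aact (at1 A) (AO X) (1, \<lambda>x. 0) = idt C (AO (AO X))"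
    using act_rho[of "AO X" 1] by (simp add: d0_def)
  ultimately have "jcoord (0, \<omega>, \<lambda>x. 0, \<lambda>x y. 0) (AF (om X \<omega>))" by simp
  moreover have "(0, \<omega>, \<lambda>x. 0, \<lambda>x y. 0) \<in> carrier (jet11 D)" by (simp add: jet11_def forms11_def)
  ultimately show ?thesis using jcoord_unique jcoord_act11 by blast
qed

lemma act11_om_right: "\<omega> \<in> forms1 D \<Longrightarrow> act11 D C (at1 A) X (0, \<lambda>x. 0, \<omega>, \<lambda>x y. 0) = om (AO X) \<omega>"
proof -
  assume w [simp]: "\<omega> \<in> forms1 D"
  have "jcoord (jet_tensor D (1, \<lambda>x. 0) (0, \<omega>)) (om (AO X) \<omega> \<cdot> AF (aact (at1 A) X (1, \<lambda>x. 0)))"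
    by (rule jcoord_tensor) simp_all
  moreover have "jet_tensor D (1, \<lambda>x. 0) (0, \<omega>) = (0, \<lambda>x. 0, \<omega>, \<lambda>x y. 0)"
    by (simp add: jet_tensor_def d0_def)
  moreover have "aact (at1 A) X (1, \<lambda>x. 0) = idt C (AO X)"
    using act_rho[of X 1] by (simp add: d0_def)
  ultimately have "jcoord (0, \<lambda>x. 0, \<omega>, \<lambda>x y. 0) (om (AO X) \<omega>)" by simp
  moreover have "(0, \<lambda>x. 0, \<omega>, \<lambda>x y. 0) \<in> carrier (jet11 D)" by (simp add: jet11_def forms11_def)
  ultimately show ?thesis using jcoord_unique jcoord_act11 by blast
qed

lemma em_act2: "p \<in> carrier (jet2 D) \<Longrightarrow> em X \<cdot> aact (at2 A) X p = act11 D C (at1 A) X p \<cdot> em X"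
  using em_base_change[OF X] by (simp add: base_change_def)

text \<open>
  By the universal property in (c), \<open>f\<close> extends to \<open>At\<^sup>1 (At\<^sup>1 X)\<close>; this is what bounds
  \<open>At\<^sup>2 X\<close> from above.
\<close>

lemma factor_through_projection:
  assumes f: "f \<in> arr C" "src C f = AO2 X" "tgt C f = X"
    and fact: "\<And>p. p \<in> carrier (jet2 D) \<Longrightarrow> f \<cdot> aact (at2 A) X p = hscal C (fst p) f"
  obtains e where "e \<in> arr C" "src C e = X" "tgt C e = X" "f = e \<cdot> pr X \<cdot> pr (AO X) \<cdot> em X"
proof -
  \<comment> \<open>\<open>X\<close> is made a module over \<open>P1 \<otimes> P1\<close> through
    the augmentation; for this structure \<open>f\<close> is linear over \<open>P2\<close>.\<close>
  let ?a = "\<lambda>r :: ('k, 'd) jt2. hscal C (fst r) (idt C X)"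
  have "module_in C (jet11 D) (rho2 D) X ?a"
    unfolding module_in_def
    by (auto simp: homs_iff jet11_def rho2_def jet_tensor_def rho1_def hform_simps split: prod.splits
      intro!: hom_eqI[where X = X and Y = X] simp: algebra_simps)
  moreover have "f \<in> homs C (AO2 X) X" using f by (simp add: homs_iff)
  moreover have "\<forall>p\<in>carrier (jet2 D). f \<cdot> aact (at2 A) X p = ?a (id p) \<cdot> f" using f fact by simp
  ultimately have "\<exists>!g. g \<in> homs C (AO (AO X)) X \<and> (\<forall>r\<in>carrier (jet11 D). g \<cdot> act11 D C (at1 A) X r = ?a r \<cdot> g) \<and> g \<cdot> em X = f"
    using em_base_change[OF X] unfolding base_change_def by blast
  then obtain g where g: "g \<in> homs C (AO (AO X)) X" "\<And>r. r \<in> carrier (jet11 D) \<Longrightarrow> g \<cdot> act11 D C (at1 A) X r = ?a r \<cdot> g"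
    "g \<cdot> em X = f" by blast
  have [simp]: "g \<in> arr C" "src C g = AO (AO X)" "tgt C g = X" using g(1) by (auto simp: homs_iff)
  \<comment> \<open>One-forms in either tensor factor have augmentation zero, so \<open>g\<close>
    kills their action. With the splittings given by \<open>s\<close>, it follows that
    \<open>g\<close> factors through \<open>AF (pr X)\<close> and further through
    \<open>pr X\<close>.\<close>
  have left: "g \<cdot> AF (om X \<omega>) = hzero C (AO (AO X)) X" if "\<omega> \<in> forms1 D" for \<omega>
    using g(2)[of "(0, \<omega>, \<lambda>x. 0, \<lambda>x y. 0)"] that
    by (simp add: act11_om_left jet11_def forms11_def hscal_zero)
  have right: "g \<cdot> om (AO X) \<omega> = hzero C (AO (AO X)) X" if "\<omega> \<in> forms1 D" for \<omega>
    using g(2)[of "(0, \<lambda>x. 0, \<omega>, \<lambda>x y. 0)"] that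
    by (simp add: act11_om_right jet11_def forms11_def hscal_zero)
  have sum0: "hsum U V (\<lambda>b. hzero C U V) bas = hzero C U V" if "U \<in> obj C" "V \<in> obj C" for U V
    by (rule hom_eqI[where X = U and Y = V]) (use that in \<open>simp_all add: hform_hsum\<close>)
  have "g = g \<cdot> idt C (AO (AO X))" by simp
  also have "\<dots> = g \<cdot> AF s \<cdot> AF (pr X)"
    unfolding AF_decomposition
    by (simp add: cmp_hsum_right reassoc[OF left] sum0)
  finally have g1: "g = g \<cdot> AF s \<cdot> AF (pr X)" .
  have "g \<cdot> AF s = g \<cdot> AF s \<cdot> idt C (AO X)" by simp
  also have "\<dots> = g \<cdot> AF s \<cdot> s \<cdot> pr X"
    unfolding decomposition
    by (simp add: cmp_hsum_right AF_act' reassoc[OF right] sum0)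
  finally have g2: "g \<cdot> AF s = g \<cdot> AF s \<cdot> s \<cdot> pr X" .
  have "g = (g \<cdot> AF s) \<cdot> AF (pr X)" using g1 by simp
  also have "\<dots> = (g \<cdot> AF s \<cdot> s) \<cdot> pr X \<cdot> AF (pr X)" by (subst g2) simp
  finally have "g = (g \<cdot> AF s \<cdot> s) \<cdot> pr X \<cdot> pr (AO X)" by simp
  from arg_cong[OF this, of "\<lambda>h. h \<cdot> em X"]
  have "f = (g \<cdot> AF s \<cdot> s) \<cdot> pr X \<cdot> pr (AO X) \<cdot> em X" by (simp add: g(3))
  then show ?thesis by (intro that[of "g \<cdot> AF s \<cdot> s"]) simp_all
qed

end

section \<open>Curvature\<close>

text \<open>No condition on \<open>t\<close> involves \<open>s\<close>, so one second-order lift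
  serves all connections on \<open>X\<close>. As a section of the projection from
  \<open>At2 X\<close> to \<open>X\<close> it evaluates the factorizations given by
  \<open>factor_through_projection\<close>; the third condition excludes a discrepancy between the
  two projections to \<open>At1 X\<close>.\<close>

locale d_lift = d_connection D C T A X s
  for D :: "('k::field_char_0, 'd::ab_group_add) dfield" and C :: "('o, 'a, 'k) lcat" (structure)
    and T :: "('o, 'a) tensor_data" and A :: "('k, 'd, 'o, 'a) at_data" and X :: 'o and s :: 'a +
  fixes t :: 'a
  assumes t: "t \<in> homs C X (AO2 X)" "pr X \<cdot> pr (AO X) \<cdot> em X \<cdot> t = idt C X"
    "AF (pr X) \<cdot> em X \<cdot> t = pr (AO X) \<cdot> em X \<cdot> t"
begin

lemma t_typ [simp]: "t \<in> arr C" "src C t = X" "tgt C t = AO2 X"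
  using t(1) by (auto simp: homs_iff)

lemma jcoord_em:
  assumes p: "(c, w, w, \<tau>) \<in> carrier (jet2 D)" and g: "g \<in> arr C" "tgt C g = AO2 X"
  shows "pr X \<cdot> pr (AO X) \<cdot> em X \<cdot> aact (at2 A) X (c, w, w, \<tau>) \<cdot> g = hscal C c (pr X \<cdot> pr (AO X) \<cdot> em X \<cdot> g)"
    "ctr y \<cdot> AF (pr X) \<cdot> em X \<cdot> aact (at2 A) X (c, w, w, \<tau>) \<cdot> g =
      hadd C (hscal C c (ctr y \<cdot> AF (pr X) \<cdot> em X \<cdot> g)) (hscal C (w y - der D y c) (pr X \<cdot> pr (AO X) \<cdot> em X \<cdot> g))"
    "ctr x \<cdot> pr (AO X) \<cdot> em X \<cdot> aact (at2 A) X (c, w, w, \<tau>) \<cdot> g =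
      hadd C (hscal C c (ctr x \<cdot> pr (AO X) \<cdot> em X \<cdot> g)) (hscal C (w x - der D x c) (pr X \<cdot> pr (AO X) \<cdot> em X \<cdot> g))"
    "ctr y \<cdot> AF (ctr x) \<cdot> em X \<cdot> aact (at2 A) X (c, w, w, \<tau>) \<cdot> g =
      hadd C (hadd C (hscal C c (ctr y \<cdot> AF (ctr x) \<cdot> em X \<cdot> g)) (hscal C (w x - der D x c) (ctr y \<cdot> AF (pr X) \<cdot> em X \<cdot> g)))
         (hadd C (hscal C (w y - der D y c) (ctr x \<cdot> pr (AO X) \<cdot> em X \<cdot> g))
           (hscal C (\<tau> x y - der D y (w x - der D x c)) (pr X \<cdot> pr (AO X) \<cdot> em X \<cdot> g)))"
proof -
  let ?p = "(c, w, w, \<tau>)" and ?a = "act11 D C (at1 A) X (c, w, w, \<tau>)"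
  have p': "?p \<in> carrier (jet11 D)" using p by (auto simp: jet2_def jet11_def)
  note j = jcoord_act11[OF p', unfolded jcoord_def prod.case]
  have [simp]: "?a \<in> arr C" "src C ?a = AO (AO X)" "tgt C ?a = AO (AO X)"
    using j by (auto simp: homs_iff)
  have em: "em X \<cdot> aact (at2 A) X ?p \<cdot> g = ?a \<cdot> em X \<cdot> g"
    using p g by (subst reassoc[OF em_act2[OF p]]) simp_all
  have e: "u \<cdot> v \<cdot> em X \<cdot> aact (at2 A) X ?p \<cdot> g = ((u \<cdot> v) \<cdot> ?a) \<cdot> em X \<cdot> g"
    if "u \<in> arr C" "v \<in> arr C" "src C u = tgt C v" "src C v = AO (AO X)" for u v
    unfolding em using that g by simp
  show "pr X \<cdot> pr (AO X) \<cdot> em X \<cdot> aact (at2 A) X ?p \<cdot> g = hscal C c (pr X \<cdot> pr (AO X) \<cdot> em X \<cdot> g)"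
    using g j by (subst e) simp_all
  show "ctr y \<cdot> AF (pr X) \<cdot> em X \<cdot> aact (at2 A) X ?p \<cdot> g =
      hadd C (hscal C c (ctr y \<cdot> AF (pr X) \<cdot> em X \<cdot> g)) (hscal C (w y - der D y c) (pr X \<cdot> pr (AO X) \<cdot> em X \<cdot> g))" for y
    using g j by (subst e) simp_all
  show "ctr x \<cdot> pr (AO X) \<cdot> em X \<cdot> aact (at2 A) X ?p \<cdot> g =
      hadd C (hscal C c (ctr x \<cdot> pr (AO X) \<cdot> em X \<cdot> g)) (hscal C (w x - der D x c) (pr X \<cdot> pr (AO X) \<cdot> em X \<cdot> g))" for x
    using g j by (subst e) simp_all
  show "ctr y \<cdot> AF (ctr x) \<cdot> em X \<cdot> aact (at2 A) X (c, w, w, \<tau>) \<cdot> g =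
      hadd C (hadd C (hscal C c (ctr y \<cdot> AF (ctr x) \<cdot> em X \<cdot> g)) (hscal C (w x - der D x c) (ctr y \<cdot> AF (pr X) \<cdot> em X \<cdot> g)))
         (hadd C (hscal C (w y - der D y c) (ctr x \<cdot> pr (AO X) \<cdot> em X \<cdot> g))
           (hscal C (\<tau> x y - der D y (w x - der D x c)) (pr X \<cdot> pr (AO X) \<cdot> em X \<cdot> g)))" for x y
    using g j by (subst e) simp_all
qed

lemma jet2_cases:
  assumes "p \<in> carrier (jet2 D)"
  obtains c w \<tau> where "p = (c, w, w, \<tau>)" "w \<in> forms1 D" "\<tau> \<in> forms11 D"
    "\<And>x y. \<tau> x y - \<tau> y x = - d1 D w x y"
  using assms by (auto simp: jet2_def)

text \<open>Contracted with \<open>x\<close>, the difference of the two projections is a morphism on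
  which \<open>P2\<close> acts through the augmentation, because the two one-form components of an
  element of \<open>P2\<close> coincide. So it is \<open>e\<close> after the projection to
  \<open>X\<close>, and \<open>e = 0\<close> since the difference vanishes on
  \<open>t\<close>.\<close>

lemma projections_agree: "AF (pr X) \<cdot> em X = pr (AO X) \<cdot> em X"
proof (rule joint_mono)
  show "ctr x \<cdot> AF (pr X) \<cdot> em X = ctr x \<cdot> pr (AO X) \<cdot> em X" for x
  proof -
    let ?f = "hsub (ctr x \<cdot> AF (pr X) \<cdot> em X) (ctr x \<cdot> pr (AO X) \<cdot> em X)"
    have fact: "?f \<cdot> aact (at2 A) X p = hscal C (fst p) ?f" if p: "p \<in> carrier (jet2 D)" for p
    proof (cases rule: jet2_cases[OF p])
      case (1 c w \<tau>)
      have [simp]: "(c, w, w, \<tau>) \<in> carrier (jet2 D)" using p by (simp add: 1(1))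
      note j = jcoord_em[OF p[unfolded 1(1)], of "idt C (AO2 X)", simplified]
      show ?thesis unfolding 1(1) fst_conv
        by (rule hom_eqI[where X = "AO2 X" and Y = X])
          (simp_all add: j hform_simps hform_hsub algebra_simps)
    qed
    obtain e where e: "e \<in> arr C" "src C e = X" "tgt C e = X" "?f = e \<cdot> pr X \<cdot> pr (AO X) \<cdot> em X"
      by (rule factor_through_projection[OF _ _ _ fact]) simp_all
    have "?f \<cdot> t = e"
      unfolding e(4) using e(1-3) t(2) by simp
    moreover have "?f \<cdot> t = hzero C X X"
      by (rule hom_eqI[where X = X and Y = X]) (simp_all add: t(3) hform_simps hform_hsub)
    ultimately have "e = hzero C X X" by simp
    then have "?f = hzero C (AO2 X) X" unfolding e(4) by simp
    then show ?thesis by (rule hsub_eq_zeroD) simp_all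
  qed
qed simp_all

lemma projections_agree' [simp]: 
  "g \<in> arr C \<Longrightarrow> tgt C g = AO2 X \<Longrightarrow> AF (pr X) \<cdot> em X \<cdot> g = pr (AO X) \<cdot> em X \<cdot> g"
  by (subst reassoc[OF projections_agree]) simp_all

text \<open>
  The last term makes \<open>curv_em\<close> independent of \<open>g\<close>: on \<open>(b, \<omega>, \<omega>, \<tau>)\<close> in \<open>P\<^sup>2\<close>, antisymmetrization
  of \<open>\<tau>\<close> gives \<open>- d\<omega>\<close>.
\<close>

definition curv :: "'d \<Rightarrow> 'd \<Rightarrow> 'a" where
  "curv x y = hsub (hsub (ctr y \<cdot> AF (ctr x) \<cdot> em X \<cdot> t) (ctr x \<cdot> AF (ctr y) \<cdot> em X \<cdot> t))
     (ctr (lie D x y) \<cdot> pr (AO X) \<cdot> em X \<cdot> t)"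

lemma curv_typ [simp]: "curv x y \<in> arr C" "src C (curv x y) = X" "tgt C (curv x y) = X"
  by (simp_all add: curv_def)

text \<open>Without \<open>g\<close>, the right-hand side is a morphism from \<open>At2 X\<close> to
  \<open>X\<close>. On it \<open>P2\<close> acts through the augmentation: the first-order terms
  cancel by \<open>projections_agree\<close>, and the antisymmetrized bilinear part
  \<open>- d w\<close> cancels the derivatives of \<open>w\<close> and the term with the bracket.
  Hence it is \<open>e\<close> after the projection to \<open>X\<close>, and evaluation on
  \<open>t\<close> shows \<open>e = curv x y\<close>.\<close>

lemma curv_em:
  assumes g: "g \<in> arr C" "tgt C g = AO2 X"
  shows "curv x y \<cdot> pr X \<cdot> pr (AO X) \<cdot> em X \<cdot> g =
    hsub (hsub (ctr y \<cdot> AF (ctr x) \<cdot> em X \<cdot> g) (ctr x \<cdot> AF (ctr y) \<cdot> em X \<cdot> g))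
     (ctr (lie D x y) \<cdot> pr (AO X) \<cdot> em X \<cdot> g)"
proof -
  let ?f = "hsub (hsub (ctr y \<cdot> AF (ctr x) \<cdot> em X) (ctr x \<cdot> AF (ctr y) \<cdot> em X))
     (ctr (lie D x y) \<cdot> pr (AO X) \<cdot> em X)"
  have fact: "?f \<cdot> aact (at2 A) X p = hscal C (fst p) ?f" if p: "p \<in> carrier (jet2 D)" for p
  proof (cases rule: jet2_cases[OF p])
    case (1 c w \<tau>)
    have [simp]: "(c, w, w, \<tau>) \<in> carrier (jet2 D)" using p by (simp add: 1(1))
    note j = jcoord_em[OF p[unfolded 1(1)], of "idt C (AO2 X)", simplified]
    have \<tau>: "\<tau> x y = \<tau> y x - d1 D w x y" for x y using 1(4)[of x y] by (simp add: algebra_simps)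
    show ?thesis unfolding 1(1) fst_conv
      by (rule hom_eqI[where X = "AO2 X" and Y = X])
        (simp_all add: j hform_simps hform_hsub projections_agree \<tau>[of x y] d1_def der_diff der_simps algebra_simps)
  qed
  obtain e where e: "e \<in> arr C" "src C e = X" "tgt C e = X" "?f = e \<cdot> pr X \<cdot> pr (AO X) \<cdot> em X"
    by (rule factor_through_projection[OF _ _ _ fact]) simp_all
  have "?f \<cdot> t = e" unfolding e(4) using e(1-3) t(2) by simp
  moreover have "?f \<cdot> t = curv x y" by (simp add: curv_def)
  ultimately have ec: "e = curv x y" by simp
  have "?f \<cdot> g = curv x y \<cdot> pr X \<cdot> pr (AO X) \<cdot> em X \<cdot> g" unfolding e(4) ec using g by simp
  then show ?thesis using g by simp
qed

lemma ctr_AF':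
  "f \<in> arr C \<Longrightarrow> src C f = X \<Longrightarrow> tgt C f = X \<Longrightarrow> g \<in> arr C \<Longrightarrow> tgt C g = AO X \<Longrightarrow>
    ctr x \<cdot> AF f \<cdot> g = hsub (f \<cdot> ctr x \<cdot> g) (nab x f \<cdot> pr X \<cdot> g)"
  by (subst reassoc[OF ctr_AF]) simp_all

text \<open>\<open>curv_em\<close> is evaluated at \<open>AF2 f \<cdot> t\<close>. By naturality of
  the embedding this inserts \<open>AF (AF f)\<close> in front of \<open>em X \<cdot> t\<close>, and
  moving \<open>f\<close> out past the contractions creates the derivatives. With these signs
  \<open>- curv\<close> is the usual curvature, acting on \<open>End X\<close> by
  commutators.\<close>

lemma commutator:
  assumes f: "f \<in> arr C" "src C f = X" "tgt C f = X"
  shows "hsub (hsub (nab x (nab y f)) (nab y (nab x f))) (nab (lie D x y) f) = hsub (f \<cdot> curv x y) (curv x y \<cdot> f)"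
proof -
  have nat: "em X \<cdot> AF2 f \<cdot> t = AF (AF f) \<cdot> em X \<cdot> t"
    using f reassoc[OF em_AF2[OF f(1) f(3)]] by simp
  have ex: "AF (ctr x) \<cdot> AF (AF f) \<cdot> em X \<cdot> t = hsub (AF f \<cdot> AF (ctr x) \<cdot> em X \<cdot> t) (AF (nab x f) \<cdot> AF (pr X) \<cdot> em X \<cdot> t)" for x
  proof -
    have "AF (ctr x) \<cdot> AF (AF f) \<cdot> em X \<cdot> t = AF (ctr x \<cdot> AF f) \<cdot> em X \<cdot> t" using f by simp
    also have "\<dots> = hsub (AF f \<cdot> AF (ctr x) \<cdot> em X \<cdot> t) (AF (nab x f) \<cdot> AF (pr X) \<cdot> em X \<cdot> t)"
      using f by (simp add: ctr_AF)
    finally show ?thesis .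
  qed
  have q: "pr X \<cdot> pr (AO X) \<cdot> AF (AF f) \<cdot> em X \<cdot> t = f"
    using f t(2) by simp
  have pa: "pr (AO X) \<cdot> AF (AF f) \<cdot> em X \<cdot> t = AF f \<cdot> pr (AO X) \<cdot> em X \<cdot> t" using f by simp
  have "curv x y \<cdot> f = curv x y \<cdot> pr X \<cdot> pr (AO X) \<cdot> em X \<cdot> AF2 f \<cdot> t"
    using f by (simp only: nat q)
  also have "\<dots> = hsub (hsub (ctr y \<cdot> AF (ctr x) \<cdot> AF (AF f) \<cdot> em X \<cdot> t) (ctr x \<cdot> AF (ctr y) \<cdot> AF (AF f) \<cdot> em X \<cdot> t))
     (ctr (lie D x y) \<cdot> pr (AO X) \<cdot> AF (AF f) \<cdot> em X \<cdot> t)"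
    using f by (subst curv_em) (simp_all only: nat, simp_all)
  finally have c: "curv x y \<cdot> f = hsub (hsub (ctr y \<cdot> AF (ctr x) \<cdot> AF (AF f) \<cdot> em X \<cdot> t) (ctr x \<cdot> AF (ctr y) \<cdot> AF (AF f) \<cdot> em X \<cdot> t))
     (ctr (lie D x y) \<cdot> pr (AO X) \<cdot> AF (AF f) \<cdot> em X \<cdot> t)" .
  define u where "u = pr (AO X) \<cdot> em X \<cdot> t"
  define w where "w x = AF (ctr x) \<cdot> em X \<cdot> t" for x
  have [simp]: "u \<in> arr C" "src C u = X" "tgt C u = AO X" "pr X \<cdot> u = idt C X"
    using t(2) by (simp_all add: u_def)
  have [simp]: "w x \<in> arr C" "src C (w x) = X" "tgt C (w x) = AO X" "pr X \<cdot> w x = ctr x \<cdot> u" for x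
    by (simp_all add: w_def u_def)
  have [simp]: "nab x f \<in> arr C" "src C (nab x f) = X" "tgt C (nab x f) = X" for x using f by simp_all
  have e1: "ctr y \<cdot> AF (ctr x) \<cdot> AF (AF f) \<cdot> em X \<cdot> t = hsub (hsub (f \<cdot> ctr y \<cdot> w x) (nab y f \<cdot> ctr x \<cdot> u))
      (hsub (nab x f \<cdot> ctr y \<cdot> u) (nab y (nab x f)))" for x y
    unfolding ex w_def[symmetric] using f by (simp add: u_def[symmetric] ctr_AF')
  have e2: "ctr z \<cdot> pr (AO X) \<cdot> AF (AF f) \<cdot> em X \<cdot> t = hsub (f \<cdot> ctr z \<cdot> u) (nab z f)" for z
    unfolding pa u_def[symmetric] using f by (simp add: ctr_AF')
  have cv: "curv x y = hsub (hsub (ctr y \<cdot> w x) (ctr x \<cdot> w y)) (ctr (lie D x y) \<cdot> u)"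
    by (simp add: curv_def w_def u_def)
  show ?thesis
    unfolding c e1 e2 unfolding cv
    by (rule hom_eqI'[where X = X and Y = X]) (simp_all add: f homs_simps nab_homs homs_iff[of f] hform_homs algebra_simps)
qed

text \<open>The factorization \<open>u\<close> of \<open>AF s \<cdot> s\<close> through
  \<open>At2 X\<close> also splits the projection to \<open>X\<close>, and all its contractions
  vanish because \<open>ctr x \<cdot> s\<close> does. Evaluation of \<open>curv_em\<close> at
  \<open>u\<close> thus gives zero, whatever the lift \<open>t\<close> is.\<close>

lemma curv_D_structure:
  assumes "D_structure C A X s"
  shows "curv x y = hzero C X X"
proof -
  obtain u where u: "u \<in> homs C X (AO2 X)" "em X \<cdot> u = AF s \<cdot> s"
    using assms by (auto simp: D_structure_def)
  have [simp]: "u \<in> arr C" "src C u = X" "tgt C u = AO2 X" using u(1) by (auto simp: homs_iff)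
  have z: "AF (ctr x) \<cdot> AF s \<cdot> s = hzero C X (AO X)" for x
  proof -
    have "AF (ctr x) \<cdot> AF s \<cdot> s = AF (ctr x \<cdot> s) \<cdot> s" by (subst AF_cmp) simp_all
    then show ?thesis by simp
  qed
  have "curv x y = curv x y \<cdot> pr X \<cdot> pr (AO X) \<cdot> em X \<cdot> u" by (simp add: u(2))
  also have "\<dots> = hzero C X X"
    by (subst curv_em) (simp_all add: u(2) z)
  finally show ?thesis .
qed

text \<open>The difference of the two connections is the \<open>End X\<close>-valued one-form
  \<open>B x = ctr x \<cdot> s'\<close>. In terms of \<open>F = - curv\<close> these are the
  classical formulas: \<open>\<nabla>\<close> changes by the commutator with \<open>B x\<close>, and
  \<open>F x y\<close> changes by \<open>(d B) x y + [B x, B y]\<close>.\<close>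

lemma gauge:
  assumes "D_connection C A X s'"
  shows "d_connection.ctr D C A X s' x = hsub (ctr x) ((ctr x \<cdot> s') \<cdot> pr X)"
    "f \<in> arr C \<Longrightarrow> src C f = X \<Longrightarrow> tgt C f = X \<Longrightarrow>
      d_connection.nab D C A X s' x f = hadd C (nab x f) (hsub ((ctr x \<cdot> s') \<cdot> f) (f \<cdot> ctr x \<cdot> s'))"
    "d_lift.curv D C A X s' t x y = hsub (curv x y) (hadd C
       (hsub (hsub (nab x (ctr y \<cdot> s')) (nab y (ctr x \<cdot> s'))) (ctr (lie D x y) \<cdot> s'))
       (hsub ((ctr x \<cdot> s') \<cdot> (ctr y \<cdot> s')) ((ctr y \<cdot> s') \<cdot> (ctr x \<cdot> s'))))"
proof -
  interpret S: d_lift D C T A X s' t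
    by unfold_locales (use assms t in auto)
  have ctr: "S.ctr x = hsub (ctr x) ((ctr x \<cdot> s') \<cdot> pr X)" for x
    by (rule S.ctr_unique[symmetric]) (simp add: S.is_ctr_def homs_iff hscal_zero)
  show "S.ctr x = hsub (ctr x) ((ctr x \<cdot> s') \<cdot> pr X)" by (rule ctr)
  show "S.nab x f = hadd C (nab x f) (hsub ((ctr x \<cdot> s') \<cdot> f) (f \<cdot> ctr x \<cdot> s'))"
    if "f \<in> arr C" "src C f = X" "tgt C f = X"
    unfolding S.nab_def ctr using that
    by (intro hom_eqI[where X = X and Y = X])
      (simp_all add: ctr_AF' hform_simps hform_hsub algebra_simps)
  show "S.curv x y = hsub (curv x y) (hadd C
       (hsub (hsub (nab x (ctr y \<cdot> s')) (nab y (ctr x \<cdot> s'))) (ctr (lie D x y) \<cdot> s'))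
       (hsub ((ctr x \<cdot> s') \<cdot> (ctr y \<cdot> s')) ((ctr y \<cdot> s') \<cdot> (ctr x \<cdot> s'))))"
  proof -
    define B where "B z = ctr z \<cdot> s'" for z
    have [simp]: "B z \<in> arr C" "src C (B z) = X" "tgt C (B z) = X" for z by (simp_all add: B_def)
    have cB: "S.ctr z = hsub (ctr z) (B z \<cdot> pr X)" for z by (simp add: ctr B_def)
    have "S.curv x y = hsub (curv x y) (hadd C
       (hsub (hsub (nab x (B y)) (nab y (B x))) (B (lie D x y)))
       (hsub (B x \<cdot> B y) (B y \<cdot> B x)))"
    proof -
      define u where "u = pr (AO X) \<cdot> em X \<cdot> t"
      define w where "w x = AF (ctr x) \<cdot> em X \<cdot> t" for x
      have [simp]: "u \<in> arr C" "src C u = X" "tgt C u = AO X" "pr X \<cdot> u = idt C X"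
        using t(2) by (simp_all add: u_def)
      have [simp]: "w x \<in> arr C" "src C (w x) = X" "tgt C (w x) = AO X" "pr X \<cdot> w x = ctr x \<cdot> u" for x
        by (simp_all add: w_def u_def)
      have e0: "AF (S.ctr x) \<cdot> em X \<cdot> t = hsub (w x) (AF (B x) \<cdot> u)" for x
        unfolding cB by (simp add: w_def u_def)
      have e1: "S.ctr y \<cdot> AF (S.ctr x) \<cdot> em X \<cdot> t = hsub (hsub (ctr y \<cdot> w x) (hsub (B x \<cdot> ctr y \<cdot> u) (nab y (B x))))
         (hsub (B y \<cdot> ctr x \<cdot> u) (B y \<cdot> B x))" for x y
        unfolding e0 unfolding cB
        by (rule hom_eqI[where X = X and Y = X]) (simp_all add: ctr_AF' hform_hsub)
      have e2: "S.ctr z \<cdot> pr (AO X) \<cdot> em X \<cdot> t = hsub (ctr z \<cdot> u) (B z)" for z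
        unfolding cB u_def[symmetric] by simp
      have cv: "curv x y = hsub (hsub (ctr y \<cdot> w x) (ctr x \<cdot> w y)) (ctr (lie D x y) \<cdot> u)"
        by (simp add: curv_def w_def u_def)
      show ?thesis
        unfolding S.curv_def e1 e2 cv
        by (rule hom_eqI'[where X = X and Y = X]) (simp_all add: homs_simps nab_homs homs_iff[of "B _"] hform_homs algebra_simps)
    qed
    then show ?thesis by (simp add: B_def)
  qed
qed

text \<open>The lift \<open>t\<close> is corrected inside \<open>At2 X\<close> until it maps to
  \<open>AF s \<cdot> s\<close>, whose only nonzero coordinate is the one under the projection to
  \<open>X\<close>. Elements of \<open>P2\<close> over the one-forms \<open>dual b\<close> remove
  the first-order coordinates. By flatness the remaining second-order coordinate
  \<open>S x y\<close> is symmetric, so it is removed by elements of the symmetric square of the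
  one-forms.\<close>

lemma D_structureI:
  assumes flat: "\<And>x y. curv x y = hzero C X X"
  shows "D_structure C A X s"
proof -
  define V where "V x = ctr x \<cdot> pr (AO X) \<cdot> em X \<cdot> t" for x
  have V [simp]: "V x \<in> arr C" "src C (V x) = X" "tgt C (V x) = X" for x by (simp_all add: V_def)
  have V_form: "(\<lambda>x. p (V x)) \<in> forms1 D" if p: "hform X X p" for p
    unfolding forms1_def V_def by (simp add: ctr_add ctr_scl hform_simps[OF p])
  define P where "P b = (0::'k, dual b, dual b, \<lambda>x y. (- 1 / 2) * d1 D (dual b) x y)" for b
  have P: "P b \<in> carrier (jet2 D)" for b unfolding P_def by (rule half_closed_form) simp
  define t1 where "t1 = hsub t (hsum X (AO2 X) (\<lambda>b. aact (at2 A) X (P b) \<cdot> t \<cdot> V b) bas)"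
  have t1 [simp]: "t1 \<in> arr C" "src C t1 = X" "tgt C t1 = AO2 X" by (simp_all add: t1_def P)
  have u_t1: "u \<cdot> t1 = hsub (u \<cdot> t) (hsum X (tgt C u) (\<lambda>b. u \<cdot> aact (at2 A) X (P b) \<cdot> t \<cdot> V b) bas)"
    if "u \<in> arr C" "src C u = AO2 X" for u
    using that by (simp add: t1_def P cmp_hsum_right)
  have q1: "pr X \<cdot> pr (AO X) \<cdot> em X \<cdot> t1 = idt C X"
  proof (rule hom_eqI[where X = X and Y = X])
    fix p assume p: "hform X X p"
    show "p (pr X \<cdot> pr (AO X) \<cdot> em X \<cdot> t1) = p (idt C X)"
      using u_t1[of "pr X \<cdot> pr (AO X) \<cdot> em X"] P t(2)
      by (simp add: hform_hsub[OF p] hform_hsum[OF p] jcoord_em(1)[OF P[unfolded P_def], folded P_def] hscal_zero p)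
  qed simp_all
  have v_t1: "ctr y \<cdot> pr (AO X) \<cdot> em X \<cdot> t1 = hzero C X X" for y
  proof (rule hom_eqI[where X = X and Y = X])
    fix p assume p: "hform X X p"
    have j: "ctr y \<cdot> pr (AO X) \<cdot> em X \<cdot> aact (at2 A) X (P b) \<cdot> t \<cdot> V b = hscal C (dual b y) (V b)" for b
      unfolding P_def using reassoc[OF t(2), of "V b"]
      by (subst jcoord_em(3)[OF P[unfolded P_def]]) (simp_all add: hscal_zero)
    have "p (ctr y \<cdot> pr (AO X) \<cdot> em X \<cdot> t1) = p (V y) - (\<Sum>b\<in>bas. dual b y * p (V b))"
      using u_t1[of "ctr y \<cdot> pr (AO X) \<cdot> em X"] P
      by (simp add: j hform_hsub[OF p] hform_hsum[OF p] hform_hscal[OF p] V_def[symmetric])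
    then show "p (ctr y \<cdot> pr (AO X) \<cdot> em X \<cdot> t1) = p (hzero C X X)"
      using dual_sum[OF V_form[OF p], of y] p by simp
  qed simp_all
  define S where "S x y = ctr y \<cdot> AF (ctr x) \<cdot> em X \<cdot> t1" for x y
  have S [simp]: "S x y \<in> arr C" "src C (S x y) = X" "tgt C (S x y) = X" for x y by (simp_all add: S_def)
  have S_sym: "S x y = S y x" for x y
  proof -
    have "hsub (S x y) (S y x) = hzero C X X"
      using curv_em[of t1 x y] by (simp add: flat q1 v_t1 S_def)
    then show ?thesis by (rule hsub_eq_zeroD) simp_all
  qed
  have S_form: "(\<lambda>y. p (S x y)) \<in> forms1 D" if p: "hform X X p" for p x
    unfolding forms1_def S_def by (simp add: ctr_add ctr_scl hform_simps[OF p])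
  have S_form': "(\<lambda>x. p (S x y)) \<in> forms1 D" if p: "hform X X p" for p y
    using S_form[OF p, of y] by (simp add: S_sym[of _ y])
  \<comment> \<open>The factor 1/2 compensates for the sum over ordered pairs: as \<open>S\<close>
    is symmetric, both products contribute the same total.\<close>
  define Q where "Q bc = (0::'k, \<lambda>x::'d. 0::'k, \<lambda>x::'d. 0::'k,
     \<lambda>x y. (1 / 2) * (dual (fst bc) x * dual (snd bc) y + dual (snd bc) x * dual (fst bc) y))" for bc
  have Q: "Q bc \<in> carrier (jet2 D)" for bc unfolding Q_def by (rule symmetric_form) simp_all
  define t2 where "t2 = hsub t1 (hsum X (AO2 X) (\<lambda>bc. aact (at2 A) X (Q bc) \<cdot> t1 \<cdot> S (fst bc) (snd bc)) (bas \<times> bas))"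
  have t2 [simp]: "t2 \<in> arr C" "src C t2 = X" "tgt C t2 = AO2 X" by (simp_all add: t2_def Q)
  have u_t2: "u \<cdot> t2 = hsub (u \<cdot> t1) (hsum X (tgt C u) (\<lambda>bc. u \<cdot> aact (at2 A) X (Q bc) \<cdot> t1 \<cdot> S (fst bc) (snd bc)) (bas \<times> bas))"
    if "u \<in> arr C" "src C u = AO2 X" for u
    using that by (simp add: t2_def Q cmp_hsum_right)
  note jQ = jcoord_em[OF Q[unfolded Q_def], folded Q_def]
  have q2: "pr X \<cdot> pr (AO X) \<cdot> em X \<cdot> t2 = idt C X"
  proof (rule hom_eqI[where X = X and Y = X])
    fix p assume p: "hform X X p"
    show "p (pr X \<cdot> pr (AO X) \<cdot> em X \<cdot> t2) = p (idt C X)"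
      using u_t2[of "pr X \<cdot> pr (AO X) \<cdot> em X"] Q q1
      by (simp add: hform_hsub[OF p] hform_hsum[OF p] jQ(1) hscal_zero p)
  qed simp_all
  have v_t2: "ctr y \<cdot> pr (AO X) \<cdot> em X \<cdot> t2 = hzero C X X" for y
  proof (rule hom_eqI[where X = X and Y = X])
    fix p assume p: "hform X X p"
    show "p (ctr y \<cdot> pr (AO X) \<cdot> em X \<cdot> t2) = p (hzero C X X)"
      using u_t2[of "ctr y \<cdot> pr (AO X) \<cdot> em X"] Q v_t1
      by (simp add: hform_hsub[OF p] hform_hsum[OF p] jQ(3) hscal_zero p)
  qed simp_all
  have S_t2: "ctr y \<cdot> AF (ctr x) \<cdot> em X \<cdot> t2 = hzero C X X" for x y
  proof (rule hom_eqI[where X = X and Y = X])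
    fix p assume p: "hform X X p"
    have j: "ctr y \<cdot> AF (ctr x) \<cdot> em X \<cdot> aact (at2 A) X (Q bc) \<cdot> t1 \<cdot> S (fst bc) (snd bc) =
       hscal C ((1 / 2) * (dual (fst bc) x * dual (snd bc) y + dual (snd bc) x * dual (fst bc) y)) (S (fst bc) (snd bc))" for bc
      using reassoc[OF q1, of "S (fst bc) (snd bc)"]
      by (subst jQ(4)) (simp_all add: hscal_zero)
    have a: "(\<Sum>c\<in>bas. dual c y * p (S b c)) = p (S b y)" for b
      by (rule dual_sum[OF S_form[OF p]])
    have a': "(\<Sum>b\<in>bas. dual b x * p (S b y)) = p (S x y)"
      by (rule dual_sum[OF S_form'[OF p]])
    have 1: "(\<Sum>b\<in>bas. \<Sum>c\<in>bas. dual b x * dual c y * p (S b c)) = p (S x y)"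
      unfolding mult.assoc sum_distrib_left[symmetric] a a' ..
    have "(\<Sum>b\<in>bas. \<Sum>c\<in>bas. dual c x * dual b y * p (S b c)) = (\<Sum>c\<in>bas. \<Sum>b\<in>bas. dual c x * dual b y * p (S c b))"
      by (subst sum.swap) (intro sum.cong refl arg_cong2[where f = "(*)"] arg_cong[where f = p] S_sym)
    then have 2: "(\<Sum>b\<in>bas. \<Sum>c\<in>bas. dual c x * dual b y * p (S b c)) = p (S x y)"
      unfolding 1 .
    have "p (ctr y \<cdot> AF (ctr x) \<cdot> em X \<cdot> t2) = p (S x y) -
      (\<Sum>bc\<in>bas \<times> bas. (1 / 2) * (dual (fst bc) x * dual (snd bc) y + dual (snd bc) x * dual (fst bc) y) * p (S (fst bc) (snd bc)))"
      using u_t2[of "ctr y \<cdot> AF (ctr x) \<cdot> em X"] Q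
      by (simp add: j hform_hsub[OF p] hform_hsum[OF p] hform_hscal[OF p] S_def[symmetric])
    also have "(\<Sum>bc\<in>bas \<times> bas. (1 / 2) * (dual (fst bc) x * dual (snd bc) y + dual (snd bc) x * dual (fst bc) y) * p (S (fst bc) (snd bc)))
      = (\<Sum>b\<in>bas. \<Sum>c\<in>bas. (1 / 2) * (dual b x * dual c y * p (S b c)) + (1 / 2) * (dual c x * dual b y * p (S b c)))"
      by (simp add: sum.cartesian_product split_beta algebra_simps)
    also have "\<dots> = (1 / 2) * p (S x y) + (1 / 2) * p (S x y)"
      unfolding sum.distrib sum_distrib_left[symmetric] 1 2 ..
    finally show "p (ctr y \<cdot> AF (ctr x) \<cdot> em X \<cdot> t2) = p (hzero C X X)"
      using p by simp
  qed simp_all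
  have AFs: "AF (ctr x) \<cdot> AF s \<cdot> s = hzero C X (AO X)" "AF (pr X) \<cdot> AF s \<cdot> s = s" for x
  proof -
    have "AF (ctr x) \<cdot> AF s \<cdot> s = AF (ctr x \<cdot> s) \<cdot> s" by (subst AF_cmp) simp_all
    then show "AF (ctr x) \<cdot> AF s \<cdot> s = hzero C X (AO X)" by simp
    have "AF (pr X) \<cdot> AF s \<cdot> s = AF (pr X \<cdot> s) \<cdot> s" by (subst AF_cmp) simp_all
    then show "AF (pr X) \<cdot> AF s \<cdot> s = s" by simp
  qed
  have "em X \<cdot> t2 = AF s \<cdot> s"
  proof (rule joint_mono_AF)
    show "AF (pr X) \<cdot> em X \<cdot> t2 = AF (pr X) \<cdot> AF s \<cdot> s"
      by (rule joint_mono) (simp_all add: AFs v_t2 q2)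
    show "AF (ctr x) \<cdot> em X \<cdot> t2 = AF (ctr x) \<cdot> AF s \<cdot> s" for x
      by (rule joint_mono) (simp_all add: AFs v_t2 S_t2)
  qed simp_all
  then show ?thesis
    unfolding D_structure_def using s by (auto intro!: bexI[of _ t2] simp: homs_iff)
qed

lemma nab_homs_simps:
  "f \<in> homs C X X \<Longrightarrow> g \<in> homs C X X \<Longrightarrow> nab x (hadd C f g) = hadd C (nab x f) (nab x g)"
  "f \<in> homs C X X \<Longrightarrow> g \<in> homs C X X \<Longrightarrow> nab x (hsub f g) = hsub (nab x f) (nab x g)"
  "f \<in> homs C X X \<Longrightarrow> g \<in> homs C X X \<Longrightarrow> nab x (f \<cdot> g) = hadd C (nab x f \<cdot> g) (f \<cdot> nab x g)"
  "nab x (hzero C X X) = hzero C X X"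
  by (simp_all add: homs_iff nab_hadd nab_hsub nab_cmp) (simp add: nab_def)

lemma cmp_homs_simps:
  "f \<in> homs C X X \<Longrightarrow> g \<in> homs C X X \<Longrightarrow> h \<in> homs C X X \<Longrightarrow> hadd C f g \<cdot> h = hadd C (f \<cdot> h) (g \<cdot> h)"
  "f \<in> homs C X X \<Longrightarrow> g \<in> homs C X X \<Longrightarrow> h \<in> homs C X X \<Longrightarrow> h \<cdot> hadd C f g = hadd C (h \<cdot> f) (h \<cdot> g)"
  "f \<in> homs C X X \<Longrightarrow> g \<in> homs C X X \<Longrightarrow> h \<in> homs C X X \<Longrightarrow> hsub f g \<cdot> h = hsub (f \<cdot> h) (g \<cdot> h)"
  "f \<in> homs C X X \<Longrightarrow> g \<in> homs C X X \<Longrightarrow> h \<in> homs C X X \<Longrightarrow> h \<cdot> hsub f g = hsub (h \<cdot> f) (h \<cdot> g)"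
  "f \<in> homs C X X \<Longrightarrow> g \<in> homs C X X \<Longrightarrow> h \<in> homs C X X \<Longrightarrow> (f \<cdot> g) \<cdot> h = f \<cdot> g \<cdot> h"
  "f \<in> homs C X X \<Longrightarrow> g \<in> homs C X X \<Longrightarrow> f \<cdot> g \<in> homs C X X"
  by (simp_all add: homs_iff)

text \<open>Relative to the flat connection \<open>s\<close>, the curvature of \<open>s'\<close> is
  an explicit expression in the one-form \<open>B\<close>, by \<open>gauge\<close>. Expanding both
  sides leaves an identity that needs only two facts: derivatives of \<open>B\<close> commute up to
  the bracket, by \<open>commutator\<close> for the flat \<open>s\<close>, and the bracket satisfies
  the Jacobi identity.\<close>

lemma bianchi:
  assumes s': "D_connection C A X s'" and flat: "\<And>x y. curv x y = hzero C X X"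
  defines "N \<equiv> d_connection.nab D C A X s'" and "K \<equiv> d_lift.curv D C A X s' t"
  shows "hadd C (hadd C (N x (K y z)) (N y (K z x))) (N z (K x y)) =
    hadd C (hadd C (K (lie D x y) z) (K (lie D y z) x)) (K (lie D z x) y)"
proof -
  define B where "B x = ctr x \<cdot> s'" for x
  have s'_typ [simp]: "s' \<in> arr C" "src C s' = X" "tgt C s' = AO X"
    using s' by (auto simp: D_connection_def homs_iff)
  have B: "B x \<in> homs C X X" for x by (simp add: B_def homs_iff)
  have B_add: "B (x + y) = hadd C (B x) (B y)" for x y by (simp add: B_def ctr_add)
  have B0: "B 0 = hzero C X X" using ctr_scl[of 0 0] by (simp add: B_def hscal_zero)
  define R where "R x y = hadd C (hsub (hsub (nab x (B y)) (nab y (B x))) (B (lie D x y)))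
     (hsub (B x \<cdot> B y) (B y \<cdot> B x))" for x y
  have z: "hzero C X X \<in> homs C X X" by (simp add: homs_iff)
  have Bz: "B x \<cdot> hzero C X X = hzero C X X" "hzero C X X \<cdot> B x = hzero C X X" for x
    by (simp_all add: B_def)
  note hs = homs_simps(1-3) cmp_homs_simps nab_homs B z Bz
  have R: "R x y \<in> homs C X X" for x y by (simp only: R_def hs)
  have K: "K x y = hsub (hzero C X X) (R x y)" for x y
    unfolding K_def gauge(3)[OF s'] flat R_def B_def by (simp only: cmp_homs_simps)
  have N: "N x f = hadd C (nab x f) (hsub (B x \<cdot> f) (f \<cdot> B x))" if "f \<in> homs C X X" for x f
    using that gauge(2)[OF s', of f x] by (simp add: N_def B_def homs_iff)
  have comm: "p (nab x (nab y (B z))) = p (nab y (nab x (B z))) + p (nab (lie D x y) (B z))" if p: "hform X X p" for p x y z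
  proof -
    have b: "B z \<in> arr C" "src C (B z) = X" "tgt C (B z) = X" using B[of z] by (auto simp: homs_iff)
    have "hsub (hsub (nab x (nab y (B z))) (nab y (nab x (B z)))) (nab (lie D x y) (B z)) = hzero C X X"
      using commutator[OF b, of x y] b by (simp add: flat)
    then have "p (hsub (hsub (nab x (nab y (B z))) (nab y (nab x (B z)))) (nab (lie D x y) (B z))) = 0"
      using p by simp
    then show ?thesis by (simp add: hform_homs[OF p] hs algebra_simps)
  qed
  have jac: "p (B (lie D (lie D x y) z)) + p (B (lie D (lie D y z) x)) + p (B (lie D (lie D z x) y)) = 0" if p: "hform X X p" for p
  proof -
    have "lie D (lie D x y) z + lie D (lie D y z) x + lie D (lie D z x) y = 0"
    proof -
      have "lie D (lie D x y) z + lie D (lie D y z) x + lie D (lie D z x) y =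
        - lie D z (lie D x y) + - lie D x (lie D y z) + - lie D y (lie D z x)"
        by (intro arg_cong2[where f = "(+)"] lie_swap)
      also have "\<dots> = - (lie D x (lie D y z) + lie D y (lie D z x) + lie D z (lie D x y))"
        by simp
      finally show ?thesis unfolding jacobi by simp
    qed
    then have "p (B (lie D (lie D x y) z + lie D (lie D y z) x + lie D (lie D z x) y)) = 0" using p by (simp add: B0)
    then show ?thesis by (simp add: B_add hform_homs[OF p] hs)
  qed
  show ?thesis
  proof (rule hom_eqI')
    fix p assume p: "hform X X p"
    have NR: "p (N x (K y z)) = - p (nab x (nab y (B z))) + p (nab x (nab z (B y))) + p (nab x (B (lie D y z)))
       - (p (nab x (B y) \<cdot> B z) + p (B y \<cdot> nab x (B z)) - p (nab x (B z) \<cdot> B y) - p (B z \<cdot> nab x (B y)))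
       - p (B x \<cdot> nab y (B z)) + p (B x \<cdot> nab z (B y)) + p (B x \<cdot> B (lie D y z)) - p (B x \<cdot> B y \<cdot> B z) + p (B x \<cdot> B z \<cdot> B y)
       + p (nab y (B z) \<cdot> B x) - p (nab z (B y) \<cdot> B x) - p (B (lie D y z) \<cdot> B x) + p (B y \<cdot> B z \<cdot> B x) - p (B z \<cdot> B y \<cdot> B x)" for x y z
      unfolding K using p by (simp add: N hs R nab_homs_simps hform_homs[OF p]) (simp add: R_def hs nab_homs_simps hform_homs[OF p])
    have KR: "p (K x y) = - p (nab x (B y)) + p (nab y (B x)) + p (B (lie D x y)) - p (B x \<cdot> B y) + p (B y \<cdot> B x)" for x y
      unfolding K using p by (simp add: hs R hform_homs[OF p]) (simp add: R_def hs hform_homs[OF p])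
    have KH: "K x y \<in> homs C X X" "N x (K y z) \<in> homs C X X" for x y z
      by (simp_all add: N K hs R)
    have j3: "p (B (lie D (lie D z x) y)) = - p (B (lie D (lie D x y) z)) - p (B (lie D (lie D y z) x))"
      using jac[OF p] by (simp add: eq_neg_iff_add_eq_0 algebra_simps)
    show "p (hadd C (hadd C (N x (K y z)) (N y (K z x))) (N z (K x y))) =
      p (hadd C (hadd C (K (lie D x y) z) (K (lie D y z) x)) (K (lie D z x) y))"
      by (simp only: hform_homs(1)[OF p] homs_simps(1) KH NR KR comm[OF p, of x y z] comm[OF p, of y z x]
          comm[OF p, of z x y] j3) (simp add: algebra_simps)
  qed (simp_all add: N K hs R)
qed

end

section \<open>Linearly closed fields\<close>

text \<open>
  The definition of linearly closed fields only speaks of modules with carrier in the type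
  \<open>nat \<Rightarrow> 'k\<close>, to which other finite-dimensional modules are transported along an injection.
\<close>

definition transport :: "('k::field, 'v) module \<Rightarrow> ('v \<Rightarrow> 'w) \<Rightarrow> ('k, 'w) module" where
  "transport V \<kappa> = (let g = inv_into (carrier V) \<kappa> in
     \<lparr>carrier = \<kappa> ` carrier V, mult = undefined, one = undefined, zero = \<kappa> \<zero>\<^bsub>V\<^esub>,
      add = (\<lambda>m n. \<kappa> (g m \<oplus>\<^bsub>V\<^esub> g n)), smult = (\<lambda>a m. \<kappa> (a \<odot>\<^bsub>V\<^esub> g m))\<rparr>)"

locale transported =
  fixes V :: "('k::field, 'v) module" and \<kappa> :: "'v \<Rightarrow> 'w"
  assumes V: "module fld V" and inj: "inj_on \<kappa> (carrier V)"
begin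

sublocale V: module fld V by (rule V)

abbreviation "g \<equiv> inv_into (carrier V) \<kappa>"
abbreviation "M \<equiv> transport V \<kappa>"

lemma g [simp]: "v \<in> carrier V \<Longrightarrow> g (\<kappa> v) = v"
  using inj by simp

lemma M_simps [simp]:
  "carrier M = \<kappa> ` carrier V" "zero M = \<kappa> \<zero>\<^bsub>V\<^esub>"
  "v \<in> carrier V \<Longrightarrow> w \<in> carrier V \<Longrightarrow> \<kappa> v \<oplus>\<^bsub>M\<^esub> \<kappa> w = \<kappa> (v \<oplus>\<^bsub>V\<^esub> w)"
  "v \<in> carrier V \<Longrightarrow> a \<odot>\<^bsub>M\<^esub> \<kappa> v = \<kappa> (a \<odot>\<^bsub>V\<^esub> v)"
  by (simp_all add: transport_def Let_def)

lemma smult_V [simp]: "v \<in> carrier V \<Longrightarrow> a \<odot>\<^bsub>V\<^esub> v \<in> carrier V"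
  by (rule V.smult_closed) simp_all

lemma smult_V_simps:
  "v \<in> carrier V \<Longrightarrow> (a + b) \<odot>\<^bsub>V\<^esub> v = a \<odot>\<^bsub>V\<^esub> v \<oplus>\<^bsub>V\<^esub> b \<odot>\<^bsub>V\<^esub> v"
  "v \<in> carrier V \<Longrightarrow> w \<in> carrier V \<Longrightarrow> a \<odot>\<^bsub>V\<^esub> (v \<oplus>\<^bsub>V\<^esub> w) = a \<odot>\<^bsub>V\<^esub> v \<oplus>\<^bsub>V\<^esub> a \<odot>\<^bsub>V\<^esub> w"
  "v \<in> carrier V \<Longrightarrow> (a * b) \<odot>\<^bsub>V\<^esub> v = a \<odot>\<^bsub>V\<^esub> (b \<odot>\<^bsub>V\<^esub> v)"
  "v \<in> carrier V \<Longrightarrow> 1 \<odot>\<^bsub>V\<^esub> v = v"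
  using V.smult_l_distr[of a b v] V.smult_r_distr[of a v w] V.smult_assoc1[of a b v] V.smult_one[of v]
  by simp_all

lemma M_abelian: "abelian_group M"
proof (rule abelian_groupI)
  fix m n assume "m \<in> carrier M" "n \<in> carrier M"
  then show "m \<oplus>\<^bsub>M\<^esub> n \<in> carrier M" by auto
next
  show "\<zero>\<^bsub>M\<^esub> \<in> carrier M" by simp
next
  fix m n l assume "m \<in> carrier M" "n \<in> carrier M" "l \<in> carrier M"
  then show "m \<oplus>\<^bsub>M\<^esub> n \<oplus>\<^bsub>M\<^esub> l = m \<oplus>\<^bsub>M\<^esub> (n \<oplus>\<^bsub>M\<^esub> l)" by (auto simp: V.a_assoc)
next
  fix m n assume "m \<in> carrier M" "n \<in> carrier M"
  then show "m \<oplus>\<^bsub>M\<^esub> n = n \<oplus>\<^bsub>M\<^esub> m" by (auto simp: V.a_comm)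
next
  fix m assume "m \<in> carrier M"
  then show "\<zero>\<^bsub>M\<^esub> \<oplus>\<^bsub>M\<^esub> m = m" by auto
next
  fix m assume "m \<in> carrier M"
  then obtain v where v: "v \<in> carrier V" "m = \<kappa> v" by auto
  then have "\<kappa> (\<ominus>\<^bsub>V\<^esub> v) \<in> carrier M \<and> \<kappa> (\<ominus>\<^bsub>V\<^esub> v) \<oplus>\<^bsub>M\<^esub> m = \<zero>\<^bsub>M\<^esub>" by (simp add: V.l_neg)
  then show "\<exists>n\<in>carrier M. n \<oplus>\<^bsub>M\<^esub> m = \<zero>\<^bsub>M\<^esub>" by blast
qed

lemma M_module: "module fld M"
proof (rule moduleI)
  show "cring (fld :: 'k ring)" using V by (simp add: module_def)
  show "abelian_group M" by (rule M_abelian)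
qed (auto simp: smult_V_simps)

lemma M_minus: "v \<in> carrier V \<Longrightarrow> w \<in> carrier V \<Longrightarrow> \<kappa> v \<ominus>\<^bsub>M\<^esub> \<kappa> w = \<kappa> (v \<ominus>\<^bsub>V\<^esub> w)"
proof -
  interpret M: abelian_group M by (rule M_abelian)
  assume vw: "v \<in> carrier V" "w \<in> carrier V"
  have "\<ominus>\<^bsub>M\<^esub> \<kappa> w = \<kappa> (\<ominus>\<^bsub>V\<^esub> w)"
    by (rule M.minus_equality) (use vw in \<open>auto simp: V.l_neg\<close>)
  then show ?thesis using vw by (simp add: a_minus_def)
qed

lemma M_finsum: "finite A \<Longrightarrow> h \<in> A \<rightarrow> carrier V \<Longrightarrow> (\<Oplus>\<^bsub>M\<^esub>x\<in>A. \<kappa> (h x)) = \<kappa> (\<Oplus>\<^bsub>V\<^esub>x\<in>A. h x)"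
proof -
  interpret M: abelian_group M by (rule M_abelian)
  show "finite A \<Longrightarrow> h \<in> A \<rightarrow> carrier V \<Longrightarrow> (\<Oplus>\<^bsub>M\<^esub>x\<in>A. \<kappa> (h x)) = \<kappa> (\<Oplus>\<^bsub>V\<^esub>x\<in>A. h x)"
    by (induction A rule: finite_induct) (auto simp: M.finsum_insert Pi_def)
qed

lemma M_fin_dim:
  assumes "fin_dim V" shows "fin_dim M"
proof -
  obtain B where B: "finite B" "B \<subseteq> carrier V" "\<And>v. v \<in> carrier V \<Longrightarrow> \<exists>c. v = (\<Oplus>\<^bsub>V\<^esub>b\<in>B. c b \<odot>\<^bsub>V\<^esub> b)"
    using assms by (auto simp: fin_dim_def)
  interpret M: module fld M by (rule M_module)
  have injB: "inj_on \<kappa> B" using B(2) inj by (rule inj_on_subset[rotated])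
  have "\<exists>c. m = (\<Oplus>\<^bsub>M\<^esub>b\<in>\<kappa> ` B. c b \<odot>\<^bsub>M\<^esub> b)" if "m \<in> carrier M" for m
  proof -
    obtain v where v: "v \<in> carrier V" "m = \<kappa> v" using \<open>m \<in> carrier M\<close> by auto
    obtain c where c: "v = (\<Oplus>\<^bsub>V\<^esub>b\<in>B. c b \<odot>\<^bsub>V\<^esub> b)" using B(3)[OF v(1)] by blast
    have "m = (\<Oplus>\<^bsub>M\<^esub>b\<in>B. \<kappa> (c b \<odot>\<^bsub>V\<^esub> b))"
      unfolding v(2) by (subst c, subst M_finsum) (use B in auto)
    also have "\<dots> = (\<Oplus>\<^bsub>M\<^esub>b\<in>B. c (g (\<kappa> b)) \<odot>\<^bsub>M\<^esub> \<kappa> b)"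
      by (rule M.finsum_cong') (use B(2) in \<open>auto simp: subset_iff\<close>)
    also have "\<dots> = (\<Oplus>\<^bsub>M\<^esub>b\<in>\<kappa> ` B. c (g b) \<odot>\<^bsub>M\<^esub> b)"
      by (rule M.add.finprod_reindex[symmetric]) (use B(2) injB in \<open>auto simp: subset_iff\<close>)
    finally show ?thesis by (rule exI[of _ "\<lambda>b. c (g b)"])
  qed
  then show ?thesis unfolding fin_dim_def using B(1,2) by (intro exI[of _ "\<kappa> ` B"]) auto
qed

end

lemma dmodule_transport:
  fixes D :: "('k::field_char_0, 'd::ab_group_add) dfield" and V :: "('k, 'v) module"
  assumes d: "dmodule D S V act" and inj: "inj_on \<kappa> (carrier V)"
  shows "dmodule D S (transport V \<kappa>) (\<lambda>x m. \<kappa> (act x (inv_into (carrier V) \<kappa> m)))"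
proof -
  interpret t: transported V \<kappa> using d inj by (intro transported.intro) (simp_all add: dmodule_def)
  have cl: "act x m \<in> carrier V" if "x \<in> S" "m \<in> carrier V" for x m
    using d that unfolding dmodule_def by blast
  show ?thesis
    using d t.M_module unfolding dmodule_def
    by (auto simp: cl t.M_minus)
qed

text \<open>The coefficients \<open>c v\<close> are merely chosen, so \<open>\<kappa>\<close> need
  not be linear. Injectivity suffices, as the operations are transported along it.\<close>

lemma fin_dim_injection:
  fixes V :: "('k::field, 'v) module"
  assumes V: "module fld V" and "fin_dim V"
  obtains \<kappa> :: "'v \<Rightarrow> nat \<Rightarrow> 'k" where "inj_on \<kappa> (carrier V)"
proof -
  interpret V: module fld V by (rule V)
  obtain B where B: "finite B" "B \<subseteq> carrier V" "\<And>v. v \<in> carrier V \<Longrightarrow> \<exists>c. v = (\<Oplus>\<^bsub>V\<^esub>b\<in>B. c b \<odot>\<^bsub>V\<^esub> b)"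
    using assms by (auto simp: fin_dim_def)
  obtain c where c: "\<And>v. v \<in> carrier V \<Longrightarrow> v = (\<Oplus>\<^bsub>V\<^esub>b\<in>B. c v b \<odot>\<^bsub>V\<^esub> b)"
    using B(3) by metis
  obtain idx :: "'v \<Rightarrow> nat" where idx: "inj_on idx B"
    using finite_imp_inj_to_nat_seg[OF B(1)] by metis
  define \<kappa> where "\<kappa> v = (\<lambda>n. if n \<in> idx ` B then c v (inv_into B idx n) else 0)" for v
  have "inj_on \<kappa> (carrier V)"
  proof (rule inj_onI)
    fix v w assume vw: "v \<in> carrier V" "w \<in> carrier V" "\<kappa> v = \<kappa> w"
    have "c v b = c w b" if "b \<in> B" for b
      using fun_cong[OF vw(3), of "idx b"] that idx by (simp add: \<kappa>_def)
    then have "(\<Oplus>\<^bsub>V\<^esub>b\<in>B. c v b \<odot>\<^bsub>V\<^esub> b) = (\<Oplus>\<^bsub>V\<^esub>b\<in>B. c w b \<odot>\<^bsub>V\<^esub> b)"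
      using B(2) V.smult_closed by (intro V.finsum_cong') auto
    then show "v = w" using c[OF vw(1)] c[OF vw(2)] by simp
  qed
  then show ?thesis by (rule that)
qed

text \<open>A trivial module is spanned by its invariants, so a linear form that is not identically
  zero is nonzero on one of them. For a line the form is the identity; for an extension of
  \<open>k\<close> it is the projection to \<open>k\<close>.\<close>

lemma linearly_closed_invariant:
  fixes D :: "('k::field_char_0, 'd::ab_group_add) dfield" and V :: "('k, 'v) module"
  assumes closed: "linearly_closed D S" and d: "dmodule D S V act" and fd: "fin_dim V"
    and p: "linear_form V p" and v0: "v0 \<in> carrier V" "p v0 \<noteq> 0"
  obtains m where "m \<in> carrier V" "\<And>x. x \<in> S \<Longrightarrow> act x m = \<zero>\<^bsub>V\<^esub>" "p m \<noteq> 0"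
proof -
  have V: "module fld V" using d by (simp add: dmodule_def)
  obtain \<kappa> :: "'v \<Rightarrow> nat \<Rightarrow> 'k" where inj: "inj_on \<kappa> (carrier V)" using fin_dim_injection[OF V fd] .
  interpret t: transported V \<kappa> by (rule transported.intro[OF V inj])
  let ?a = "\<lambda>x m. \<kappa> (act x (t.g m))"
  let ?I = "invariants S t.M ?a" and ?k = "constants D S"
  have dM: "dmodule D S t.M ?a" by (rule dmodule_transport[OF d inj])
  have "trivial_dmodule D S t.M ?a"
    using closed dM t.M_fin_dim[OF fd] unfolding linearly_closed_def by blast
  then have bij: "bij_betw (\<lambda>P. the_elem (lin_ext t.M id ` P)) (carrier (tensor_space ?k id ?I)) (carrier t.M)"
    by (simp add: trivial_dmodule_def is_scalar_extension_def)
  have Ic: "carrier ?I = {m \<in> carrier t.M. \<forall>x\<in>S. ?a x m = \<zero>\<^bsub>t.M\<^esub>}"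
    and Io: "add ?I = add t.M" "smult ?I = smult t.M" by (simp_all add: invariants_def)
  have cl: "act x m \<in> carrier V" if "x \<in> S" "m \<in> carrier V" for x m
    using d that unfolding dmodule_def by blast
  have inv_iff: "\<kappa> v \<in> carrier ?I \<longleftrightarrow> (\<forall>x\<in>S. act x v = \<zero>\<^bsub>V\<^esub>)" if "v \<in> carrier V" for v
    using that inj cl unfolding Ic by (auto simp: inj_on_eq_iff[OF inj])
  have closed_I: "closed_under ?k ?I"
    unfolding closed_under_def
  proof (intro conjI ballI)
    fix m n assume m: "m \<in> carrier ?I" and n: "n \<in> carrier ?I"
    obtain v w where v: "v \<in> carrier V" "m = \<kappa> v" and w: "w \<in> carrier V" "n = \<kappa> w" using m n unfolding Ic by auto
    have "\<kappa> (v \<oplus>\<^bsub>V\<^esub> w) \<in> carrier ?I"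
      using m n d v w by (subst inv_iff) (auto simp: inv_iff dmodule_def)
    then show "m \<oplus>\<^bsub>?I\<^esub> n \<in> carrier ?I" using v w by (simp add: Io)
  next
    fix a m assume a: "a \<in> ?k" and m: "m \<in> carrier ?I"
    obtain v where v: "v \<in> carrier V" "m = \<kappa> v" using m unfolding Ic by auto
    have z: "0 \<odot>\<^bsub>V\<^esub> v = \<zero>\<^bsub>V\<^esub>" "a \<odot>\<^bsub>V\<^esub> \<zero>\<^bsub>V\<^esub> = \<zero>\<^bsub>V\<^esub>" 
      using t.V.smult_l_null[OF v(1)] t.V.smult_r_null[of a] by simp_all
    have "\<kappa> (a \<odot>\<^bsub>V\<^esub> v) \<in> carrier ?I"
      using m d v a by (subst inv_iff) (auto simp: inv_iff dmodule_def constants_def z)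
    then show "a \<odot>\<^bsub>?I\<^esub> m \<in> carrier ?I" using v by (simp add: Io)
  qed
  have id: "semilin_map ?k id ?I t.M id"
    by (auto simp: semilin_map_def Io) (auto simp: Ic)
  have "\<kappa> v0 \<in> carrier t.M" using v0 by simp
  then obtain P where P: "P \<in> carrier (tensor_space ?k id ?I)" "the_elem (lin_ext t.M id ` P) = \<kappa> v0"
    using bij unfolding bij_betw_def by (metis (no_types, lifting) imageE)
  then obtain f where f: "f \<in> fin_supp (carrier ?I)" "P = tensor_class ?k id ?I f"
    by (auto simp: tensor_space_def)
  have lf: "lin_ext t.M id f = \<kappa> v0"
    using P(2) the_elem_lin_ext[OF closed_I t.M_module id f(1)] f(2) by simp
  have pM: "linear_form t.M (\<lambda>m. p (t.g m))"
    using p by (auto simp: linear_form_def)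
  have "p v0 = (\<Sum>m\<in>{m. f m \<noteq> 0}. f m * p (t.g m))"
    using linear_form_lin_ext[OF t.M_module pM _ f(1), of id] lf v0 by (auto simp: Ic)
  then obtain m where m: "f m \<noteq> 0" "p (t.g m) \<noteq> 0"
    using v0(2) by (metis (mono_tags, lifting) mem_Collect_eq mult_zero_right sum.neutral)
  then have mI: "m \<in> carrier ?I" using f(1) by (auto simp: fin_supp_def)
  then obtain v where v: "v \<in> carrier V" "m = \<kappa> v" unfolding Ic by auto
  show ?thesis
    by (rule that[of v]) (use v m mI inv_iff in auto)
qed

section \<open>Extensions of the base field by a vector space\<close>

definition prod_line :: "('k::field, 'v) module \<Rightarrow> ('k, 'v \<times> 'k) module" where
  "prod_line V = \<lparr>carrier = carrier V \<times> UNIV, mult = undefined, one = undefined, zero = (\<zero>\<^bsub>V\<^esub>, 0),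
     add = (\<lambda>(v, a) (w, b). (v \<oplus>\<^bsub>V\<^esub> w, a + b)), smult = (\<lambda>c (v, a). (c \<odot>\<^bsub>V\<^esub> v, c * a))\<rparr>"

lemma prod_line_simps [simp]:
  "carrier (prod_line V) = carrier V \<times> UNIV" "zero (prod_line V) = (\<zero>\<^bsub>V\<^esub>, 0)"
  "(v, a) \<oplus>\<^bsub>prod_line V\<^esub> (w, b) = (v \<oplus>\<^bsub>V\<^esub> w, a + b)" "c \<odot>\<^bsub>prod_line V\<^esub> (v, a) = (c \<odot>\<^bsub>V\<^esub> v, c * a)"
  by (simp_all add: prod_line_def)

lemma prod_line_module:
  fixes V :: "('k::field, 'v) module"
  assumes V: "module fld V"
  shows "module fld (prod_line V)"
proof -
  interpret V: module fld V by (rule V)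
  have sm: "a \<odot>\<^bsub>V\<^esub> v \<in> carrier V" if "v \<in> carrier V" for a v by (rule V.smult_closed) (simp_all add: that)
  show ?thesis
  proof (rule moduleI)
    show "cring (fld :: 'k ring)" using V by (simp add: module_def)
    show "abelian_group (prod_line V)"
    proof (rule abelian_groupI)
      fix x assume "x \<in> carrier (prod_line V)"
      then obtain v a where "x = (v, a)" "v \<in> carrier V" by auto
      then have "(\<ominus>\<^bsub>V\<^esub> v, - a) \<in> carrier (prod_line V) \<and> (\<ominus>\<^bsub>V\<^esub> v, - a) \<oplus>\<^bsub>prod_line V\<^esub> x = \<zero>\<^bsub>prod_line V\<^esub>"
        by (simp add: V.l_neg)
      then show "\<exists>y\<in>carrier (prod_line V). y \<oplus>\<^bsub>prod_line V\<^esub> x = \<zero>\<^bsub>prod_line V\<^esub>" by blast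
    qed (auto simp: V.a_ac)
  next
    fix a b x assume "x \<in> carrier (prod_line V)"
    then obtain v c where x: "x = (v, c)" "v \<in> carrier V" by auto
    show "(a \<oplus>\<^bsub>fld\<^esub> b) \<odot>\<^bsub>prod_line V\<^esub> x = a \<odot>\<^bsub>prod_line V\<^esub> x \<oplus>\<^bsub>prod_line V\<^esub> b \<odot>\<^bsub>prod_line V\<^esub> x"
      using x V.smult_l_distr[of a b v] by (simp add: algebra_simps)
    show "(a \<otimes>\<^bsub>fld\<^esub> b) \<odot>\<^bsub>prod_line V\<^esub> x = a \<odot>\<^bsub>prod_line V\<^esub> (b \<odot>\<^bsub>prod_line V\<^esub> x)"
      using x V.smult_assoc1[of a b v] by (simp add: algebra_simps)
    show "\<one>\<^bsub>fld\<^esub> \<odot>\<^bsub>prod_line V\<^esub> x = x" using x V.smult_one[of v] by simp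
    show "a \<odot>\<^bsub>prod_line V\<^esub> x \<in> carrier (prod_line V)" using x sm by simp
    fix y assume "y \<in> carrier (prod_line V)"
    then obtain w d where y: "y = (w, d)" "w \<in> carrier V" by auto
    show "a \<odot>\<^bsub>prod_line V\<^esub> (x \<oplus>\<^bsub>prod_line V\<^esub> y) = a \<odot>\<^bsub>prod_line V\<^esub> x \<oplus>\<^bsub>prod_line V\<^esub> a \<odot>\<^bsub>prod_line V\<^esub> y"
      using x y V.smult_r_distr[of a v w] by (simp add: algebra_simps)
  qed
qed

lemma prod_line_minus:
  fixes V :: "('k::field, 'v) module"
  assumes V: "module fld V" and v: "v \<in> carrier V" and w: "w \<in> carrier V"
  shows "(v, a) \<ominus>\<^bsub>prod_line V\<^esub> (w, b) = (v \<ominus>\<^bsub>V\<^esub> w, a - b)"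
proof -
  interpret V: module fld V by (rule V)
  interpret P: module fld "prod_line V" by (rule prod_line_module[OF V])
  have "\<ominus>\<^bsub>prod_line V\<^esub> (w, b) = (\<ominus>\<^bsub>V\<^esub> w, - b)"
    by (rule P.minus_equality) (use w in \<open>auto simp: V.l_neg\<close>)
  then show ?thesis by (simp add: a_minus_def)
qed

lemma prod_line_fin_dim:
  fixes V :: "('k::field, 'v) module"
  assumes V: "module fld V" and fd: "fin_dim V"
  shows "fin_dim (prod_line V)"
proof -
  interpret V: module fld V by (rule V)
  interpret P: module fld "prod_line V" by (rule prod_line_module[OF V])
  have sm: "a \<odot>\<^bsub>V\<^esub> v \<in> carrier V" if "v \<in> carrier V" for a v by (rule V.smult_closed) (simp_all add: that)
  have sm0: "a \<odot>\<^bsub>V\<^esub> \<zero>\<^bsub>V\<^esub> = \<zero>\<^bsub>V\<^esub>" for a using V.smult_r_null[of a] by simp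
  obtain B where B: "finite B" "B \<subseteq> carrier V" "\<And>v. v \<in> carrier V \<Longrightarrow> \<exists>c. v = (\<Oplus>\<^bsub>V\<^esub>b\<in>B. c b \<odot>\<^bsub>V\<^esub> b)"
    using fd by (auto simp: fin_dim_def)
  let ?e = "(\<zero>\<^bsub>V\<^esub>, 1::'k)" and ?B = "(\<lambda>b. (b, 0::'k)) ` B"
  have sum: "(\<Oplus>\<^bsub>prod_line V\<^esub>b\<in>F. (h b, 0)) = (\<Oplus>\<^bsub>V\<^esub>b\<in>F. h b, 0)" if "finite F" "h \<in> F \<rightarrow> carrier V" for F h
    using that
    by (induction F rule: finite_induct) (auto simp: P.finsum_insert Pi_def)
  have "\<exists>c. x = (\<Oplus>\<^bsub>prod_line V\<^esub>b\<in>insert ?e ?B. c b \<odot>\<^bsub>prod_line V\<^esub> b)" if x': "x \<in> carrier (prod_line V)" for x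
  proof -
    obtain v a where x: "x = (v, a)" "v \<in> carrier V" using x' by auto
    obtain c where c: "v = (\<Oplus>\<^bsub>V\<^esub>b\<in>B. c b \<odot>\<^bsub>V\<^esub> b)" using B(3)[OF x(2)] by blast
    let ?c = "\<lambda>p. if snd p = 1 then a else c (fst p)"
    have "(\<Oplus>\<^bsub>prod_line V\<^esub>b\<in>insert ?e ?B. ?c b \<odot>\<^bsub>prod_line V\<^esub> b) =
      ?c ?e \<odot>\<^bsub>prod_line V\<^esub> ?e \<oplus>\<^bsub>prod_line V\<^esub> (\<Oplus>\<^bsub>prod_line V\<^esub>b\<in>?B. ?c b \<odot>\<^bsub>prod_line V\<^esub> b)"
      using B sm by (intro P.finsum_insert) (auto simp: subset_iff)
    also have "(\<Oplus>\<^bsub>prod_line V\<^esub>b\<in>?B. ?c b \<odot>\<^bsub>prod_line V\<^esub> b) = (\<Oplus>\<^bsub>prod_line V\<^esub>b\<in>B. (c b \<odot>\<^bsub>V\<^esub> b, 0))"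
      by (subst P.add.finprod_reindex) (use B sm in \<open>auto simp: subset_iff inj_on_def\<close>)
    also have "\<dots> = (v, 0)" by (subst sum) (use B sm c in \<open>auto simp: subset_iff\<close>)
    finally have "(\<Oplus>\<^bsub>prod_line V\<^esub>b\<in>insert ?e ?B. ?c b \<odot>\<^bsub>prod_line V\<^esub> b) = x" using x by (simp add: sm0)
    then show ?thesis by (intro exI[of _ ?c]) simp
  qed
  then show ?thesis unfolding fin_dim_def using B(1,2)
    by (intro exI[of _ "insert ?e ?B"]) auto
qed

lemma line_module: "module fld (tspace (*) :: ('k::field, 'k) module)"
proof (rule moduleI)
  show "cring (fld :: 'k ring)" by unfold_locales (auto simp: algebra_simps Units_def intro: exI[of _ "- _"])
  show "abelian_group (tspace (*) :: ('k, 'k) module)"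
    by (rule abelian_groupI) (auto simp: tspace_def algebra_simps intro: exI[of _ "- _"])
qed (auto simp: tspace_def algebra_simps)

lemma line_fin_dim: "fin_dim (tspace (*) :: ('k::field, 'k) module)"
proof -
  interpret V: module fld "tspace (*) :: ('k, 'k) module" by (rule line_module)
  have "v = (\<Oplus>\<^bsub>tspace (*)\<^esub>b\<in>{1}. v \<odot>\<^bsub>tspace (*)\<^esub> b)" for v :: 'k
  proof -
    have "(\<Oplus>\<^bsub>tspace (*)\<^esub>b\<in>{1}. v \<odot>\<^bsub>tspace (*)\<^esub> b) = v \<odot>\<^bsub>tspace (*)\<^esub> (1 :: 'k)"
      by (subst V.finsum_insert) (simp_all only: V.finsum_empty finite.emptyI empty_iff not_False_eq_True,
        simp_all add: tspace_def)
    then show ?thesis by (simp add: tspace_def)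
  qed
  then have "\<exists>c. v = (\<Oplus>\<^bsub>tspace (*)\<^esub>b\<in>{1}. c b \<odot>\<^bsub>tspace (*)\<^esub> b)" for v :: 'k
    by (intro exI[of _ "\<lambda>_. v"])
  then show ?thesis unfolding fin_dim_def
    by (intro exI[of _ "{1}"]) (simp add: tspace_def)
qed

section \<open>Bilinearity of the curvature and one step of the filtration\<close>

context d_lift
begin

text \<open>The terms \<open>w x y\<close> are not linear in \<open>x\<close>, since
  \<open>AF\<close> does not commute with scalars; the extra \<open>der D y a\<close> cancels
  against the one that \<open>lie_scl_left\<close> produces in the bracket of
  \<open>scl D a x\<close> with \<open>y\<close>.\<close>

lemma curv_bilinear:
  "curv (x + y) z = hadd C (curv x z) (curv y z)"
  "curv (scl D a x) z = hscal C a (curv x z)"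
  "curv x y = hscal C (- 1) (curv y x)"
proof -
  define u where "u = pr (AO X) \<cdot> em X \<cdot> t"
  define w where "w x y = ctr y \<cdot> AF (ctr x) \<cdot> em X \<cdot> t" for x y
  have u [simp]: "u \<in> arr C" "src C u = X" "tgt C u = AO X" "pr X \<cdot> u = idt C X"
    using t(2) by (simp_all add: u_def)
  have w: "w x y \<in> homs C X X" for x y by (simp add: w_def homs_iff)
  have cu: "ctr x \<cdot> u \<in> homs C X X" for x by (simp add: homs_iff)
  have c: "curv x y = hsub (hsub (w x y) (w y x)) (ctr (lie D x y) \<cdot> u)" for x y
    by (simp add: curv_def u_def w_def)
  note hs = homs_simps(1-3) w cu
  have w_add: "w (x + y) z = hadd C (w x z) (w y z)" "w x (y + z) = hadd C (w x y) (w x z)" for x y z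
    by (simp_all add: w_def ctr_add)
  have w_scl: "w x (scl D a y) = hscal C a (w x y)"
    "w (scl D a x) y = hsub (hscal C a (w x y)) (hscal C (der D y a) (ctr x \<cdot> u))" for a x y
    by (simp_all add: w_def ctr_scl AF_hscal u_def d0_apply)
  have cu_add: "ctr (x + y) \<cdot> u = hadd C (ctr x \<cdot> u) (ctr y \<cdot> u)" "ctr (scl D a x) \<cdot> u = hscal C a (ctr x \<cdot> u)" for x y a
    by (simp_all add: ctr_add ctr_scl)
  have cu_minus: "ctr (- x) \<cdot> u = hscal C (- 1) (ctr x \<cdot> u)" for x
    using cu_add(2)[of "- 1" x] by simp
  have cu_diff: "ctr (x - y) \<cdot> u = hsub (ctr x \<cdot> u) (ctr y \<cdot> u)" for x y
    using cu_add(1)[of x "- y"] by (simp add: cu_minus hsub_def)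
  show "curv (x + y) z = hadd C (curv x z) (curv y z)"
    unfolding c
    by (rule hom_eqI'[where X = X and Y = X]) (simp_all add: hs w_add lie_simps cu_add hform_homs)
  show "curv (scl D a x) z = hscal C a (curv x z)"
    unfolding c
    by (rule hom_eqI'[where X = X and Y = X]) (simp_all add: hs w_scl lie_scl_left cu_add cu_diff hform_homs algebra_simps)
  show "curv x y = hscal C (- 1) (curv y x)"
    unfolding c lie_swap[of x y]
    by (rule hom_eqI'[where X = X and Y = X]) (simp_all add: hs cu_minus hform_homs)
qed

lemma curv_homs: "curv x y \<in> homs C X X"
  by (simp add: homs_iff)

lemma curv_bilinear_right:
  "curv z (x + y) = hadd C (curv z x) (curv z y)" "curv z (scl D a x) = hscal C a (curv z x)"
proof -
  show "curv z (x + y) = hadd C (curv z x) (curv z y)"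
    unfolding curv_bilinear(3)[of z] curv_bilinear(1)
    by (rule hom_eqI'[where X = X and Y = X]) (simp_all add: homs_simps(1-3) curv_homs hform_homs)
  show "curv z (scl D a x) = hscal C a (curv z x)"
    unfolding curv_bilinear(3)[of z] curv_bilinear(2)
    by (rule hom_eqI'[where X = X and Y = X]) (simp_all add: homs_simps(1-3) curv_homs hform_homs)
qed

lemma curv_self: "curv x x = hzero C X X"
proof (rule hom_eqI'[where X = X and Y = X])
  fix p assume p: "hform X X p"
  have "p (curv x x) = - p (curv x x)"
    using arg_cong[OF curv_bilinear(3)[of x x], of p] by (simp add: hform_homs[OF p] curv_homs)
  then show "p (curv x x) = p (hzero C X X)" using p by simp
qed (simp_all add: homs_iff)

text \<open>Linear closedness over \<open>S\<close> is applied twice: once to replace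
  \<open>v\<close> by a multiple that normalizes \<open>S\<close>, and once to find an endomorphism
  \<open>\<beta>\<close> whose derivatives along \<open>S\<close> are the curvatures in the
  direction of that multiple. Adding \<open>\<omega> \<otimes> \<beta>\<close> to the connection,
  where \<open>\<omega>\<close> vanishes on \<open>S\<close>, removes them and keeps the curvature
  on \<open>S\<close> zero.\<close>

lemma flat_step:
  assumes fd: "fin_dim (hspace C X X)"
    and S: "0 \<in> S" "\<And>x y. x \<in> S \<Longrightarrow> y \<in> S \<Longrightarrow> x + y \<in> S" "\<And>a x. x \<in> S \<Longrightarrow> scl D a x \<in> S"
      "\<And>x y. x \<in> S \<Longrightarrow> y \<in> S \<Longrightarrow> lie D x y \<in> S"
    and closed: "linearly_closed D S"
    and v: "v \<notin> S" and S': "\<And>x. x \<in> S \<Longrightarrow> \<exists>w\<in>S. \<exists>a. lie D x v = w + scl D a v"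
    and flat: "\<And>x y. x \<in> S \<Longrightarrow> y \<in> S \<Longrightarrow> curv x y = hzero C X X"
    and bianchi: "\<And>x y z. hadd C (hadd C (nab x (curv y z)) (nab y (curv z x))) (nab z (curv x y)) =
      hadd C (hadd C (curv (lie D x y) z) (curv (lie D y z) x)) (curv (lie D z x) y)"
  shows "\<exists>s'. D_connection C A X s' \<and>
    (\<forall>x\<in>{w + scl D a v | w a. w \<in> S}. \<forall>y\<in>{w + scl D a v | w a. w \<in> S}. d_lift.curv D C A X s' t x y = hzero C X X)"
proof -
  obtain \<theta> where \<theta>: "\<theta> \<in> forms1 D" "\<And>u. u \<in> S \<Longrightarrow> \<theta> u = 0" "\<theta> v = 1"
    using separating_one_form[OF S(1-3) v] by blast
  note \<theta>s = forms1_simps[OF \<theta>(1)]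
  \<comment> \<open>The coefficient of \<open>v\<close> in the bracket of \<open>x\<close> and
    \<open>v\<close> modulo \<open>S\<close>. It need not vanish, but by the Jacobi identity it
    satisfies the cocycle condition \<open>cbr\<close>.\<close>
  define c where "c x = \<theta> (lie D x v)" for x
  have lie_v: "lie D x v - scl D (c x) v \<in> S" if xS: "x \<in> S" for x
  proof -
    obtain w a where w: "w \<in> S" "lie D x v = w + scl D a v" using S'[OF xS] by blast
    then have "c x = a" by (simp add: c_def \<theta>s \<theta>)
    then show ?thesis using w by simp
  qed
  let ?L = "tspace (*) :: ('k, 'k) module"
  interpret L: module fld ?L by (rule line_module)
  have Lminus: "a \<ominus>\<^bsub>?L\<^esub> b = a - b" for a b :: 'k
  proof -
    have "\<ominus>\<^bsub>?L\<^esub> b = - b" by (rule L.minus_equality) (simp_all add: tspace_def)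
    then show ?thesis by (simp add: a_minus_def) (simp add: tspace_def)
  qed
  have cbr: "c (lie D x y) = der D x (c y) - der D y (c x)" if x: "x \<in> S" and y: "y \<in> S" for x y
  proof -
    have e: "\<theta> (lie D x (lie D y v)) = c x * c y + der D x (c y)" if x: "x \<in> S" and y: "y \<in> S" for x y
    proof -
      have "lie D x (lie D y v) = lie D x ((lie D y v - scl D (c y) v) + scl D (c y) v)" by simp
      also have "\<dots> = lie D x (lie D y v - scl D (c y) v) + (scl D (c y) (lie D x v) + scl D (der D x (c y)) v)"
        unfolding lie_simps ..
      finally have "\<theta> (lie D x (lie D y v)) = \<theta> (lie D x (lie D y v - scl D (c y) v)) + (c y * c x + der D x (c y))"
        by (simp only: \<theta>s \<theta>(3) c_def) simp
      then show ?thesis using \<theta>(2)[OF S(4)[OF x lie_v[OF y]]] by simp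
    qed
    have "lie D (lie D x y) v = lie D x (lie D y v) - lie D y (lie D x v)"
    proof -
      have 1: "lie D (lie D x y) v = - lie D v (lie D x y)" by (rule lie_swap)
      have 2: "lie D v x = - lie D x v" by (rule lie_swap)
      have 3: "lie D y (- lie D x v) = - lie D y (lie D x v)"
        using lie_simps(2)[of y "lie D x v" "- lie D x v"] by (simp add: eq_neg_iff_add_eq_0 add.commute)
      show ?thesis using jacobi[of x y v] unfolding 1 2 3 by (simp add: algebra_simps eq_neg_iff_add_eq_0)
    qed
    then show ?thesis using e[OF x y] e[OF y x] by (simp add: c_def \<theta>s)
  qed
  \<comment> \<open>This is the quotient of the next step of the filtration by \<open>S\<close>,
    with the bracket as action and \<open>v\<close> as basis.\<close>
  have "dmodule D S ?L (\<lambda>x a. der D x a + c x * a)"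
    unfolding dmodule_def Lminus
  proof (intro conjI ballI allI)
    fix x y a m assume x: "x \<in> S" and y: "y \<in> S"
    show "der D (lie D x y) m + c (lie D x y) * m =
      der D x (der D y m + c y * m) + c x * (der D y m + c y * m) - (der D y (der D x m + c x * m) + c y * (der D x m + c x * m))"
      by (simp add: cbr[OF x y] der_simps algebra_simps)
    show "der D (x + y) m + c (x + y) * m = (der D x m + c x * m) \<oplus>\<^bsub>?L\<^esub> (der D y m + c y * m)"
      by (simp add: tspace_def der_simps c_def lie_simps \<theta>s algebra_simps)
    show "der D (scl D a x) m + c (scl D a x) * m = a \<odot>\<^bsub>?L\<^esub> (der D x m + c x * m)"
      by (simp add: tspace_def der_simps c_def lie_scl_left \<theta>s \<theta>(2)[OF x] algebra_simps)
  qed (auto simp: tspace_def der_simps algebra_simps line_module[unfolded tspace_def])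
  then have dm: "dmodule D S ?L (\<lambda>x a. der D x a + c x * a)" .
  have lf: "linear_form ?L id" and one: "1 \<in> carrier ?L" "id 1 \<noteq> (0 :: 'k)"
    by (simp_all add: linear_form_def tspace_def)
  obtain a where a': "\<And>x. x \<in> S \<Longrightarrow> der D x a + c x * a = \<zero>\<^bsub>?L\<^esub>" "id a \<noteq> 0"
    using linearly_closed_invariant[OF closed dm line_fin_dim lf one] by blast
  then have a: "\<And>x. x \<in> S \<Longrightarrow> der D x a + c x * a = 0" "a \<noteq> 0" by (simp_all add: tspace_def)
  \<comment> \<open>An invariant of that line is a multiple of \<open>v\<close> whose brackets with
    \<open>S\<close> stay in \<open>S\<close>.\<close>
  define v' where "v' = scl D a v"
  have lie_v': "lie D x v' \<in> S" if x: "x \<in> S" for x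
  proof -
    have "lie D x v' = scl D a (lie D x v - scl D (c x) v) + scl D (der D x a + c x * a) v"
      by (simp add: v'_def lie_simps(4) scl.scale_right_diff_distrib scl.scale_left_distrib mult.commute)
    then show ?thesis using a(1)[OF x] S(3)[OF lie_v[OF x]] by simp
  qed
  define K where "K x = curv x v'" for x
  have K: "K x \<in> homs C X X" for x by (simp add: K_def curv_homs)
  have z: "hzero C X X \<in> homs C X X" by (simp add: homs_iff)
  note hs = homs_simps(1-3) nab_homs K z
  \<comment> \<open>In the Bianchi identity for \<open>x\<close>, \<open>y\<close> and
    \<open>v'\<close> all curvatures with both arguments in \<open>S\<close> vanish; among them are
    those with \<open>lie D y v'\<close> or \<open>lie D v' x\<close>, as \<open>v'\<close>
    normalizes \<open>S\<close>.\<close>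
  have cocycle: "hsub (nab x (K y)) (nab y (K x)) = K (lie D x y)" if x: "x \<in> S" and y: "y \<in> S" for x y
  proof (rule hom_eqI'[where X = X and Y = X])
    fix p assume p: "hform X X p"
    have z1: "curv x y = hzero C X X" "curv (lie D y v') x = hzero C X X" "curv (lie D v' x) y = hzero C X X"
      using flat x y lie_v' S(3)[of "lie D x v'" "- 1"] lie_swap[of v' x] by auto
    have "nab y (curv v' x) = hscal C (- 1) (nab y (K x))"
      unfolding curv_bilinear(3)[of v'] K_def by (subst nab_hscal) (simp_all add: der_minus hscal_zero)
    then have "p (hadd C (hadd C (nab x (K y)) (hscal C (- 1) (nab y (K x)))) (hzero C X X)) =
        p (hadd C (hadd C (K (lie D x y)) (hzero C X X)) (hzero C X X))"
      using bianchi[of x y v'] by (simp add: z1 K_def[symmetric] nab_homs_simps)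
    then show "p (hsub (nab x (K y)) (nab y (K x))) = p (K (lie D x y))"
      using p by (simp add: hform_homs[OF p] hs)
  qed (simp_all add: hs)
  let ?E = "prod_line (hspace C X X)"
  \<comment> \<open>The extension of \<open>k\<close> by \<open>End X\<close> that belongs to the
    cocycle \<open>K\<close>. Compatibility with brackets amounts to flatness on \<open>S\<close>
    together with \<open>cocycle\<close>.\<close>
  let ?act = "\<lambda>x (e, b). (hadd C (nab x e) (hscal C b (K x)), der D x b)"
  have Em: "module fld (hspace C X X)" by (rule hspace_module) simp_all
  interpret E: module fld "hspace C X X" by (rule Em)
  have Eminus: "e \<ominus>\<^bsub>hspace C X X\<^esub> f = hsub e f" if "e \<in> homs C X X" "f \<in> homs C X X" for e f
  proof -
    have "\<ominus>\<^bsub>hspace C X X\<^esub> f = hscal C (- 1) f"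
      by (rule E.minus_equality; (simp add: hs that)?; (rule hom_eqI'[where X = X and Y = X])?) (simp_all add: hs that hform_homs)
    then show ?thesis by (simp add: a_minus_def hsub_def)
  qed
  have nab_scal: "nab x (hscal C b e) = hadd C (hscal C b (nab x e)) (hscal C (der D x b) e)" if "e \<in> homs C X X" for x b e
    using that by (simp add: homs_iff nab_hscal)
  have K_lin: "K (x + y) = hadd C (K x) (K y)" "K (scl D a x) = hscal C a (K x)" for x y a
    by (simp_all add: K_def curv_bilinear(1,2))
  have nab_lin: "nab (x + y) e = hadd C (nab x e) (nab y e)" "nab (scl D a x) e = hscal C a (nab x e)"
    if "e \<in> homs C X X" for x y a e using that by (simp_all add: homs_iff nab_left)
  have flat_nab: "nab (lie D x y) e = hsub (nab x (nab y e)) (nab y (nab x e))"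
    if "x \<in> S" "y \<in> S" and e: "e \<in> homs C X X" for x y e
  proof (rule hom_eqI'[where X = X and Y = X])
    fix p assume p: "hform X X p"
    have "hsub (hsub (nab x (nab y e)) (nab y (nab x e))) (nab (lie D x y) e) = hzero C X X"
      using commutator[of e x y] e flat[OF that(1,2)] by (simp add: homs_iff)
    from arg_cong[OF this, of p] show "p (nab (lie D x y) e) = p (hsub (nab x (nab y e)) (nab y (nab x e)))"
      using p by (simp add: hform_homs[OF p] hs e algebra_simps)
  qed (simp_all add: hs e)
  have "dmodule D S ?E ?act"
    unfolding dmodule_def
  proof (intro conjI ballI allI)
    show "module fld ?E" by (rule prod_line_module[OF Em])
  next
    fix x assume x: "x \<in> S"
    show "?act x \<in> carrier ?E \<rightarrow> carrier ?E" by (auto simp: hs)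
  next
    fix x m n assume x: "x \<in> S" and "m \<in> carrier ?E" "n \<in> carrier ?E"
    then obtain e b f d where m: "m = (e, b)" "e \<in> homs C X X" and n: "n = (f, d)" "f \<in> homs C X X" by auto
    show "?act x (m \<oplus>\<^bsub>?E\<^esub> n) = ?act x m \<oplus>\<^bsub>?E\<^esub> ?act x n"
      by (simp add: m n der_simps; rule hom_eqI'[where X = X and Y = X]) (simp_all add: m n hs nab_homs_simps hform_homs algebra_simps)
  next
    fix x y m assume x: "x \<in> S" and y: "y \<in> S" and "m \<in> carrier ?E"
    then obtain e b where m: "m = (e, b)" "e \<in> homs C X X" by auto
    show "?act (x + y) m = ?act x m \<oplus>\<^bsub>?E\<^esub> ?act y m"
      by (simp add: m der_simps; rule hom_eqI'[where X = X and Y = X]) (simp_all add: m hs nab_lin K_lin hform_homs algebra_simps)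
    show "?act (lie D x y) m = ?act x (?act y m) \<ominus>\<^bsub>?E\<^esub> ?act y (?act x m)"
    proof -
      have "hadd C (nab (lie D x y) e) (hscal C b (K (lie D x y))) =
        hsub (hadd C (nab x (hadd C (nab y e) (hscal C b (K y)))) (hscal C (der D y b) (K x)))
             (hadd C (nab y (hadd C (nab x e) (hscal C b (K x)))) (hscal C (der D x b) (K y)))"
        unfolding flat_nab[OF x y m(2)] cocycle[OF x y, symmetric]
        by (rule hom_eqI'[where X = X and Y = X]) (simp_all add: m hs nab_homs_simps nab_scal hform_homs algebra_simps)
      then show ?thesis
        by (simp add: m der_simps prod_line_minus[OF Em] hs Eminus)
    qed
  next
    fix x and d :: 'k and m assume x: "x \<in> S" and "m \<in> carrier ?E"
    then obtain e b where m: "m = (e, b)" "e \<in> homs C X X" by auto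
    show "?act (scl D d x) m = d \<odot>\<^bsub>?E\<^esub> ?act x m"
      by (simp add: m der_simps; rule hom_eqI'[where X = X and Y = X]) (simp_all add: m hs nab_lin K_lin hform_homs algebra_simps)
    show "?act x (d \<odot>\<^bsub>?E\<^esub> m) = der D x d \<odot>\<^bsub>?E\<^esub> m \<oplus>\<^bsub>?E\<^esub> d \<odot>\<^bsub>?E\<^esub> ?act x m"
      by (simp add: m der_simps; rule hom_eqI'[where X = X and Y = X]) (simp_all add: m hs nab_scal hform_homs algebra_simps)
  qed
  then have dmE: "dmodule D S ?E ?act" .
  have lfE: "linear_form ?E snd" by (auto simp: linear_form_def)
  have oneE: "(hzero C X X, 1) \<in> carrier ?E" "snd (hzero C X X, 1) \<noteq> (0 :: 'k)" by (simp_all add: z)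
  obtain m where m: "m \<in> carrier ?E" "\<And>x. x \<in> S \<Longrightarrow> ?act x m = \<zero>\<^bsub>?E\<^esub>" "snd m \<noteq> 0"
    using linearly_closed_invariant[OF closed dmE prod_line_fin_dim[OF Em fd] lfE oneE] by blast
  obtain e b where eb: "m = (e, b)" by (cases m)
  have e: "e \<in> homs C X X" and b: "b \<noteq> 0" "\<And>x. x \<in> S \<Longrightarrow> der D x b = 0"
    "\<And>x. x \<in> S \<Longrightarrow> hadd C (nab x e) (hscal C b (K x)) = hzero C X X"
    using m by (auto simp: eb)
  \<comment> \<open>The last component \<open>b\<close> of the invariant is nonzero and constant
    along \<open>S\<close>, so dividing by \<open>- b\<close> turns invariance into
    \<open>nab x \<beta> = K x\<close>.\<close>
  define \<beta> where "\<beta> = hscal C (- inverse b) e"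
  have \<beta>: "\<beta> \<in> homs C X X" by (simp add: \<beta>_def hs e)
  then have [simp]: "\<beta> \<in> arr C" "src C \<beta> = X" "tgt C \<beta> = X" by (auto simp: homs_iff)
  have nab_\<beta>: "nab x \<beta> = K x" if x: "x \<in> S" for x
  proof (rule hom_eqI'[where X = X and Y = X])
    fix p assume p: "hform X X p"
    have "p (hadd C (nab x e) (hscal C b (K x))) = 0" using b(3)[OF x] p by simp
    then have "p (nab x e) = - b * p (K x)" by (simp add: hform_homs[OF p] hs e eq_neg_iff_add_eq_0)
    moreover have "der D x (- inverse b) = 0" using der_inverse[OF b(1) b(2)[OF x]] by (simp add: der_minus)
    ultimately show "p (nab x \<beta>) = p (K x)"
      using b(1) by (simp add: \<beta>_def nab_scal e hform_homs[OF p] hs)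
  qed (simp_all add: hs \<beta>)
  \<comment> \<open>Scaled by \<open>inverse a\<close> so that the value at \<open>v'\<close> is
    1.\<close>
  define \<omega> where "\<omega> = (\<lambda>x. inverse a * \<theta> x)"
  have \<omega>: "\<omega> \<in> forms1 D" "\<omega> v' = 1" "\<And>x. x \<in> S \<Longrightarrow> \<omega> x = 0"
    using \<theta> a(2) by (auto simp: \<omega>_def v'_def \<theta>s)
  define s' where "s' = hadd C s (om X \<omega> \<cdot> s \<cdot> \<beta>)"
  have s'_typ [simp]: "s' \<in> arr C" "src C s' = X" "tgt C s' = AO X" by (simp_all add: s'_def \<omega>)
  have conn: "D_connection C A X s'"
    unfolding D_connection_def by (simp add: homs_iff s'_def \<omega> hscal_zero)
  interpret N: d_lift D C T A X s' t by unfold_locales (use conn t in auto)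
  have Bx: "ctr x \<cdot> s' = hscal C (\<omega> x) \<beta>" for x by (simp add: s'_def \<omega>)
  have flat1: "N.curv x y = hzero C X X" if "x \<in> S" "y \<in> S" for x y
    unfolding gauge(3)[OF conn] Bx flat[OF that]
    using that S(4) by (simp add: \<omega> hscal_zero nab_homs_simps)
  \<comment> \<open>Since \<open>\<omega>\<close> vanishes at \<open>x\<close> and at
    \<open>lie D x v'\<close>, only \<open>nab x \<beta>\<close> remains of the gauge correction,
    and it equals \<open>K x\<close>.\<close>
  have flat2: "N.curv x v' = hzero C X X" if x: "x \<in> S" for x
    unfolding gauge(3)[OF conn] Bx
    using x lie_v'[OF x] by (simp add: \<omega> hscal_zero nab_homs_simps nab_\<beta> K_def)
  have flat3: "N.curv v' x = hzero C X X" if x: "x \<in> S" for x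
    unfolding N.curv_bilinear(3)[of v'] flat2[OF x] by simp
  have v_v': "scl D d v = scl D (d * inverse a) v'" for d
    using a(2) by (simp add: v'_def)
  have "N.curv (w + scl D d v) (w' + scl D d' v) = hzero C X X" if "w \<in> S" "w' \<in> S" for w w' d d'
    unfolding v_v' using that
    by (simp add: N.curv_bilinear(1,2) N.curv_bilinear_right flat1 flat2 flat3 N.curv_self)
  then show ?thesis using conn by blast
qed

end

text \<open>Induction along the filtration, starting from \<open>F 0 = {0}\<close>, where every
  connection is flat. The connection changes at each step while \<open>t\<close> does not, so the
  Bianchi identity is assumed for all connections on \<open>X\<close>.\<close>

lemma (in d_lift) D_structure_exists:
  assumes fd: "fin_dim (hspace C X X)" and filt: "filtered_linearly_closed D"
    and bianchi: "\<And>s' x y z. D_connection C A X s' \<Longrightarrow>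
      hadd C (hadd C (d_connection.nab D C A X s' x (d_lift.curv D C A X s' t y z))
        (d_connection.nab D C A X s' y (d_lift.curv D C A X s' t z x)))
        (d_connection.nab D C A X s' z (d_lift.curv D C A X s' t x y)) =
      hadd C (hadd C (d_lift.curv D C A X s' t (lie D x y) z) (d_lift.curv D C A X s' t (lie D y z) x))
        (d_lift.curv D C A X s' t (lie D z x) y)"
  shows "\<exists>s'. D_structure C A X s'"
proof -
  obtain d F where H: "F 0 = {0} \<and> F d = UNIV \<and>
     (\<forall>i\<le>d. submodule (F i) fld (dspace D) \<and> (\<forall>x\<in>F i. \<forall>y\<in>F i. lie D x y \<in> F i)) \<and>
     (\<forall>i<d. F i \<subseteq> F (Suc i) \<and>
        (\<exists>v. v \<notin> F i \<and> F (Suc i) = {w + scl D a v | w a. w \<in> F i}) \<and>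
        linearly_closed D (F i))"
    using filt unfolding filtered_linearly_closed_def by (elim exE) (rule that)
  have F: "F 0 = {0}" "F d = UNIV"
    and sub: "\<And>i. i \<le> d \<Longrightarrow> submodule (F i) fld (dspace D)"
    and lie: "\<And>i x y. i \<le> d \<Longrightarrow> x \<in> F i \<Longrightarrow> y \<in> F i \<Longrightarrow> lie D x y \<in> F i"
    and step: "\<And>i. i < d \<Longrightarrow> F i \<subseteq> F (Suc i)"
      "\<And>i. i < d \<Longrightarrow> \<exists>v. v \<notin> F i \<and> F (Suc i) = {w + scl D a v | w a. w \<in> F i}"
      "\<And>i. i < d \<Longrightarrow> linearly_closed D (F i)"
    using H by simp_all
  have S: "0 \<in> F i" "\<And>x y. x \<in> F i \<Longrightarrow> y \<in> F i \<Longrightarrow> x + y \<in> F i" "\<And>a x. x \<in> F i \<Longrightarrow> scl D a x \<in> F i"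
    if "i \<le> d" for i
  proof -
    interpret N: submodule "F i" fld "dspace D" by (rule sub[OF that])
    show "0 \<in> F i" using N.one_closed by (simp add: tspace_def)
    show "x + y \<in> F i" if "x \<in> F i" "y \<in> F i" for x y
      using N.m_closed[OF that] by (simp add: tspace_def)
    show "scl D a x \<in> F i" if "x \<in> F i" for a x
      using N.smult_closed[of a x] that by (simp add: tspace_def)
  qed
  have "\<exists>s'. D_connection C A X s' \<and> (\<forall>x\<in>F i. \<forall>y\<in>F i. d_lift.curv D C A X s' t x y = hzero C X X)"
    if "i \<le> d" for i
    using that
  proof (induction i)
    case 0
    show ?case using s by (intro exI[of _ s]) (simp add: F curv_self)
  next
    case (Suc i)
    then have i: "i < d" "i \<le> d" by auto
    obtain s' where s': "D_connection C A X s'"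
      "\<And>x y. x \<in> F i \<Longrightarrow> y \<in> F i \<Longrightarrow> d_lift.curv D C A X s' t x y = hzero C X X"
      using Suc.IH[OF i(2)] by blast
    obtain v where v: "v \<notin> F i" "F (Suc i) = {w + scl D a v | w a. w \<in> F i}" using step(2)[OF i(1)] by blast
    interpret N: d_lift D C T A X s' t by unfold_locales (use s' t in auto)
    have "0 + scl D 1 v \<in> F (Suc i)" unfolding v(2) using S(1)[OF i(2)] by blast
    then have vS: "v \<in> F (Suc i)" by (simp add: scl_simps)
    have lv: "\<exists>w\<in>F i. \<exists>a. lie D x v = w + scl D a v" if "x \<in> F i" for x
      using lie[OF Suc.prems _ vS, of x] step(1)[OF i(1)] that unfolding v(2) by blast
    show ?case unfolding v(2)
      by (rule N.flat_step[OF fd S[OF i(2)] lie[OF i(2)] step(3)[OF i(1)] v(1) lv s'(2) bianchi[OF s'(1)]])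
  qed
  from this[of d] obtain s' where s': "D_connection C A X s'" "\<And>x y. d_lift.curv D C A X s' t x y = hzero C X X"
    using F(2) by auto
  interpret N: d_lift D C T A X s' t by unfold_locales (use s' t in auto)
  show ?thesis using N.D_structureI[OF s'(2)] by blast
qed

section \<open>Differential functors\<close>

text \<open>The features of \<open>l \<otimes> -\<close> on which the descent rests: the comparison
  maps are isomorphisms, and \<open>j\<close> respects brackets and evaluation of one-forms.
  Contractions, derivatives and curvature can therefore be compared at arguments of the form
  \<open>j x\<close>.\<close>

locale d_functor =
  src: d_category D C T A + tgt: d_category D' C' T' A'
  for D :: "('k::field_char_0, 'd::ab_group_add) dfield" and C :: "('o, 'a, 'k) lcat" (structure)
    and T :: "('o, 'a) tensor_data" and A :: "('k, 'd, 'o, 'a) at_data"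
    and D' :: "('l::field_char_0, 'e::ab_group_add) dfield" and C' :: "('p, 'b, 'l) lcat"
    and T' :: "('p, 'b) tensor_data" and A' :: "('l, 'e, 'p, 'b) at_data" +
  fixes \<phi> :: "'k \<Rightarrow> 'l" and \<Theta> :: "'e \<Rightarrow> ('d \<Rightarrow> 'l) set" and j :: "'d \<Rightarrow> 'e"
    and Fo :: "'o \<Rightarrow> 'p" and Fa :: "'a \<Rightarrow> 'b" and G :: "('o, 'b) dfun_data"
  assumes \<phi>: "field_hom \<phi>"
    and F: "differential_functor D D' \<phi> \<Theta> C T A C' T' A' Fo Fa G"
    and iso1: "\<And>X. X \<in> obj C \<Longrightarrow> is_iso C' (Fo (aob (at1 A) X)) (aob (at1 A') (Fo X)) (th1 G X)"
    and iso2: "\<And>X. X \<in> obj C \<Longrightarrow> is_iso C' (Fo (aob (at2 A) X)) (aob (at2 A') (Fo X)) (th2 G X)"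
    and lie_j: "\<And>x y. lie D' (j x) (j y) = j (lie D x y)"
    and pull: "\<And>\<omega>. \<omega> \<in> forms1 D \<Longrightarrow> pull1 \<phi> \<Theta> \<omega> \<in> forms1 D'"
      "\<And>\<omega> x. \<omega> \<in> forms1 D \<Longrightarrow> pull1 \<phi> \<Theta> \<omega> (j x) = \<phi> (\<omega> x)"
begin

abbreviation cmp' (infixr "\<bullet>" 70) where "g \<bullet> f \<equiv> g \<cdot>\<^bsub>C'\<^esub> f"

lemma \<phi>_simps [simp]: "\<phi> 1 = 1" "\<phi> 0 = 0" "\<phi> (- a) = - \<phi> a"
proof -
  have add: "\<phi> (a + b) = \<phi> a + \<phi> b" for a b using \<phi> by (simp add: field_hom_def)
  show "\<phi> 1 = 1" using \<phi> by (simp add: field_hom_def)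
  show z: "\<phi> 0 = 0" using add[of 0 0] by simp
  show "\<phi> (- a) = - \<phi> a" using add[of a "- a"] z by (simp add: eq_neg_iff_add_eq_0 add.commute)
qed

lemma F_functor: "is_functor C C' Fo Fa"
  using F by (simp add: differential_functor_def exact_functor_def)

lemma Fo_obj [simp]: "X \<in> obj C \<Longrightarrow> Fo X \<in> obj C'"
  using F_functor by (auto simp: is_functor_def)

lemma Fa_typ [simp]: "f \<in> arr C \<Longrightarrow> Fa f \<in> arr C'" "f \<in> arr C \<Longrightarrow> lcat.src C' (Fa f) = Fo (lcat.src C f)"
  "f \<in> arr C \<Longrightarrow> lcat.tgt C' (Fa f) = Fo (lcat.tgt C f)"
  using F_functor by (auto simp: is_functor_def homs_def)

lemma Fa_idt [simp]: "X \<in> obj C \<Longrightarrow> Fa (idt C X) = idt C' (Fo X)"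
  using F_functor by (auto simp: is_functor_def)

lemma Fa_cmp [simp]: "f \<in> arr C \<Longrightarrow> g \<in> arr C \<Longrightarrow> lcat.tgt C f = lcat.src C g \<Longrightarrow> Fa (g \<cdot> f) = Fa g \<bullet> Fa f"
  using F_functor by (auto simp: is_functor_def)

lemma Fa_semilin: "X \<in> obj C \<Longrightarrow> Y \<in> obj C \<Longrightarrow> semilin_map UNIV \<phi> (hspace C X Y) (hspace C' (Fo X) (Fo Y)) Fa"
  using F by (simp add: differential_functor_def)

lemma Fa_hadd [simp]: "f \<in> arr C \<Longrightarrow> g \<in> arr C \<Longrightarrow> lcat.src C f = lcat.src C g \<Longrightarrow> lcat.tgt C f = lcat.tgt C g \<Longrightarrow>
    Fa (hadd C f g) = hadd C' (Fa f) (Fa g)"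
  using Fa_semilin[of "lcat.src C g" "lcat.tgt C g"] by (auto simp: semilin_map_def homs_def)

lemma Fa_hscal [simp]: "f \<in> arr C \<Longrightarrow> Fa (hscal C a f) = hscal C' (\<phi> a) (Fa f)"
  using Fa_semilin[of "lcat.src C f" "lcat.tgt C f"] by (auto simp: semilin_map_def homs_def)

lemma Fa_hsub [simp]: "f \<in> arr C \<Longrightarrow> g \<in> arr C \<Longrightarrow> lcat.src C f = lcat.src C g \<Longrightarrow> lcat.tgt C f = lcat.tgt C g \<Longrightarrow>
    Fa (src.hsub f g) = tgt.hsub (Fa f) (Fa g)"
  by (simp add: src.hsub_def tgt.hsub_def)

lemma Fa_hzero [simp]: "X \<in> obj C \<Longrightarrow> Y \<in> obj C \<Longrightarrow> Fa (hzero C X Y) = hzero C' (Fo X) (Fo Y)"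
  using Fa_hscal[of "hzero C X Y" 0] by (simp add: tgt.hscal_zero)

lemma Fa_hsum:
  assumes "X \<in> obj C" "Y \<in> obj C" "finite B" "\<And>b. b \<in> B \<Longrightarrow> g b \<in> arr C" "\<And>b. b \<in> B \<Longrightarrow> lcat.src C (g b) = X"
    "\<And>b. b \<in> B \<Longrightarrow> lcat.tgt C (g b) = Y"
  shows "Fa (src.hsum X Y g B) = tgt.hsum (Fo X) (Fo Y) (\<lambda>b. Fa (g b)) B"
proof -
  interpret H: module fld "hspace C X Y" by (rule src.hspace_module) (use assms in auto)
  interpret H': module fld "hspace C' (Fo X) (Fo Y)" by (rule tgt.hspace_module) (use assms in auto)
  show ?thesis using assms(3-)
  proof (induction B rule: finite_induct)
    case empty then show ?case using assms by (simp add: src.hsum_def tgt.hsum_def)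
  next
    case (insert x F)
    have 1: "src.hsum X Y g (insert x F) = hadd C (g x) (src.hsum X Y g F)"
      using insert unfolding src.hsum_def by (subst H.finsum_insert) (auto simp: homs_def)
    have 2: "tgt.hsum (Fo X) (Fo Y) (\<lambda>b. Fa (g b)) (insert x F) = hadd C' (Fa (g x)) (tgt.hsum (Fo X) (Fo Y) (\<lambda>b. Fa (g b)) F)"
      using insert unfolding tgt.hsum_def by (subst H'.finsum_insert) (auto simp: homs_def)
    show ?case unfolding 1 2 using insert assms by (subst Fa_hadd) auto
  qed
qed

abbreviation "\<theta>1 \<equiv> th1 G"
abbreviation "\<theta>2 \<equiv> th2 G"

lemma \<theta>_typ [simp]:
  "X \<in> obj C \<Longrightarrow> \<theta>1 X \<in> arr C'" "X \<in> obj C \<Longrightarrow> lcat.src C' (\<theta>1 X) = Fo (src.AO X)" "X \<in> obj C \<Longrightarrow> lcat.tgt C' (\<theta>1 X) = tgt.AO (Fo X)"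
  "X \<in> obj C \<Longrightarrow> \<theta>2 X \<in> arr C'" "X \<in> obj C \<Longrightarrow> lcat.src C' (\<theta>2 X) = Fo (src.AO2 X)" "X \<in> obj C \<Longrightarrow> lcat.tgt C' (\<theta>2 X) = tgt.AO2 (Fo X)"
  using iso1[of X] iso2[of X] by (simp_all add: is_iso_def homs_def)

lemma \<theta>1_base_change: "X \<in> obj C \<Longrightarrow> base_change C' (carrier (jet1 D)) (Fo (src.AO X)) (\<lambda>p. Fa (aact (at1 A) X p)) (jet_map1 \<phi> \<Theta>)
     (jet1 D') (rho1 D') (tgt.AO (Fo X)) (aact (at1 A') (Fo X)) (\<theta>1 X)"
  using F by (simp add: differential_functor_def atiyah_compatible_def)

lemma \<theta>1_om: "X \<in> obj C \<Longrightarrow> \<omega> \<in> forms1 D \<Longrightarrow> \<theta>1 X \<bullet> Fa (src.om X \<omega>) = tgt.om (Fo X) (pull1 \<phi> \<Theta> \<omega>) \<bullet> \<theta>1 X"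
  using \<theta>1_base_change[of X] unfolding base_change_def by (auto simp: src.jet1_simps jet_map1_def)

lemma \<theta>1_AF: "f \<in> arr C \<Longrightarrow> lcat.src C f = X \<Longrightarrow> tgt.AF (Fa f) \<bullet> \<theta>1 X = \<theta>1 (lcat.tgt C f) \<bullet> Fa (src.AF f)"
  using F by (auto simp: differential_functor_def atiyah_compatible_def)

lemma \<theta>1_AF': "f \<in> arr C \<Longrightarrow> lcat.src C f = X \<Longrightarrow> g \<in> arr C' \<Longrightarrow> lcat.tgt C' g = Fo (src.AO X) \<Longrightarrow>
    tgt.AF (Fa f) \<bullet> \<theta>1 X \<bullet> g = \<theta>1 (lcat.tgt C f) \<bullet> Fa (src.AF f) \<bullet> g"
  by (subst tgt.reassoc[OF \<theta>1_AF]) auto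

lemma \<theta>1_pr [simp]: "X \<in> obj C \<Longrightarrow> tgt.pr (Fo X) \<bullet> \<theta>1 X = Fa (src.pr X)"
  using F by (simp add: differential_functor_def)

lemma \<theta>1_pr' [simp]: "X \<in> obj C \<Longrightarrow> g \<in> arr C' \<Longrightarrow> lcat.tgt C' g = Fo (src.AO X) \<Longrightarrow>
    tgt.pr (Fo X) \<bullet> \<theta>1 X \<bullet> g = Fa (src.pr X) \<bullet> g"
  by (subst tgt.reassoc[OF \<theta>1_pr]) auto

lemma \<theta>2_em: "X \<in> obj C \<Longrightarrow> tgt.em (Fo X) \<bullet> \<theta>2 X =
    tgt.AF (\<theta>1 X) \<bullet> \<theta>1 (src.AO X) \<bullet> Fa (src.em X)"
  using F by (simp add: differential_functor_def)

lemma \<theta>2_em': "X \<in> obj C \<Longrightarrow> g \<in> arr C' \<Longrightarrow> lcat.tgt C' g = Fo (src.AO2 X) \<Longrightarrow> tgt.em (Fo X) \<bullet> \<theta>2 X \<bullet> g =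
    tgt.AF (\<theta>1 X) \<bullet> \<theta>1 (src.AO X) \<bullet> Fa (src.em X) \<bullet> g"
  by (subst tgt.reassoc[OF \<theta>2_em]) auto

text \<open>In \<open>\<theta>2_em\<close> the comparison for \<open>At1 (At1 X)\<close> is made in
  two stages. Naturality of \<open>\<theta>1\<close> moves \<open>tgt.AF u\<close> past both as soon
  as \<open>u\<close> after the inner comparison is the image of a morphism
  \<open>v\<close>.\<close>

lemma AF_\<theta>1_cmp:
  assumes "X \<in> obj C" "u \<in> arr C'" "lcat.src C' u = tgt.AO (Fo X)" "u \<bullet> \<theta>1 X = Fa v" "v \<in> arr C"  "lcat.src C v = src.AO X"
    and "g \<in> arr C'" "lcat.tgt C' g = Fo (src.AO (src.AO X))"
  shows "tgt.AF u \<bullet> tgt.AF (\<theta>1 X) \<bullet> \<theta>1 (src.AO X) \<bullet> g = \<theta>1 (lcat.tgt C v) \<bullet> Fa (src.AF v) \<bullet> g"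
proof -
  have "tgt.AF u \<bullet> tgt.AF (\<theta>1 X) = tgt.AF (Fa v)"
    using assms(1-4) tgt.AF_cmp[of "\<theta>1 X" u] by simp
  then have "tgt.AF u \<bullet> tgt.AF (\<theta>1 X) \<bullet> \<theta>1 (src.AO X) \<bullet> g = tgt.AF (Fa v) \<bullet> \<theta>1 (src.AO X) \<bullet> g"
    using assms by (subst tgt.reassoc) auto
  also have "\<dots> = \<theta>1 (lcat.tgt C v) \<bullet> Fa (src.AF v) \<bullet> g"
    using assms by (subst \<theta>1_AF') auto
  finally show ?thesis .
qed

section \<open>Images of connections, contractions and curvature\<close>

lemma connection_image:
  assumes X: "X \<in> obj C" and s: "D_connection C A X s"
  shows "D_connection C' A' (Fo X) (\<theta>1 X \<bullet> Fa s)"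
proof -
  have [simp]: "s \<in> arr C" "lcat.src C s = X" "lcat.tgt C s = src.AO X" "src.pr X \<cdot> s = idt C X"
    using s by (auto simp: D_connection_def homs_def)
  have "Fa (src.pr X) \<bullet> Fa s = Fa (src.pr X \<cdot> s)" using X by (subst Fa_cmp) auto
  then show ?thesis using X by (simp add: D_connection_def homs_def)
qed

lemma D_structure_image:
  assumes X: "X \<in> obj C" and s: "D_structure C A X s"
  shows "D_structure C' A' (Fo X) (\<theta>1 X \<bullet> Fa s)"
proof -
  have c: "D_connection C A X s" using s by (simp add: D_structure_def)
  have [simp]: "s \<in> arr C" "lcat.src C s = X" "lcat.tgt C s = src.AO X"
    using c by (auto simp: D_connection_def homs_def)
  obtain t where t: "t \<in> homs C X (src.AO2 X)" "src.em X \<cdot> t = src.AF s \<cdot> s"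
    using s by (auto simp: D_structure_def)
  have [simp]: "t \<in> arr C" "lcat.src C t = X" "lcat.tgt C t = src.AO2 X"
    using t(1) by (auto simp: homs_def)
  have "tgt.em (Fo X) \<bullet> \<theta>2 X \<bullet> Fa t = tgt.AF (\<theta>1 X) \<bullet> \<theta>1 (src.AO X) \<bullet> Fa (src.em X) \<bullet> Fa t"
    using X by (simp add: \<theta>2_em')
  also have "Fa (src.em X) \<bullet> Fa t = Fa (src.AF s) \<bullet> Fa s"
    using X Fa_cmp[of t "src.em X"] by (simp add: t(2))
  also have "tgt.AF (\<theta>1 X) \<bullet> \<theta>1 (src.AO X) \<bullet> Fa (src.AF s) \<bullet> Fa s =
     tgt.AF (\<theta>1 X \<bullet> Fa s) \<bullet> \<theta>1 X \<bullet> Fa s"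
    using X by (simp add: \<theta>1_AF')
  finally have e: "tgt.em (Fo X) \<bullet> \<theta>2 X \<bullet> Fa t = tgt.AF (\<theta>1 X \<bullet> Fa s) \<bullet> \<theta>1 X \<bullet> Fa s" .
  show ?thesis unfolding D_structure_def
    by (intro conjI connection_image[OF X c] bexI[of _ "\<theta>2 X \<bullet> Fa t"] e) (use X in \<open>simp add: homs_def\<close>)
qed

text \<open>Both sides agree on \<open>Fa s\<close> and on the images of the operators
  \<open>src.om X \<omega>\<close>. The functor carries the decomposition of the identity of
  \<open>src.AO X\<close> to the target, so these composites determine them.\<close>

lemma ctr_image:
  assumes X: "X \<in> obj C" and s: "D_connection C A X s"
  shows "d_connection.ctr D' C' A' (Fo X) (\<theta>1 X \<bullet> Fa s) (j x) \<bullet> \<theta>1 X = Fa (d_connection.ctr D C A X s x)"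
proof -
  interpret S: d_connection D C T A X s by unfold_locales (fact X s)+
  interpret S': d_connection D' C' T' A' "Fo X" "\<theta>1 X \<bullet> Fa s"
    by unfold_locales (use X connection_image[OF X s] in auto)
  have exp: "w = hadd C' ((w \<bullet> Fa s) \<bullet> Fa (src.pr X))
      (tgt.hsum (Fo (src.AO X)) (lcat.tgt C' w) (\<lambda>b. (w \<bullet> Fa (src.om X (src.dual b))) \<bullet> Fa s \<bullet> Fa (S.ctr b)) src.bas)"
    if "w \<in> arr C'" "lcat.src C' w = Fo (src.AO X)" for w
  proof -
    have "w = w \<bullet> Fa (idt C (src.AO X))" using that by simp
    also have "\<dots> = hadd C' ((w \<bullet> Fa s) \<bullet> Fa (src.pr X))
      (tgt.hsum (Fo (src.AO X)) (lcat.tgt C' w) (\<lambda>b. (w \<bullet> Fa (src.om X (src.dual b))) \<bullet> Fa s \<bullet> Fa (S.ctr b)) src.bas)"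
      unfolding S.decomposition using that by (simp add: Fa_hsum tgt.cmp_hsum_right)
    finally show ?thesis .
  qed
  have e1: "(S'.ctr (j x) \<bullet> \<theta>1 X) \<bullet> Fa s = Fa (S.ctr x) \<bullet> Fa s"
  proof -
    have "(S'.ctr (j x) \<bullet> \<theta>1 X) \<bullet> Fa s = hzero C' (Fo X) (Fo X)"
      using S'.ctr_s[of "j x"] by simp
    also have "\<dots> = Fa (S.ctr x \<cdot> s)" by simp
    also have "\<dots> = Fa (S.ctr x) \<bullet> Fa s" by (subst Fa_cmp) simp_all
    finally show ?thesis .
  qed
  have e2: "(S'.ctr (j x) \<bullet> \<theta>1 X) \<bullet> Fa (src.om X \<omega>) = Fa (S.ctr x) \<bullet> Fa (src.om X \<omega>)"
    if w: "\<omega> \<in> forms1 D" for \<omega>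
  proof -
    have "(S'.ctr (j x) \<bullet> \<theta>1 X) \<bullet> Fa (src.om X \<omega>) = hscal C' (\<phi> (\<omega> x)) (Fa (src.pr X))"
      using w by (simp add: \<theta>1_om pull)
    also have "\<dots> = Fa (S.ctr x \<cdot> src.om X \<omega>)" using w by simp
    also have "\<dots> = Fa (S.ctr x) \<bullet> Fa (src.om X \<omega>)" using w by (subst Fa_cmp) simp_all
    finally show ?thesis .
  qed
  let ?u = "S'.ctr (j x) \<bullet> \<theta>1 X" and ?v = "Fa (S.ctr x)"
  let ?e = "\<lambda>w. hadd C' ((w \<bullet> Fa s) \<bullet> Fa (src.pr X))
      (tgt.hsum (Fo (src.AO X)) (lcat.tgt C' w) (\<lambda>b. (w \<bullet> Fa (src.om X (src.dual b))) \<bullet> Fa s \<bullet> Fa (S.ctr b)) src.bas)"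
  have "lcat.tgt C' ?u = lcat.tgt C' ?v" by simp
  then have "?e ?u = ?e ?v" by (simp only: e1 e2[OF src.dual_form])
  moreover have "?u = ?e ?u" "?v = ?e ?v" by (rule exp; simp)+
  ultimately show ?thesis by (metis (no_types))
qed

lemma nab_image:
  assumes X: "X \<in> obj C" and s: "D_connection C A X s" and f: "f \<in> homs C X X"
  shows "d_connection.nab D' C' A' (Fo X) (\<theta>1 X \<bullet> Fa s) (j x) (Fa f) = Fa (d_connection.nab D C A X s x f)"
proof -
  interpret S: d_connection D C T A X s by unfold_locales (fact X s)+
  interpret S': d_connection D' C' T' A' "Fo X" "\<theta>1 X \<bullet> Fa s"
    by unfold_locales (use X connection_image[OF X s] in auto)
  have [simp]: "f \<in> arr C" "lcat.src C f = X" "lcat.tgt C f = X" using f by (auto simp: homs_def)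
  have "S'.nab (j x) (Fa f) = hscal C' (- 1) ((S'.ctr (j x) \<bullet> \<theta>1 X) \<bullet> Fa (src.AF f) \<bullet> Fa s)"
    unfolding S'.nab_def by (simp add: \<theta>1_AF')
  also have "\<dots> = Fa (S.nab x f)"
    unfolding ctr_image[OF X s] S.nab_def by simp
  finally show ?thesis .
qed

text \<open>Every ingredient of \<open>curv\<close> is a composite of contractions, projections and
  the embedding evaluated on the lift; \<open>ctr_image\<close>, \<open>\<theta>2_em\<close> and
  \<open>lie_j\<close> transport them one by one.\<close>

lemma lift_image:
  assumes "d_lift D C T A X s t"
  shows "d_lift D' C' T' A' (Fo X) (\<theta>1 X \<bullet> Fa s) (\<theta>2 X \<bullet> Fa t)"
    and "d_lift.curv D' C' A' (Fo X) (\<theta>1 X \<bullet> Fa s) (\<theta>2 X \<bullet> Fa t) (j x) (j y) = Fa (d_lift.curv D C A X s t x y)"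
proof -
  interpret S: d_lift D C T A X s t by fact
  interpret S': d_connection D' C' T' A' "Fo X" "\<theta>1 X \<bullet> Fa s"
    by unfold_locales (use connection_image[OF S.X S.s] in auto)
  have em: "tgt.em (Fo X) \<bullet> \<theta>2 X \<bullet> Fa t =
    tgt.AF (\<theta>1 X) \<bullet> \<theta>1 (src.AO X) \<bullet> Fa (src.em X) \<bullet> Fa t" by (simp add: \<theta>2_em')
  have pr: "tgt.pr (tgt.AO (Fo X)) \<bullet> tgt.em (Fo X) \<bullet> \<theta>2 X \<bullet> Fa t =
     \<theta>1 X \<bullet> Fa (src.pr (src.AO X) \<cdot> src.em X \<cdot> t)"
    unfolding em by simp
  have pr': "tgt.AF (tgt.pr (Fo X)) \<bullet> tgt.em (Fo X) \<bullet> \<theta>2 X \<bullet> Fa t =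
     \<theta>1 X \<bullet> Fa (src.AF (src.pr X) \<cdot> src.em X \<cdot> t)"
    unfolding em by (subst AF_\<theta>1_cmp[where v = "src.pr X"]) (simp_all del: S.projections_agree')
  have "tgt.pr (Fo X) \<bullet> tgt.pr (tgt.AO (Fo X)) \<bullet> tgt.em (Fo X) \<bullet> \<theta>2 X \<bullet> Fa t = 
    Fa (src.pr X \<cdot> src.pr (src.AO X) \<cdot> src.em X \<cdot> t)"
    unfolding pr by simp
  then have q: "tgt.pr (Fo X) \<bullet> tgt.pr (tgt.AO (Fo X)) \<bullet> tgt.em (Fo X) \<bullet> \<theta>2 X \<bullet> Fa t = idt C' (Fo X)"
    unfolding S.t(2) by simp
  show L: "d_lift D' C' T' A' (Fo X) (\<theta>1 X \<bullet> Fa s) (\<theta>2 X \<bullet> Fa t)"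
  proof unfold_locales
    show "\<theta>2 X \<bullet> Fa t \<in> homs C' (Fo X) (tgt.AO2 (Fo X))" by (simp add: homs_def)
  qed (rule q, simp only: pr pr' S.t(3))
  interpret L: d_lift D' C' T' A' "Fo X" "\<theta>1 X \<bullet> Fa s" "\<theta>2 X \<bullet> Fa t" by (rule L)
  have c: "S'.ctr (j x) \<bullet> \<theta>1 X \<bullet> g = Fa (S.ctr x) \<bullet> g" if "g \<in> arr C'" "lcat.tgt C' g = Fo (src.AO X)" for x g
    using that by (subst tgt.reassoc[OF ctr_image[OF S.X S.s]]) simp_all
  have w: "S'.ctr (j y) \<bullet> tgt.AF (S'.ctr (j x)) \<bullet> tgt.em (Fo X) \<bullet> \<theta>2 X \<bullet> Fa t =
    Fa (S.ctr y \<cdot> src.AF (S.ctr x) \<cdot> src.em X \<cdot> t)" for x y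
    unfolding em by (subst AF_\<theta>1_cmp[OF S.X _ _ ctr_image[OF S.X S.s]]) (simp_all add: c)
  have u: "S'.ctr (j x) \<bullet> tgt.pr (tgt.AO (Fo X)) \<bullet> tgt.em (Fo X) \<bullet> \<theta>2 X \<bullet> Fa t = 
    Fa (S.ctr x \<cdot> src.pr (src.AO X) \<cdot> src.em X \<cdot> t)" for x
    unfolding pr by (simp add: c)
  show "L.curv (j x) (j y) = Fa (S.curv x y)"
    unfolding L.curv_def S.curv_def lie_j w u by (subst Fa_hsub; simp)+
qed

lemma \<theta>1_cancel:
  assumes "X \<in> obj C" "u \<in> arr C'" "v \<in> arr C'" "lcat.tgt C' u = Fo (src.AO X)" "lcat.tgt C' v = Fo (src.AO X)"
    "lcat.src C' u = lcat.src C' v" "\<theta>1 X \<bullet> u = \<theta>1 X \<bullet> v"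
  shows "u = v"
proof -
  obtain i where i: "i \<in> homs C' (tgt.AO (Fo X)) (Fo (src.AO X))" "i \<bullet> \<theta>1 X = idt C' (Fo (src.AO X))"
    using iso1[OF assms(1)] by (auto simp: is_iso_def)
  have i_typ [simp]: "i \<in> arr C'" "lcat.src C' i = tgt.AO (Fo X)" "lcat.tgt C' i = Fo (src.AO X)" using i(1) by (auto simp: homs_def)
  have "i \<bullet> \<theta>1 X \<bullet> w = w" if "w \<in> arr C'" "lcat.tgt C' w = Fo (src.AO X)" for w
    using assms(1) that by (subst tgt.reassoc[OF i(2)]) simp_all
  from this[OF assms(2,4)] this[OF assms(3,5)] show ?thesis unfolding assms(7) by (rule trans[OF sym])
qed

text \<open>\<open>R\<close> retracts morphisms out of \<open>Fo X\<close> to morphisms out of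
  \<open>X\<close> and commutes with postcomposition by morphisms of \<open>C\<close>. As it need
  not respect other composites, it is applied to a second-order lift and not to the equation of a
  \<open>D\<close>-structure. Flatness upstairs is used only to obtain the Bianchi identity
  downstairs.\<close>

theorem D_structure_iff:
  assumes X: "X \<in> obj C" and fd: "fin_dim (hspace C X X)" and filt: "filtered_linearly_closed D"
    and R_typ: "\<And>Y \<eta>. Y \<in> obj C \<Longrightarrow> \<eta> \<in> homs C' (Fo X) (Fo Y) \<Longrightarrow> R Y \<eta> \<in> homs C X Y"
    and R_nat: "\<And>Y Z \<eta> u. \<eta> \<in> homs C' (Fo X) (Fo Y) \<Longrightarrow> u \<in> homs C Y Z \<Longrightarrow> R Z (Fa u \<bullet> \<eta>) = u \<cdot> R Y \<eta>"
    and R_id: "R X (idt C' (Fo X)) = idt C X"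
  shows "(\<exists>s. D_structure C A X s) \<longleftrightarrow> (\<exists>s. D_structure C' A' (Fo X) s)"
proof
  assume "\<exists>s. D_structure C A X s"
  then show "\<exists>s. D_structure C' A' (Fo X) s" using D_structure_image[OF X] by blast
next
  assume "\<exists>s. D_structure C' A' (Fo X) s"
  then obtain s where sD: "D_structure C' A' (Fo X) s" by blast
  then have s: "D_connection C' A' (Fo X) s" by (simp add: D_structure_def)
  interpret S: d_connection D' C' T' A' "Fo X" s by unfold_locales (use X s in auto)
  obtain t where t: "t \<in> homs C' (Fo X) (tgt.AO2 (Fo X))" "tgt.em (Fo X) \<bullet> t = tgt.AF s \<bullet> s"
    using sD by (auto simp: D_structure_def)
  have [simp]: "t \<in> arr C'" "lcat.src C' t = Fo X" "lcat.tgt C' t = tgt.AO2 (Fo X)" using t(1) by (auto simp: homs_def)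
  obtain i where i: "i \<in> homs C' (tgt.AO2 (Fo X)) (Fo (src.AO2 X))" "\<theta>2 X \<bullet> i = idt C' (tgt.AO2 (Fo X))"
    using iso2[OF X] by (auto simp: is_iso_def)
  have [simp]: "i \<in> arr C'" "lcat.src C' i = tgt.AO2 (Fo X)" "lcat.tgt C' i = Fo (src.AO2 X)" using i(1) by (auto simp: homs_def)
  define \<tau> where "\<tau> = i \<bullet> t"
  have \<tau>: "\<tau> \<in> homs C' (Fo X) (Fo (src.AO2 X))" by (simp add: \<tau>_def homs_def)
  have [simp]: "\<tau> \<in> arr C'" "lcat.src C' \<tau> = Fo X" "lcat.tgt C' \<tau> = Fo (src.AO2 X)" using \<tau> by (auto simp: homs_def)
  have \<theta>\<tau>: "\<theta>2 X \<bullet> \<tau> = t" using X tgt.reassoc[OF i(2), of t] by (simp add: \<tau>_def)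
  have em: "tgt.AF (\<theta>1 X) \<bullet> \<theta>1 (src.AO X) \<bullet> Fa (src.em X) \<bullet> \<tau> = tgt.AF s \<bullet> s"
    using X \<theta>2_em'[of X \<tau>] \<theta>\<tau> t(2) by simp
  have AFs: "tgt.AF (tgt.pr (Fo X)) \<bullet> tgt.AF s \<bullet> s = s"
  proof -
    have "tgt.AF (tgt.pr (Fo X)) \<bullet> tgt.AF s \<bullet> s = tgt.AF (tgt.pr (Fo X) \<bullet> s) \<bullet> s"
      by (subst tgt.AF_cmp) simp_all
    then show ?thesis by simp
  qed
  \<comment> \<open>Both projections of \<open>\<tau>\<close> become \<open>s\<close> after
    \<open>\<theta>1 X\<close>, which can be cancelled.\<close>
  have p1: "\<theta>1 X \<bullet> Fa (src.pr (src.AO X) \<cdot> src.em X) \<bullet> \<tau> = s"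
    using X arg_cong[OF em, of "\<lambda>g. tgt.pr (tgt.AO (Fo X)) \<bullet> g"] by simp
  have p2: "\<theta>1 X \<bullet> Fa (src.AF (src.pr X) \<cdot> src.em X) \<bullet> \<tau> = s"
  proof -
    have "tgt.AF (tgt.pr (Fo X)) \<bullet> tgt.AF (\<theta>1 X) \<bullet> \<theta>1 (src.AO X) \<bullet> Fa (src.em X) \<bullet> \<tau> =
      \<theta>1 X \<bullet> Fa (src.AF (src.pr X)) \<bullet> Fa (src.em X) \<bullet> \<tau>"
      using X by (subst AF_\<theta>1_cmp[where v = "src.pr X"]) simp_all
    then show ?thesis using X AFs em by simp
  qed
  have p12: "Fa (src.pr (src.AO X) \<cdot> src.em X) \<bullet> \<tau> = Fa (src.AF (src.pr X) \<cdot> src.em X) \<bullet> \<tau>"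
    by (rule \<theta>1_cancel[OF X]) (use X p1 p2 in simp_all)
  have q: "Fa (src.pr X \<cdot> src.pr (src.AO X) \<cdot> src.em X) \<bullet> \<tau> = idt C' (Fo X)"
    using X arg_cong[OF p1, of "\<lambda>g. tgt.pr (Fo X) \<bullet> g"] by simp
  \<comment> \<open>All conditions on a lift compare composites \<open>Fa u \<bullet> \<tau>\<close>
    with each other or with the identity, so they survive the application of
    \<open>R\<close>.\<close>
  define t0 where "t0 = R (src.AO2 X) \<tau>"
  have t0: "t0 \<in> homs C X (src.AO2 X)" unfolding t0_def by (rule R_typ) (use X \<tau> in auto)
  have [simp]: "t0 \<in> arr C" "lcat.src C t0 = X" "lcat.tgt C t0 = src.AO2 X" using t0 by (auto simp: homs_def)
  have R_nat': "R Z (Fa u \<bullet> \<tau>) = u \<cdot> t0" if "u \<in> homs C (src.AO2 X) Z" for u Z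
    unfolding t0_def by (rule R_nat[OF \<tau> that])
  have t0_pr: "src.AF (src.pr X) \<cdot> src.em X \<cdot> t0 = src.pr (src.AO X) \<cdot> src.em X \<cdot> t0"
    using X R_nat'[of "src.AF (src.pr X) \<cdot> src.em X" "src.AO X"] R_nat'[of "src.pr (src.AO X) \<cdot> src.em X" "src.AO X"] p12
    by (simp add: homs_def)
  have t0_q: "src.pr X \<cdot> src.pr (src.AO X) \<cdot> src.em X \<cdot> t0 = idt C X"
    using X R_nat'[of "src.pr X \<cdot> src.pr (src.AO X) \<cdot> src.em X" X] q R_id by (simp add: homs_def)
  \<comment> \<open>The first-order part of the lift.\<close>
  define s0 where "s0 = src.pr (src.AO X) \<cdot> src.em X \<cdot> t0"
  have s0: "D_connection C A X s0" using X t0_q by (simp add: D_connection_def s0_def homs_def)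
  have lift: "d_lift D C T A X s' t0" if "D_connection C A X s'" for s'
    by unfold_locales (use X that t0 t0_q t0_pr in auto)
  \<comment> \<open>Naturality of \<open>R\<close>, applied to the identity of \<open>Fo X\<close>,
    makes it a left inverse of \<open>Fa\<close> on \<open>End X\<close>.\<close>
  have Fa_inj: "u = v" if uv: "u \<in> homs C X X" "v \<in> homs C X X" "Fa u = Fa v" for u v
  proof -
    have idh: "idt C' (Fo X) \<in> homs C' (Fo X) (Fo X)" using X by (simp add: homs_def)
    have r: "R X (Fa u) = u" if "u \<in> homs C X X" for u
      using R_nat[OF idh that] that R_id X by (simp add: homs_def)
    show ?thesis using r[OF uv(1)] r[OF uv(2)] unfolding uv(3) by (rule trans[OF sym])
  qed
  show "\<exists>s. D_structure C A X s"
  proof (rule d_lift.D_structure_exists[OF lift[OF s0] fd filt])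
    fix s' x y z assume s': "D_connection C A X s'"
    interpret L: d_lift D C T A X s' t0 by (rule lift[OF s'])
    interpret L': d_lift D' C' T' A' "Fo X" "\<theta>1 X \<bullet> Fa s'" "\<theta>2 X \<bullet> Fa t0"
      by (rule lift_image[OF lift[OF s']])
    \<comment> \<open>The given \<open>D\<close>-structure serves as the flat reference connection
      for the image of \<open>t0\<close>; its curvature is zero with respect to any lift.\<close>
    interpret F: d_lift D' C' T' A' "Fo X" s "\<theta>2 X \<bullet> Fa t0"
      by unfold_locales (fact L'.t)+
    note ci = lift_image(2)[OF lift[OF s']] and ni = nab_image[OF X s' L.curv_homs]
    show "hadd C (hadd C (L.nab x (L.curv y z)) (L.nab y (L.curv z x))) (L.nab z (L.curv x y)) =
      hadd C (hadd C (L.curv (lie D x y) z) (L.curv (lie D y z) x)) (L.curv (lie D z x) y)"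
    proof (rule Fa_inj)
      show "Fa (hadd C (hadd C (L.nab x (L.curv y z)) (L.nab y (L.curv z x))) (L.nab z (L.curv x y))) =
        Fa (hadd C (hadd C (L.curv (lie D x y) z) (L.curv (lie D y z) x)) (L.curv (lie D z x) y))"
        using F.bianchi[OF L'.s F.curv_D_structure[OF sD], of "j x" "j y" "j z"]
        by (simp add: ci ni lie_j)
    qed (simp_all add: homs_def)
  qed
qed

end

section \<open>Extension of scalars\<close>

locale scalar_retraction =
  fixes \<phi> :: "'k::field \<Rightarrow> 'l::field" and r :: "'l \<Rightarrow> 'k"
  assumes \<phi>: "field_hom \<phi>" and r: "r (a + b) = r a + r b" "r (\<phi> c * a) = c * r a" "r 1 = 1"
begin

lemma r_zero [simp]: "r 0 = 0"
  using r(2)[of 0 0] by simp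

lemma r_diff: "r (a - b) = r a - r b"
  using r(1)[of "a - b" b] by simp

lemma r_sum: "r (sum f A) = (\<Sum>x\<in>A. r (f x))"
  by (induction A rule: infinite_finite_induct) (simp_all add: r)

lemma r_fin_supp: "f \<in> fin_supp A \<Longrightarrow> (\<lambda>x. r (f x)) \<in> fin_supp A"
  unfolding fin_supp_def by (auto elim: rev_finite_subset intro: ccontr)

text \<open>Since \<open>r\<close> is only \<open>k\<close>-linear, it does not commute with
  multiplication by elements of \<open>l\<close>. The factor \<open>c\<close> makes the statement
  stable under \<open>null_smult\<close>.\<close>

lemma r_tensor_null:
  "f \<in> tensor_null UNIV \<phi> V \<Longrightarrow> (\<lambda>x. r (c * f x)) \<in> tensor_null UNIV id V"
proof (induction arbitrary: c rule: tensor_null.induct)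
  case null_zero
  show ?case unfolding mult_zero_right r_zero by (rule tensor_null.null_zero)
next
  case (null_add f g)
  have "(\<lambda>x. r (c * f x) + r (c * g x)) \<in> tensor_null UNIV id V"
    by (intro tensor_null.null_add null_add)
  then show ?case by (simp only: distrib_left r(1))
next
  case (null_smult f d)
  show ?case using null_smult.IH[of "c * d"] by (simp only: mult.assoc)
next
  case (rel_add v w)
  have "(\<lambda>x. r c * (single (v \<oplus>\<^bsub>V\<^esub> w) x - single v x - single w x)) \<in> tensor_null UNIV id V"
    by (intro tensor_null.null_smult tensor_null.rel_add rel_add)
  moreover have "r (c * (single (v \<oplus>\<^bsub>V\<^esub> w) x - single v x - single w x)) =
      r c * (single (v \<oplus>\<^bsub>V\<^esub> w) x - single v x - single w x)" for x
    by (simp add: right_diff_distrib r_diff) (simp add: single_def)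
  ultimately show ?case by (simp only:)
next
  case (rel_smult a v)
  have "(\<lambda>x. r c * (single (a \<odot>\<^bsub>V\<^esub> v) x - id a * single v x)) \<in> tensor_null UNIV id V"
    by (intro tensor_null.null_smult tensor_null.rel_smult rel_smult)
  moreover have "r (c * (single (a \<odot>\<^bsub>V\<^esub> v) x - \<phi> a * single v x)) =
      r c * (single (a \<odot>\<^bsub>V\<^esub> v) x - id a * single v x)" for x
    using r(2)[of a c] by (simp add: right_diff_distrib r_diff mult.left_commute) (simp add: single_def mult.commute)
  ultimately show ?case by (simp only:)
qed

definition ret :: "('k, 'v) module \<Rightarrow> ('v \<Rightarrow> 'l) set \<Rightarrow> 'v" where
  "ret V P = lin_ext V id (\<lambda>x. r ((SOME f. f \<in> P) x))"

lemma ret_tensor_class: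
  assumes V: "module fld V" and f: "f \<in> fin_supp (carrier V)" and g: "g \<in> tensor_class UNIV \<phi> V f"
  shows "lin_ext V id (\<lambda>x. r (g x)) = lin_ext V id (\<lambda>x. r (f x))"
proof (rule lin_ext_tensor_class)
  show "closed_under UNIV V" by (rule module_closed_under[OF V])
  show "semilin_map UNIV id V V id" by (simp add: semilin_map_def)
  show "(\<lambda>x. r (f x)) \<in> fin_supp (carrier V)" by (rule r_fin_supp[OF f])
  have g': "g \<in> fin_supp (carrier V)" "(\<lambda>x. g x - f x) \<in> tensor_null UNIV \<phi> V"
    using g by (auto simp: tensor_class_def)
  show "(\<lambda>x. r (g x)) \<in> tensor_class UNIV id V (\<lambda>x. r (f x))"
    using r_tensor_null[OF g'(2), of 1] r_fin_supp[OF g'(1)] by (simp add: tensor_class_def r_diff)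
qed (rule V)

lemma ret_eq:
  assumes V: "module fld V" and P: "P \<in> carrier (tensor_space UNIV \<phi> V)" and g: "g \<in> P"
  shows "ret V P = lin_ext V id (\<lambda>x. r (g x))" "g \<in> fin_supp (carrier V)"
proof -
  obtain f where f: "f \<in> fin_supp (carrier V)" "P = tensor_class UNIV \<phi> V f"
    using P by (auto simp: tensor_space_def)
  have "(SOME f. f \<in> P) \<in> P" by (rule someI[of "\<lambda>f. f \<in> P", OF g])
  then show "ret V P = lin_ext V id (\<lambda>x. r (g x))"
    using ret_tensor_class[OF V f(1)] g unfolding ret_def f(2) by metis
  show "g \<in> fin_supp (carrier V)" using g unfolding f(2) tensor_class_def by simp
qed

end

text \<open>Along \<open>\<phi>\<close> the field \<open>l\<close> is a \<open>k\<close>-vector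
  space in which 1 is not zero, so some linear form takes the value 1 there.\<close>

lemma scalar_retraction_exists:
  fixes \<phi> :: "'k::field \<Rightarrow> 'l::field"
  assumes \<phi>: "field_hom \<phi>"
  obtains r where "scalar_retraction \<phi> r"
proof -
  have vs: "vector_space (\<lambda>a b. \<phi> a * b)"
    using \<phi> by unfold_locales (auto simp: field_hom_def algebra_simps)
  obtain r where "\<forall>u v. r (u + v) = r u + r v" "\<forall>a v. r (\<phi> a * v) = a * r v" "r 1 = 1"
    using separating_form[OF vs, of "{0}" 1] by auto
  then show ?thesis using that[of r] \<phi> by (simp add: scalar_retraction_def)
qed

section \<open>Retraction of morphisms out of \<open>l \<otimes> X\<close>\<close>

locale ext_retraction = lin_category C + scalar_retraction \<phi> r
  for C :: "('o, 'a, 'k::field) lcat" (structure) and \<phi> :: "'k \<Rightarrow> 'l::field" and r :: "'l \<Rightarrow> 'k"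
begin

lemma ext_cat_simps:
  "cmp (ext_cat C \<phi>) = cmp (ind_lmodule_cat C \<phi>)" "idt (ext_cat C \<phi>) = idt (ind_lmodule_cat C \<phi>)"
  "src (ext_cat C \<phi>) = fst" "tgt (ext_cat C \<phi>) = (\<lambda>t. fst (snd t))"
  "t \<in> arr (ext_cat C \<phi>) \<Longrightarrow> t \<in> arr (ind_lmodule_cat C \<phi>)"
  by (simp_all add: ext_cat_def Let_def ind_lmodule_cat_def)

text \<open>By the Yoneda lemma, a morphism from \<open>l \<otimes> X\<close> is determined by its value on \<open>1 \<otimes> id\<close>.\<close>

definition unit_elem :: "'o \<Rightarrow> ('a \<Rightarrow> 'l) set" where
  "unit_elem X = tensor_class UNIV \<phi> (hspace C X X) (single (idt C X))"

definition ret_hom :: "'o \<Rightarrow> 'o \<Rightarrow> ('o, 'a, 'l) ext_ar \<Rightarrow> 'a" where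
  "ret_hom X Y t = ret (hspace C X Y) (snd (snd t) X (unit_elem X))"

lemma unit_elem: "X \<in> obj C \<Longrightarrow> unit_elem X \<in> carrier (psp (ext_obj C \<phi> X) X)"
  "X \<in> obj C \<Longrightarrow> single (idt C X) \<in> unit_elem X"
proof -
  assume X: "X \<in> obj C"
  have "(single (idt C X) :: 'a \<Rightarrow> 'l) \<in> fin_supp (carrier (hspace C X X))"
    by (rule single_fin_supp) (simp add: X homs_iff)
  then show "unit_elem X \<in> carrier (psp (ext_obj C \<phi> X) X)" "single (idt C X) \<in> unit_elem X"
    by (auto simp: unit_elem_def ext_obj_def tensor_space_def tensor_class_self)
qed

lemma hom_value:
  assumes X: "X \<in> obj C" and t: "t \<in> homs (ext_cat C \<phi>) (ext_obj C \<phi> X) (ext_obj C \<phi> Y)"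
  shows "snd (snd t) X (unit_elem X) \<in> carrier (tensor_space UNIV \<phi> (hspace C X Y))"
proof -
  obtain F G \<eta> where t_eq: "t = (F, G, \<eta>)" by (cases t)
  have "t \<in> arr (ind_lmodule_cat C \<phi>)" "F = ext_obj C \<phi> X" "G = ext_obj C \<phi> Y"
    using t by (auto simp: homs_def ext_cat_simps t_eq)
  then have "lin_map (psp (ext_obj C \<phi> X) X) (psp (ext_obj C \<phi> Y) X) (\<eta> X)"
    using X by (auto simp: ind_lmodule_cat_def t_eq)
  then have "\<eta> X (unit_elem X) \<in> carrier (psp (ext_obj C \<phi> Y) X)"
    using unit_elem(1)[OF X] by (auto simp: semilin_map_def)
  then show ?thesis by (simp add: t_eq ext_obj_def)
qed

lemma tensor_space_nonempty:
  "P \<in> carrier (tensor_space UNIV \<phi> V) \<Longrightarrow> \<exists>g. g \<in> P"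
  using tensor_class_self by (fastforce simp: tensor_space_def)

lemma lin_ext_homs:
  assumes "X \<in> obj C" "Y \<in> obj C" "f \<in> fin_supp (homs C X Y)"
  shows "lin_ext (hspace C X Y) id f \<in> homs C X Y"
  using lin_ext_closed[OF hspace_module[OF assms(1,2)], of id "hspace C X Y" f] assms(3) by simp

lemma hform_lin_ext:
  assumes p: "hform X Y p" and f: "f \<in> fin_supp (homs C X Y)" and A: "finite A" "{v. f v \<noteq> 0} \<subseteq> A"
  shows "p (lin_ext (hspace C X Y) id f) = (\<Sum>v\<in>A. f v * p v)"
proof -
  have "p (lin_ext (hspace C X Y) id f) = (\<Sum>v\<in>{v. f v \<noteq> 0}. f v * p (id v))"
    by (rule linear_form_lin_ext[where V = "hspace C X Y"]) (use p f hspace_module in \<open>auto simp: hform_def\<close>)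
  also have "\<dots> = (\<Sum>v\<in>A. f v * p v)"
    using A by (intro sum.mono_neutral_cong_left) auto
  finally show ?thesis .
qed

lemma ret_hom_typ:
  assumes X: "X \<in> obj C" and Y: "Y \<in> obj C" and t: "t \<in> homs (ext_cat C \<phi>) (ext_obj C \<phi> X) (ext_obj C \<phi> Y)"
  shows "ret_hom X Y t \<in> homs C X Y"
proof -
  note P = hom_value[OF X t]
  obtain g where g: "g \<in> snd (snd t) X (unit_elem X)" using tensor_space_nonempty[OF P] by blast
  note e = ret_eq[OF hspace_module[OF X Y] P g]
  show ?thesis unfolding ret_hom_def e(1)
    by (rule lin_ext_homs[OF X Y r_fin_supp]) (use e(2) in simp)
qed

text \<open>Composition with \<open>l \<otimes> u\<close> transforms the value on the unit element
  by \<open>push\<close>, which adds up coefficients along the fibres of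
  \<open>h \<mapsto> u \<cdot> h\<close>. The additive map \<open>r\<close> commutes with such sums,
  and linear forms reduce the claim to a regrouping of a finite sum.\<close>

lemma ret_hom_nat:
  assumes X: "X \<in> obj C" and t: "t \<in> homs (ext_cat C \<phi>) (ext_obj C \<phi> X) (ext_obj C \<phi> Y)" and u: "u \<in> homs C Y Z"
  shows "ret_hom X Z (ext_arr C \<phi> u \<cdot>\<^bsub>ext_cat C \<phi>\<^esub> t) = u \<cdot> ret_hom X Y t"
proof -
  have u' [simp]: "u \<in> arr C" "src C u = Y" "tgt C u = Z" using u by (auto simp: homs_iff)
  have Y: "Y \<in> obj C" and Z: "Z \<in> obj C" using src_tgt_obj[OF u'(1)] by simp_all
  define P where "P = snd (snd t) X (unit_elem X)"
  have P: "P \<in> carrier (tensor_space UNIV \<phi> (hspace C X Y))" unfolding P_def by (rule hom_value[OF X t])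
  define Q where "Q = (\<Union>g\<in>P. tensor_class UNIV \<phi> (hspace C X Z) (push (\<lambda>h. u \<cdot> h) g))"
  obtain F G \<eta> where t_eq: "t = (F, G, \<eta>)" by (cases t)
  have FG: "F = ext_obj C \<phi> X" "G = ext_obj C \<phi> Y"
    using t by (auto simp: homs_def ext_cat_simps t_eq)
  have "snd (snd (ext_arr C \<phi> u \<cdot>\<^bsub>ext_cat C \<phi>\<^esub> t)) X (unit_elem X) = Q"
    using X unit_elem(1)[OF X] P
    by (simp add: t_eq FG ext_cat_simps ind_lmodule_cat_def ext_arr_def P_def Q_def ext_obj_def)
  then have 1: "ret_hom X Z (ext_arr C \<phi> u \<cdot>\<^bsub>ext_cat C \<phi>\<^esub> t) = ret (hspace C X Z) Q"
    by (simp add: ret_hom_def)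
  have push: "push (\<lambda>h. u \<cdot> h) g \<in> fin_supp (homs C X Z)" if g: "g \<in> fin_supp (homs C X Y)" for g :: "'a \<Rightarrow> 'l"
  proof -
    have "{w. push (\<lambda>h. u \<cdot> h) g w \<noteq> 0} \<subseteq> (\<lambda>h. u \<cdot> h) ` {v. g v \<noteq> 0}"
      unfolding push_def by (auto intro: sum.neutral ccontr elim!: sum.not_neutral_contains_not_neutral)
    moreover have "(\<lambda>h. u \<cdot> h) ` {v. g v \<noteq> 0} \<subseteq> homs C X Z"
      using g by (auto simp: fin_supp_def homs_iff)
    ultimately show ?thesis using g finite_subset unfolding fin_supp_def by blast
  qed
  obtain g0 where g0: "g0 \<in> P" using tensor_space_nonempty[OF P] by blast
  have "push (\<lambda>h. u \<cdot> h) g0 \<in> Q"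
    unfolding Q_def using g0 tensor_class_self[OF push[of g0, folded hspace_simps(1)]]
      ret_eq(2)[OF hspace_module[OF X Y] P g0] by auto
  then have "(SOME f. f \<in> Q) \<in> Q" by (rule someI[of "\<lambda>f. f \<in> Q"])
  then obtain g where g: "g \<in> P" "(SOME f. f \<in> Q) \<in> tensor_class UNIV \<phi> (hspace C X Z) (push (\<lambda>h. u \<cdot> h) g)"
    unfolding Q_def by blast
  have gf: "g \<in> fin_supp (homs C X Y)" using ret_eq(2)[OF hspace_module[OF X Y] P g(1)] by simp
  have 2: "ret (hspace C X Z) Q = lin_ext (hspace C X Z) id (\<lambda>x. r (push (\<lambda>h. u \<cdot> h) g x))"
    unfolding ret_def using ret_tensor_class[OF hspace_module[OF X Z] _ g(2)] push[OF gf] by simp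
  have 3: "ret_hom X Y t = lin_ext (hspace C X Y) id (\<lambda>x. r (g x))"
    unfolding ret_hom_def P_def[symmetric] by (rule ret_eq(1)[OF hspace_module[OF X Y] P g(1)])
  have rg: "(\<lambda>x. r (g x)) \<in> fin_supp (homs C X Y)" by (rule r_fin_supp[OF gf])
  have rpg: "(\<lambda>x. r (push (\<lambda>h. u \<cdot> h) g x)) \<in> fin_supp (homs C X Z)" by (rule r_fin_supp[OF push[OF gf]])
  let ?S = "{v. g v \<noteq> 0}"
  have S: "finite ?S" using gf by (simp add: fin_supp_def)
  have "lin_ext (hspace C X Z) id (\<lambda>x. r (push (\<lambda>h. u \<cdot> h) g x)) = u \<cdot> lin_ext (hspace C X Y) id (\<lambda>x. r (g x))"
  proof (rule hom_eqI'[where X = X and Y = Z])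
    show "lin_ext (hspace C X Z) id (\<lambda>x. r (push (\<lambda>h. u \<cdot> h) g x)) \<in> homs C X Z"
      by (rule lin_ext_homs[OF X Z rpg])
    show "u \<cdot> lin_ext (hspace C X Y) id (\<lambda>x. r (g x)) \<in> homs C X Z"
      using lin_ext_homs[OF X Y rg] by (simp add: homs_iff)
    fix p assume p: "hform X Z p"
    have "p (lin_ext (hspace C X Z) id (\<lambda>x. r (push (\<lambda>h. u \<cdot> h) g x))) =
      (\<Sum>w\<in>(\<lambda>h. u \<cdot> h) ` ?S. r (push (\<lambda>h. u \<cdot> h) g w) * p w)"
      using S by (intro hform_lin_ext[OF p rpg])
        (auto simp: push_def r_sum elim!: sum.not_neutral_contains_not_neutral)
    also have "\<dots> = (\<Sum>w\<in>(\<lambda>h. u \<cdot> h) ` ?S. \<Sum>v\<in>{v. v \<in> ?S \<and> u \<cdot> v = w}. r (g v) * p (u \<cdot> v))"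
      by (intro sum.cong) (auto simp: push_def r_sum sum_distrib_right intro!: sum.cong)
    also have "\<dots> = (\<Sum>v\<in>?S. r (g v) * p (u \<cdot> v))"
      by (rule sum.image_gen[OF S, symmetric])
    also have "\<dots> = p (u \<cdot> lin_ext (hspace C X Y) id (\<lambda>x. r (g x)))"
      by (rule hform_lin_ext[OF hform_cmp_left[OF p u'] rg S, symmetric]) auto
    finally show "p (lin_ext (hspace C X Z) id (\<lambda>x. r (push (\<lambda>h. u \<cdot> h) g x))) = p (u \<cdot> lin_ext (hspace C X Y) id (\<lambda>x. r (g x)))" .
  qed
  then show ?thesis using 1 2 3 by simp
qed

lemma ret_hom_idt:
  assumes X: "X \<in> obj C"
  shows "ret_hom X X (idt (ext_cat C \<phi>) (ext_obj C \<phi> X)) = idt C X"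
proof -
  have "snd (snd (idt (ext_cat C \<phi>) (ext_obj C \<phi> X))) X (unit_elem X) = unit_elem X"
    using X unit_elem(1)[OF X] by (simp add: ext_cat_simps ind_lmodule_cat_def)
  then have "ret_hom X X (idt (ext_cat C \<phi>) (ext_obj C \<phi> X)) = ret (hspace C X X) (unit_elem X)"
    by (simp add: ret_hom_def)
  also have "\<dots> = lin_ext (hspace C X X) id (\<lambda>x. r (single (idt C X) x))"
    using unit_elem[OF X] by (intro ret_eq(1)[OF hspace_module[OF X X]]) (simp_all add: ext_obj_def)
  also have "(\<lambda>x. r (single (idt C X) x)) = single (idt C X)"
    by (auto simp: single_def r)
  also have "lin_ext (hspace C X X) id (single (idt C X)) = id (idt C X)"
    by (rule lin_ext_single[OF hspace_module[OF X X]]) (simp add: X homs_iff)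
  finally show ?thesis by simp
qed

end

text \<open>The pulled back form is the \<open>l\<close>-linear extension of
  \<open>\<phi> \<circ> \<omega>\<close> to \<open>D_l\<close>. By bijectivity in
  \<open>is_scalar_extension\<close> every element has representatives, and any two of them lie in
  one tensor class, on which the extension is constant; so \<open>the_elem\<close> in
  \<open>pull1\<close> is meaningful.\<close>

lemma pull1_extension_morphism:
  fixes D :: "('k::field_char_0, 'd::ab_group_add) dfield" and Dl :: "('l::field_char_0, 'e::ab_group_add) dfield"
  assumes D: "differential_field D" and \<phi>: "field_hom \<phi>" and ext: "D_field_extension D \<phi> dl Dl j"
    and \<omega>: "\<omega> \<in> forms1 D"
  shows "pull1 \<phi> (extension_morphism Dl j) \<omega> \<in> forms1 Dl"
    "pull1 \<phi> (extension_morphism Dl j) \<omega> (j x) = \<phi> (\<omega> x)"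
proof -
  have Dl: "differential_field Dl" using ext by (simp add: D_field_extension_def)
  interpret k: diff_field D by unfold_locales (rule D)
  interpret l: diff_field Dl by unfold_locales (rule Dl)
  let ?W = "tspace (*) :: ('l, 'l) module" and ?k = "\<lambda>x. \<phi> (\<omega> x)" and ?\<Theta> = "extension_morphism Dl j"
  have cD [simp]: "carrier (dspace D) = UNIV" "carrier (dspace Dl) = UNIV" "carrier ?W = UNIV"
    by (simp_all add: tspace_def)
  have se: "is_scalar_extension UNIV \<phi> (dspace D) (dspace Dl) j" using ext by (simp add: D_field_extension_def)
  then have j: "semilin_map UNIV \<phi> (dspace D) (dspace Dl) j"
    and bij: "bij_betw (\<lambda>P. the_elem (lin_ext (dspace Dl) j ` P)) (carrier (tensor_space UNIV \<phi> (dspace D))) UNIV"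
    by (simp_all add: is_scalar_extension_def)
  have cl: "closed_under UNIV (dspace D)" by (rule module_closed_under[OF k.scl_module])
  have kl: "semilin_map UNIV \<phi> (dspace D) ?W ?k"
    using \<phi> \<omega> by (simp add: semilin_map_def tspace_def field_hom_def k.forms1_simps)
  have te: "the_elem (lin_ext (dspace Dl) j ` tensor_class UNIV \<phi> (dspace D) f) = lin_ext (dspace Dl) j f"
    if "f \<in> fin_supp UNIV" for f
    by (rule the_elem_lin_ext[OF cl l.scl_module j]) (simp add: that)
  define L where "L f = lin_ext ?W ?k f" for f
  have L_eq: "L f = (\<Sum>v\<in>{v. f v \<noteq> 0}. f v * \<phi> (\<omega> v))" if "f \<in> fin_supp UNIV" for f
    using linear_form_lin_ext[OF line_module, of id ?k "dspace D" f] that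
    by (simp add: L_def linear_form_def tspace_def)
  have L_cong: "L f = L g" if "f \<in> ?\<Theta> \<delta>" "g \<in> ?\<Theta> \<delta>" for f g \<delta>
  proof -
    have fg: "f \<in> fin_supp UNIV" "g \<in> fin_supp UNIV" "lin_ext (dspace Dl) j f = lin_ext (dspace Dl) j g"
      using that by (auto simp: extension_morphism_def)
    have "tensor_class UNIV \<phi> (dspace D) f = tensor_class UNIV \<phi> (dspace D) g"
      by (rule inj_onD[OF bij_betw_imp_inj_on[OF bij]]) (use fg in \<open>auto simp: te tensor_space_def\<close>)
    then have "f \<in> tensor_class UNIV \<phi> (dspace D) g"
      using tensor_class_self[of f "dspace D" UNIV \<phi>] fg by simp
    then show ?thesis unfolding L_def using fg by (intro lin_ext_tensor_class[OF cl line_module kl]) simp_all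
  qed
  have pull: "pull1 \<phi> ?\<Theta> \<omega> \<delta> = L f" if f: "f \<in> ?\<Theta> \<delta>" for f \<delta>
  proof -
    have "(\<lambda>f. \<Sum>v\<in>{v. f v \<noteq> 0}. f v * \<phi> (\<omega> v)) ` ?\<Theta> \<delta> = L ` ?\<Theta> \<delta>"
      by (intro image_cong refl) (simp add: L_eq extension_morphism_def)
    also have "\<dots> = {L f}" using L_cong f by blast
    finally show ?thesis by (simp add: pull1_def)
  qed
  have ex: "\<exists>f. f \<in> ?\<Theta> \<delta>" for \<delta>
  proof -
    have "\<delta> \<in> (\<lambda>P. the_elem (lin_ext (dspace Dl) j ` P)) ` carrier (tensor_space UNIV \<phi> (dspace D))"
      unfolding bij_betw_imp_surj_on[OF bij] by simp
    then obtain P where P: "P \<in> carrier (tensor_space UNIV \<phi> (dspace D))" "the_elem (lin_ext (dspace Dl) j ` P) = \<delta>"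
      by blast
    then obtain f where f: "f \<in> fin_supp UNIV" "P = tensor_class UNIV \<phi> (dspace D) f" by (auto simp: tensor_space_def)
    then show ?thesis using P(2) te by (auto simp: extension_morphism_def)
  qed
  show "pull1 \<phi> ?\<Theta> \<omega> (j x) = \<phi> (\<omega> x)"
  proof -
    have "single x \<in> ?\<Theta> (j x)"
      using lin_ext_single[OF l.scl_module, of j x] by (simp add: extension_morphism_def single_fin_supp)
    moreover have "L (single x) = \<phi> (\<omega> x)" unfolding L_def by (rule lin_ext_single[OF line_module]) simp
    ultimately show ?thesis by (simp add: pull)
  qed
  show "pull1 \<phi> ?\<Theta> \<omega> \<in> forms1 Dl"
    unfolding forms1_def
  proof (intro CollectI conjI allI)
    fix \<delta> \<epsilon>
    obtain f g where fg: "f \<in> ?\<Theta> \<delta>" "g \<in> ?\<Theta> \<epsilon>" using ex by metis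
    then have fs: "f \<in> fin_supp UNIV" "g \<in> fin_supp UNIV" "lin_ext (dspace Dl) j f = \<delta>" "lin_ext (dspace Dl) j g = \<epsilon>"
      by (auto simp: extension_morphism_def)
    have "lin_ext (dspace Dl) j (\<lambda>x. f x + g x) = \<delta> + \<epsilon>"
      using lin_ext_add[OF l.scl_module, of j "dspace D" f g] fs by (simp add: tspace_def)
    then have "(\<lambda>x. f x + g x) \<in> ?\<Theta> (\<delta> + \<epsilon>)" using fs by (simp add: extension_morphism_def fin_supp_add)
    moreover have "L (\<lambda>x. f x + g x) = L f + L g"
      using lin_ext_add[OF line_module, of ?k "dspace D" f g] fs by (simp add: L_def tspace_def)
    ultimately show "pull1 \<phi> ?\<Theta> \<omega> (\<delta> + \<epsilon>) = pull1 \<phi> ?\<Theta> \<omega> \<delta> + pull1 \<phi> ?\<Theta> \<omega> \<epsilon>"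
      using fg by (simp add: pull)
  next
    fix a \<delta>
    obtain f where f: "f \<in> ?\<Theta> \<delta>" using ex by metis
    then have fs: "f \<in> fin_supp UNIV" "lin_ext (dspace Dl) j f = \<delta>"
      by (auto simp: extension_morphism_def)
    have "lin_ext (dspace Dl) j (\<lambda>x. a * f x) = scl Dl a \<delta>"
      using lin_ext_smult[OF l.scl_module, of j "dspace D" f a] fs by (simp add: tspace_def)
    then have "(\<lambda>x. a * f x) \<in> ?\<Theta> (scl Dl a \<delta>)" using fs by (simp add: extension_morphism_def fin_supp_smult)
    moreover have "L (\<lambda>x. a * f x) = a * L f"
      using lin_ext_smult[OF line_module, of ?k "dspace D" f a] fs by (simp add: L_def tspace_def)
    ultimately show "pull1 \<phi> ?\<Theta> \<omega> (scl Dl a \<delta>) = a * pull1 \<phi> ?\<Theta> \<omega> \<delta>"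
      using f by (simp add: pull)
  qed
qed

theorem proposition3p12:
  fixes D :: "('k::field_char_0, 'd::ab_group_add) dfield"
    and C :: "('o, 'a, 'k) lcat"
    and T :: "('o, 'a) tensor_data"
    and A :: "('k, 'd, 'o, 'a) at_data"
    and X :: "'o"
    and \<phi> :: "'k \<Rightarrow> 'l::field_char_0"
    and dl :: "'d \<Rightarrow> 'l \<Rightarrow> 'l"
    and Dl :: "('l, 'e::ab_group_add) dfield"
    and j :: "'d \<Rightarrow> 'e"
    and Tl :: "(('o, 'a, 'l) ext_ob, ('o, 'a, 'l) ext_ar) tensor_data"
    and Al :: "('l, 'e, ('o, 'a, 'l) ext_ob, ('o, 'a, 'l) ext_ar) at_data"
    and DK :: "('K::field_char_0, 'f::ab_group_add) dfield"
    and \<psi> :: "'k \<Rightarrow> 'K"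
    and \<Theta> :: "'f \<Rightarrow> ('d \<Rightarrow> 'K) set"
    and TK :: "(('K, 'w) module, ('K, 'w) vect_arr) tensor_data"
    and AK :: "('K, 'f, ('K, 'w) module, ('K, 'w) vect_arr) at_data"
    and Fo :: "'o \<Rightarrow> ('K, 'w) module"
    and Fa :: "'a \<Rightarrow> ('K, 'w) vect_arr"
    and G :: "('o, ('K, 'w) vect_arr) dfun_data"
  assumes "differential_field D"
    and "D_category D C T A"
    and "finite_category C"
    and "X \<in> obj C"
    and "D_field D \<phi> dl"
    and "D_field_extension D \<phi> dl Dl j"
    and "canonical_extension D Dl \<phi> (extension_morphism Dl j) C T A Tl Al"
    and "filtered_linearly_closed D"
    and "differential_field DK"
    and "differential_morphism D DK \<psi> \<Theta>"
    and "canonical_vect DK TK AK"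
    and "differential_functor D DK \<psi> \<Theta> C T A vect_cat TK AK Fo Fa G"
    and "faithful C Fa"
  shows "(\<exists>s. D_structure C A X s) \<longleftrightarrow> (\<exists>s. D_structure (ext_cat C \<phi>) Al (ext_obj C \<phi> X) s)"
proof -
  obtain H where H: "differential_functor D Dl \<phi> (extension_morphism Dl j) C T A (ext_cat C \<phi>) Tl Al (ext_obj C \<phi>) (ext_arr C \<phi>) H"
    "\<And>X. X \<in> obj C \<Longrightarrow> is_iso (ext_cat C \<phi>) (ext_obj C \<phi> (aob (at1 A) X)) (aob (at1 Al) (ext_obj C \<phi> X)) (th1 H X)"
    "\<And>X. X \<in> obj C \<Longrightarrow> is_iso (ext_cat C \<phi>) (ext_obj C \<phi> (aob (at2 A) X)) (aob (at2 Al) (ext_obj C \<phi> X)) (th2 H X)"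
    and DC: "D_category Dl (ext_cat C \<phi>) Tl Al"
    using assms(7) unfolding canonical_extension_def by blast
  have lin: "linear_category C" "linear_category (ext_cat C \<phi>)"
    using assms(2) DC by (simp_all add: D_category_def abelian_category_def)
  have \<phi>: "field_hom \<phi>" using assms(5) by (simp add: D_field_def)
  have Dl: "differential_field Dl" and lie: "\<And>x y. lie Dl (j x) (j y) = j (lie D x y)"
    using assms(6) by (simp_all add: D_field_extension_def)
  obtain r where r: "scalar_retraction \<phi> r" using scalar_retraction_exists[OF \<phi>] .
  interpret E: ext_retraction C \<phi> r by (intro ext_retraction.intro lin_category.intro lin r)
  interpret F: d_functor D C T A Dl "ext_cat C \<phi>" Tl Al \<phi> "extension_morphism Dl j" j "ext_obj C \<phi>" "ext_arr C \<phi>" H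
    by (intro d_functor.intro d_category.intro diff_field.intro lin_category.intro d_category_axioms.intro
        d_functor_axioms.intro) (fact assms Dl lin DC \<phi> H lie pull1_extension_morphism[OF assms(1) \<phi> assms(6)])+
  \<comment> \<open>Linear closedness speaks of finite-dimensional modules only, so the extension of
    \<open>k\<close> by \<open>End X\<close> has to be one.\<close>
  have "fin_dim (hspace C X X)" using assms(3,4) by (simp add: finite_category_def)
  from F.D_structure_iff[OF assms(4) this assms(8), of "E.ret_hom X"] show ?thesis
    using E.ret_hom_typ[OF assms(4)] E.ret_hom_nat[OF assms(4)] E.ret_hom_idt[OF assms(4)] by blast
qed

end
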